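(* Assume the explicit $abc$-conjecture (as stated in the context). Then for every integer $d\geq 3$ and every nonzero integer $c$, if the polynomial $f(z)=z^d+\frac{1}{c}$ is irreducible over $\mathbb{Q}$, then $f(z)$ is stable over $\mathbb{Q}$.
   Context: For a polynomial $f$, $f^n$ denotes the $n$-th iterate under composition: $f^1=f$ and $f^n(z)=f(f^{n-1}(z))$. A polynomial $f(z)\in\mathbb{Q}[z]$ is called stable over $\mathbb{Q}$ if $f^n(z)$ is irreducible over $\mathbb{Q}$ for every $n\geq 1$. For a positive integer $m$, the radical $N(m)$ is the product of the distinct primes dividing $m$, and $\omega(m)$ is the number of distinct primes dividing $m$. Explicit $abc$-conjecture (Baker): for all pairwise coprime positive integers $a,b,c$ with $a+b=c$ and $N>2$, where $N=N(abc)$ and $\omega=\omega(N)$, one has $$c<\frac{6}{5}\,N\,\frac{(\log N)^{\omega}}{\omega!},$$ where $\log$ is the natural logarithm. *)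

theory Defs
  imports Complex_Main "HOL-Computational_Algebra.Polynomial_Factorial"
begin

definition nat_radical :: "nat \<Rightarrow> nat"
  where "nat_radical m = \<Prod>(prime_factors m)"

definition prime_omega :: "nat \<Rightarrow> nat"
  where "prime_omega m = card (prime_factors m)"

definition explicit_abc_conjecture :: bool
  where "explicit_abc_conjecture \<longleftrightarrow>
    (\<forall>a b c :: nat. a > 0 \<longrightarrow> b > 0 \<longrightarrow> c > 0 \<longrightarrow>
       coprime a b \<longrightarrow> coprime a c \<longrightarrow> coprime b c \<longrightarrow> a + b = c \<longrightarrow>
       (let N = nat_radical (a * b * c); w = prime_omega N
        in N > 2 \<longrightarrow> real c < 6 / 5 * real N * (ln (real N) ^ w / fact w)))"

(* The 0th iterate is the polynomial X. *)
definition poly_iterate :: "nat \<Rightarrow> 'a::comm_semiring_1 poly \<Rightarrow> 'a poly"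
  where "poly_iterate n f = (pcompose f ^^ n) [:0, 1:]"

lemma poly_iterate_1: "poly_iterate 1 f = f"
  by (simp add: poly_iterate_def)

lemma poly_iterate_Suc: "poly_iterate (Suc n) f = pcompose f (poly_iterate n f)"
  by (simp add: poly_iterate_def)

definition stable_over_Q :: "rat poly \<Rightarrow> bool"
  where "stable_over_Q f \<longleftrightarrow> (\<forall>n\<ge>1. irreducible (poly_iterate n f))"

end

theory Submission
  imports Defs
    "HOL-Computational_Algebra.Fundamental_Theorem_Algebra"
    "HOL-Computational_Algebra.Nth_Powers"
begin

text \<open>
  Let \<open>f = z^d + 1/c\<close>. The proof turns reducibility of an iterate into an equation between coprime integers
  that the \<open>abc\<close> inequality forbids.

  The algebraic half is Capelli's lemma (\<open>irreducible_over_pcompose_tower\<close>) combined with taking norms. If \<open>P\<close> is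
  irreducible over a field \<open>K\<close> and \<open>P \<circ> f\<close> is not, then for a root \<open>\<alpha>\<close> of \<open>P\<close> the polynomial \<open>x^d - (\<alpha> - 1/c)\<close> is
  reducible over \<open>K(\<alpha>)\<close>; this makes the norm of \<open>\<alpha> - 1/c\<close>, which is \<open>P(1/c)\<close> up to sign, a \<open>p\<close>-th power in \<open>K\<close> for
  some prime \<open>p\<close> dividing \<open>d\<close> (\<open>iterate_step\<close>). For \<open>K = \<rat>\<close> and \<open>P = f^n\<close> that value is \<open>f^(n+1)(0)\<close>, a fraction with
  denominator \<open>c^(d^n)\<close>, whose numerators satisfy \<open>a' = a^d + c^m\<close> with \<open>m = d^n - 1\<close>. So a reducible iterate gives
  \<open>a^d + c^m = y^p\<close> with coprime terms.

  From Baker's inequality one gets \<open>a + b < rad(ab(a+b))^(15/8)\<close> (\<open>abc_power_bound\<close>). For odd \<open>p\<close> and \<open>d \<ge> 5\<close> this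
  contradicts the equation directly. For \<open>p = 2\<close> and positive \<open>c\<close> the equation is first written as \<open>(y - b)(y + b) = c^m\<close> with \<open>b^2 = a^d\<close>. For \<open>c \<le> -2\<close> and even \<open>d\<close> the numerators are negative from
  the second one on, hence not squares.

  Degree three, and degree four with \<open>c > 0\<close>, need more, and indeed \<open>f^2(0) = 9/16\<close> is a square for \<open>d = 4\<close>,
  \<open>c = 2\<close>. There the argument is run over a larger field: \<open>K = \<rat>(\<delta>)\<close> with \<open>\<delta>^2 = -1/c\<close> and
  \<open>P = (f^n)^2 - \<delta>\<close> in degree four, \<open>K = \<rat>(\<alpha>)\<close> with \<open>\<alpha>\<close> a
  root of \<open>f\<close> and \<open>P = f^n - \<alpha>\<close> in degree three. Capelli's lemma returns from irreducibility of \<open>P\<close> over \<open>K\<close> to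
  irreducibility of \<open>f^(n+1)\<close> over \<open>\<rat>\<close>. Comparing coordinates in \<open>P(1/c) = w^2\<close> or \<open>P(1/c) = w^3\<close> gives several
  rational equations; together they lead to \<open>u^m + v^m = w^m\<close> with small coefficients and large \<open>m\<close>
  (\<open>quartic_obstruction\<close>, \<open>cubic_obstruction\<close>), which \<open>abc\<close> excludes. The first iterates, for which \<open>m\<close> is too
  small, are settled by hand: two positive cubes do not differ by one or two, and \<open>c^2 + 1\<close> is a cube only for \<open>c = 0\<close>.
\<close>

section \<open>A power-saving form of the explicit abc inequality\<close>

text \<open>
  The largest element is at least one more than the number of elements; remove it and induct.
\<close>

lemma fact_card_le_prod:
  fixes S :: "nat set"
  assumes "finite S" "\<And>x. x \<in> S \<Longrightarrow> 2 \<le> x"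
  shows "fact (card S + 1) \<le> \<Prod>S"
  using assms
proof (induction "card S" arbitrary: S)
  case 0
  then show ?case by simp
next
  case (Suc k)
  define M where "M = Max S"
  have "S \<noteq> {}" using Suc.hyps(2) by auto
  then have M: "M \<in> S" "S \<subseteq> {2..M}"
    using Suc.prems by (auto simp: M_def)
  have "card S \<le> card {2..M}" using M by (intro card_mono) auto
  then have cM: "card S + 1 \<le> M" using Suc.hyps(2) by simp
  have cardS: "card (S - {M}) = k" using M Suc.prems(1) Suc.hyps(2) by simp
  have IH: "fact (k + 1) \<le> \<Prod>(S - {M})"
    using Suc.hyps(1)[of "S - {M}"] cardS Suc.prems by auto
  have "fact (card S + 1) = (card S + 1) * fact (k + 1)"
    using Suc.hyps(2)[symmetric] by simp
  also have "\<dots> \<le> M * \<Prod>(S - {M})"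
    using cM IH by (intro mult_mono) auto
  also have "\<dots> = \<Prod>S" using M Suc.prems(1) prod.remove[of S M "\<lambda>x. x"] by simp
  finally show ?case .
qed

text \<open>
  This is \<open>t \<le> exp (t - 1)\<close> for \<open>t = L / (C w)\<close>, raised to the power \<open>w\<close>. The bound is sharp at \<open>L = C w\<close>, so \<open>C\<close> is
  chosen according to the size of \<open>L\<close>.
\<close>

lemma power_le_exp_scaled:
  fixes C L :: real
  assumes "C > 0" "L \<ge> 0" "w > 0"
  shows "L ^ w \<le> (C * real w) ^ w * exp (L / C - real w)"
proof -
  let ?x = "L / (C * real w)"
  have "?x \<le> exp (?x - 1)" using exp_ge_add_one_self[of "?x - 1"] by simp
  moreover have "?x \<ge> 0" using assms by simp
  ultimately have "?x ^ w \<le> exp (?x - 1) ^ w" by (intro power_mono)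
  also have "\<dots> = exp (real w * (?x - 1))" by (simp add: exp_of_nat_mult)
  also have "real w * (?x - 1) = L / C - real w" using assms by (simp add: field_simps)
  finally have "L ^ w / (C * real w) ^ w \<le> exp (L / C - real w)" by (simp add: power_divide)
  then show ?thesis using assms by (simp add: field_simps)
qed

lemma power_self_le_fact_exp: "real w ^ w \<le> fact w * exp (real w)"
proof -
  have "(\<Sum>n\<in>{w}. real w ^ n /\<^sub>R fact n) \<le> exp (real w)"
    unfolding exp_def by (intro sum_le_suminf summable_exp_generic) auto
  then show ?thesis by (simp add: field_simps)
qed

lemma exp_one_ge: "exp (1::real) \<ge> 271 / 100"
proof -
  have "(145 / 128 :: real) \<le> exp (1/8)"
    using exp_lower_Taylor_quadratic[of "1/8::real"] by (simp add: power2_eq_square)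
  then have "(145 / 128 :: real) ^ 8 \<le> exp (1/8) ^ 8" by (intro power_mono) auto
  also have "exp (1/8) ^ 8 = exp (1::real)" by (simp flip: exp_of_nat_mult)
  finally show ?thesis by (simp add: field_simps)
qed

lemma exp_two_le: "exp (2::real) \<le> 8"
proof -
  have "(15 / 16 :: real) \<le> exp (- 1/16)"
    using exp_ge_add_one_self[of "- 1/16::real"] by simp
  then have "exp (1 / 16::real) \<le> 16 / 15"
    by (simp add: exp_minus field_simps)
  then have "exp (1/16) ^ 32 \<le> (16 / 15 :: real) ^ 32" by (intro power_mono) auto
  moreover have "exp (1/16) ^ 32 = exp (2::real)" by (simp flip: exp_of_nat_mult)
  ultimately show ?thesis by (simp add: field_simps)
qed

text \<open>
  As a function of \<open>L\<close> the quotient of the two sides is largest at \<open>L = 8 w / 7\<close>. Up to \<open>w = 15\<close> even this maximum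
  is below one, so no lower bound on \<open>L\<close> in terms of \<open>w\<close> is used.
\<close>

lemma log_power_le_exp_small:
  fixes L :: real
  assumes "L \<ge> 0" "w > 0" "w \<le> 15"
  shows "6 / 5 * (L ^ w / fact w) \<le> exp (7 / 8 * L)"
proof -
  have "w = 1 \<or> w = 2 \<or> w = 3 \<or> w = 4 \<or> w = 5 \<or> w = 6 \<or> w = 7 \<or> w = 8 \<or> w = 9 \<or>
      w = 10 \<or> w = 11 \<or> w = 12 \<or> w = 13 \<or> w = 14 \<or> w = 15"
    using assms(2,3) by presburger
  \<comment> \<open>The maximum is compared numerically, with 2.71 in place of e.\<close>
  then have *: "6 / 5 * (8 / 7 * real w) ^ w \<le> fact w * (271/100) ^ w"
    by (elim disjE; simp add: fact_numeral field_simps)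
  have e: "(271/100) ^ w \<le> exp (real w)"
    using power_mono[OF exp_one_ge, of w] by (simp flip: exp_of_nat_mult)
  have "6 / 5 * L ^ w \<le> 6 / 5 * ((8 / 7 * real w) ^ w * exp (L / (8/7) - real w))"
    using power_le_exp_scaled[of "8/7" L w] assms by simp
  also have "\<dots> = 6 / 5 * (8 / 7 * real w) ^ w * exp (L / (8/7) - real w)" by simp
  also have "\<dots> \<le> (fact w * exp (real w)) * exp (L / (8/7) - real w)"
    by (intro mult_right_mono order.trans[OF *] mult_left_mono e) auto
  also have "\<dots> = fact w * exp (7 / 8 * L)" by (simp add: exp_diff)
  finally show ?thesis by (simp add: field_simps)
qed

text \<open>
  The maximum over all \<open>L\<close> grows like \<open>(8/7)^w\<close>, so for many primes one needs that \<open>L\<close> is far beyond the point where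
  it is attained. From \<open>L = 2 w\<close> on, the scaled exponential bound with \<open>C = 2\<close> leaves \<open>2^w\<close> against \<open>exp (3 L / 8)\<close>, and
  \<open>exp (3/4) > 2\<close>.
\<close>

lemma log_power_le_exp_large:
  fixes L :: real
  assumes "w \<ge> 16" "L \<ge> 2 * real w"
  shows "6 / 5 * (L ^ w / fact w) \<le> exp (7 / 8 * L)"
proof -
  have e: "65 / 32 \<le> exp (3/4 :: real)"
    using exp_lower_Taylor_quadratic[of "3/4::real"] by (simp add: power2_eq_square)
  have "6 / 5 \<le> (65 / 64 :: real) ^ 16" by (simp add: field_simps)
  also have "\<dots> \<le> (65 / 64) ^ w" using assms by (intro power_increasing) auto
  finally have "6 / 5 * 2 ^ w \<le> (65/64) ^ w * (2::real) ^ w" by (intro mult_right_mono) auto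
  also have "\<dots> = (65 / 32) ^ w" by (simp flip: power_mult_distrib)
  also have "\<dots> \<le> exp (3/4) ^ w" by (intro power_mono e) auto
  also have "\<dots> = exp (3/4 * real w)" by (simp add: mult.commute flip: exp_of_nat_mult)
  also have "\<dots> \<le> exp (3 / 8 * L)" using assms by simp
  finally have c: "6 / 5 * 2 ^ w \<le> exp (3 / 8 * L)" .
  have "L ^ w \<le> (2 * real w) ^ w * exp (L / 2 - real w)"
    using power_le_exp_scaled[of 2 L w] assms by simp
  also have "\<dots> = 2 ^ w * real w ^ w * exp (L / 2 - real w)" by (simp add: power_mult_distrib)
  also have "\<dots> \<le> 2 ^ w * (fact w * exp (real w)) * exp (L / 2 - real w)"
    by (intro mult_right_mono mult_left_mono power_self_le_fact_exp) auto
  also have "\<dots> = fact w * 2 ^ w * exp (L / 2)" by (simp add: exp_diff)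
  finally have "6 / 5 * (L ^ w / fact w) \<le> (6 / 5 * 2 ^ w) * exp (L / 2)" by (simp add: field_simps)
  also have "\<dots> \<le> exp (3 / 8 * L) * exp (L / 2)" by (intro mult_right_mono c) auto
  also have "\<dots> = exp (7 / 8 * L)" by (simp flip: exp_add)
  finally show ?thesis .
qed

lemma eight_power_le_fact: "w \<ge> 16 \<Longrightarrow> 8 ^ w \<le> (fact (w + 1) :: real)"
proof (induction w rule: nat_induct_at_least)
  case base
  then show ?case by (simp add: fact_numeral)
next
  case (Suc n)
  have "8 ^ Suc n \<le> real (n + 2) * fact (n + 1)"
    using Suc by (simp only: power_Suc) (intro mult_mono, auto)
  then show ?case by (simp add: algebra_simps)
qed

text \<open>
  The correction factor of the explicit inequality costs at most \<open>N^(7/8)\<close>. A number with \<open>w \<ge> 16\<close> distinct prime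
  factors is at least \<open>(w + 1)! \<ge> 8^w \<ge> exp (2 w)\<close>, which is the lower bound on the logarithm required for large \<open>w\<close>.
\<close>

lemma log_power_omega_le:
  assumes "N > 2"
  shows "6 / 5 * (ln (real N) ^ prime_omega N / fact (prime_omega N)) \<le> exp (7 / 8 * ln (real N))"
proof -
  define w L where "w = prime_omega N" and "L = ln (real N)"
  have "exp 1 \<le> (3::real)" by (rule exp_le)
  then have "ln (exp 1 :: real) \<le> ln (real N)" using assms by (subst ln_le_cancel_iff) auto
  then have L1: "L \<ge> 1" by (simp add: L_def)
  have "fact (w + 1) \<le> \<Prod>(prime_factors N)" unfolding w_def prime_omega_def
    by (rule fact_card_le_prod) (auto simp: in_prime_factors_iff prime_ge_2_nat)
  also have "\<dots> dvd \<Prod>\<^sub># (prime_factorization N)"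
    using prod_mset_subset_imp_dvd[of "mset_set (prime_factors N)" "prime_factorization N"]
    by (simp add: mset_set_set_mset_msubset prod_unfold_prod_mset)
  then have "\<Prod>(prime_factors N) \<le> N" using assms
    by (simp add: prod_mset_prime_factorization_nat dvd_imp_le)
  finally have f: "fact (w + 1) \<le> N" .
  consider "w = 0" | "w > 0" "w \<le> 15" | "w \<ge> 16" by linarith
  then show ?thesis unfolding w_def[symmetric] L_def[symmetric]
  proof cases
    case 1
    have "6 / 5 \<le> 7 / 8 * L + 1" using L1 by simp
    also have "\<dots> \<le> exp (7 / 8 * L)" using exp_ge_add_one_self[of "7 / 8 * L"] by (simp only: add.commute)
    finally show "6 / 5 * (L ^ w / fact w) \<le> exp (7 / 8 * L)" using 1 by simp
  next
    case 2
    then show "6 / 5 * (L ^ w / fact w) \<le> exp (7 / 8 * L)" using L1 by (intro log_power_le_exp_small) auto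
  next
    case 3
    have "exp (2 * real w) = exp 2 ^ w" by (simp add: mult.commute flip: exp_of_nat_mult)
    also have "\<dots> \<le> 8 ^ w" by (intro power_mono exp_two_le) auto
    also have "\<dots> \<le> real (fact (w + 1))" using eight_power_le_fact[OF 3] by (simp only: of_nat_fact)
    also have "\<dots> \<le> real N" using f by (simp only: of_nat_le_iff)
    finally have "ln (exp (2 * real w)) \<le> ln (real N)" using assms by (subst ln_le_cancel_iff) auto
    then have "L \<ge> 2 * real w" by (simp add: L_def)
    then show "6 / 5 * (L ^ w / fact w) \<le> exp (7 / 8 * L)" using 3 by (rule log_power_le_exp_large[rotated])
  qed
qed

lemma prod_primes_dvd:
  fixes S :: "nat set"
  assumes "finite S" "\<And>p. p \<in> S \<Longrightarrow> prime p \<and> p dvd K"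
  shows "\<Prod>S dvd K"
  using assms
proof (induction S rule: finite_induct)
  case (insert p S)
  have "coprime p (\<Prod>S)"
    using insert by (intro prod_coprime_right) (auto intro: primes_coprime)
  then show ?case using insert by (simp add: divides_mult)
qed simp

text \<open>
  The radical enters only through a number \<open>K\<close> that all the primes concerned divide; for perfect powers such a \<open>K\<close> is
  read off from the bases. The exponent \<open>15/8\<close> is stated in integral form.
\<close>

lemma abc_power_bound:
  fixes a b K :: nat
  assumes abc: explicit_abc_conjecture
    and ab: "a > 0" "b > 0" "coprime a b"
    and K: "K > 0" "\<And>p. prime p \<Longrightarrow> p dvd a * b * (a + b) \<Longrightarrow> p dvd K"
  shows "(a + b) ^ 8 < K ^ 15"
proof -
  define N where "N = nat_radical (a * b * (a + b))"
  have pos: "a * b * (a + b) > 0" using ab by simp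
  have "N dvd K" unfolding N_def nat_radical_def
    by (rule prod_primes_dvd) (use K in \<open>auto simp: in_prime_factors_iff\<close>)
  then have NK: "N \<le> K" using K by (simp add: dvd_imp_le)
  have pN: "p dvd N" if "prime p" "p dvd a * b * (a + b)" for p
    unfolding N_def nat_radical_def using that pos
    by (intro dvd_prodI[of "prime_factors _" _ "\<lambda>x. x", simplified]) (auto simp: in_prime_factors_iff)
  have N0: "N > 0" using NK K \<open>N dvd K\<close> by (auto intro: Nat.gr0I)
  have "(a + b) ^ 8 < N ^ 15"
  proof (cases "N > 2")
    case True
    have cop: "coprime a (a + b)" "coprime b (a + b)" using ab(3)
      by (simp_all add: coprime_iff_gcd_eq_1 gcd.commute[of b])
    have "real (a + b) < 6 / 5 * real N * (ln (real N) ^ prime_omega N / fact (prime_omega N))"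
      using abc[unfolded explicit_abc_conjecture_def Let_def, rule_format, of a b "a + b"] ab cop True
      by (auto simp: N_def)
    also have "\<dots> = real N * (6 / 5 * (ln (real N) ^ prime_omega N / fact (prime_omega N)))" by simp
    also have "\<dots> \<le> real N * exp (7 / 8 * ln (real N))"
      by (intro mult_left_mono log_power_omega_le True) simp
    finally have "real (a + b) ^ 8 < (real N * exp (7 / 8 * ln (real N))) ^ 8"
      by (intro power_strict_mono) auto
    also have "\<dots> = real N ^ 8 * exp (7 * ln (real N))"
      by (simp add: power_mult_distrib flip: exp_of_nat_mult)
    also have "exp (7 * ln (real N)) = real N ^ 7" using True exp_of_nat_mult[of 7 "ln (real N)"] by simp
    finally have "real ((a + b) ^ 8) < real (N ^ 15)" by (simp flip: power_add)
    then show ?thesis by (simp only: of_nat_less_iff)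
  next
    case False
    \<comment> \<open>With radical at most two, the odd ones among the three terms are equal to one; this leaves 1 + 1 = 2.\<close>
    have two: "p = 2" if "prime p" "p dvd a * b * (a + b)" for p
      using pN[OF that] False N0 prime_ge_2_nat[OF that(1)] dvd_imp_le[of p N] by linarith
    have odd1: "x = 1" if "odd x" "x dvd a * b * (a + b)" for x
      using two prime_factor_nat[of x] that by (metis dvd_trans)
    have "a = 1 \<and> b = 1"
    proof (cases "even a \<or> even b")
      case True
      have "odd (a + b)" using True ab(3) by (auto dest: coprime_common_divisor[of a b 2])
      then have "a + b = 1" by (intro odd1) auto
      then show ?thesis using ab by simp
    next
      case False
      then show ?thesis using odd1[of a] odd1[of b] by simp
    qed
    moreover have "2 dvd N" if "a = 1 \<and> b = 1" using pN[of 2] that by simp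
    ultimately have "a + b = 2" "N = 2" using False N0 by (auto elim!: dvdE)
    then show ?thesis by simp
  qed
  also have "\<dots> \<le> K ^ 15" using NK by (intro power_mono) auto
  finally show ?thesis .
qed

section \<open>Polynomials over a subfield\<close>

text \<open>
  The fields needed later are generated over \<open>\<rat>\<close> by numbers that depend on \<open>c\<close>, so they cannot be types. Hence a
  field is a set \<open>K\<close> of elements of a fixed big field, and \<open>K[x]\<close> is a set of polynomials over the big field.
\<close>

definition polys_over :: "'a::zero set \<Rightarrow> 'a poly set"
  where "polys_over K = {p. \<forall>i. coeff p i \<in> K}"

definition irreducible_over :: "'a::comm_semiring_1 set \<Rightarrow> 'a poly \<Rightarrow> bool"
  where "irreducible_over K p \<longleftrightarrow> p \<in> polys_over K \<and> degree p > 0 \<and>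
    (\<forall>a\<in>polys_over K. \<forall>b\<in>polys_over K. p = a * b \<longrightarrow> degree a = 0 \<or> degree b = 0)"

text \<open>
  The ring \<open>K[\<alpha>]\<close>; it is a field when \<open>\<alpha>\<close> is a root of an irreducible polynomial over \<open>K\<close>.
\<close>

definition adjoin :: "'a::comm_semiring_1 set \<Rightarrow> 'a \<Rightarrow> 'a set"
  where "adjoin K \<alpha> = {poly s \<alpha> | s. s \<in> polys_over K}"

lemma irreducible_overD:
  "irreducible_over K p \<Longrightarrow> p = a * b \<Longrightarrow> a \<in> polys_over K \<Longrightarrow> b \<in> polys_over K \<Longrightarrow>
    degree a = 0 \<or> degree b = 0"
  by (simp add: irreducible_over_def)

locale subfield =
  fixes K :: "'a::field set"
  assumes one_closed [simp, intro]: "1 \<in> K"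
    and diff_closed [intro]: "x \<in> K \<Longrightarrow> y \<in> K \<Longrightarrow> x - y \<in> K"
    and mult_closed [intro]: "x \<in> K \<Longrightarrow> y \<in> K \<Longrightarrow> x * y \<in> K"
    and inverse_closed [intro]: "x \<in> K \<Longrightarrow> inverse x \<in> K"
begin

lemma zero_closed [simp, intro]: "0 \<in> K"
  using diff_closed[of 1 1] by simp

lemma uminus_closed [intro]: "x \<in> K \<Longrightarrow> - x \<in> K"
  using diff_closed[of 0 x] by simp

lemma add_closed [intro]: "x \<in> K \<Longrightarrow> y \<in> K \<Longrightarrow> x + y \<in> K"
  using diff_closed[of x "- y"] by auto

lemma divide_closed [intro]: "x \<in> K \<Longrightarrow> y \<in> K \<Longrightarrow> x / y \<in> K"
  by (auto simp: divide_inverse)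

lemma power_closed [intro]: "x \<in> K \<Longrightarrow> x ^ n \<in> K"
  by (induction n) auto

lemma sum_closed [intro]: "(\<And>i. i \<in> I \<Longrightarrow> f i \<in> K) \<Longrightarrow> sum f I \<in> K"
  by (induction I rule: infinite_finite_induct) auto

lemma const_polys_over [intro]: "x \<in> K \<Longrightarrow> [:x:] \<in> polys_over K"
  by (auto simp: polys_over_def coeff_pCons split: nat.splits)

lemma pCons_polys_over_iff [simp]: "pCons x p \<in> polys_over K \<longleftrightarrow> x \<in> K \<and> p \<in> polys_over K"
proof -
  have "(\<forall>i. coeff (pCons x p) i \<in> K) \<longleftrightarrow> x \<in> K \<and> (\<forall>i. coeff p i \<in> K)"
    by (metis coeff_pCons_0 coeff_pCons_Suc not0_implies_Suc)
  then show ?thesis by (simp add: polys_over_def)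
qed

lemma coeff_closed [intro]: "p \<in> polys_over K \<Longrightarrow> coeff p i \<in> K"
  by (simp add: polys_over_def)

lemma zero_polys_over [simp, intro]: "0 \<in> polys_over K"
  by (auto simp: polys_over_def)

lemma one_polys_over [simp, intro]: "1 \<in> polys_over K"
  by (simp add: one_pCons)

lemma monom_polys_over [intro]: "x \<in> K \<Longrightarrow> monom x n \<in> polys_over K"
  by (auto simp: polys_over_def)

lemma diff_polys_over [intro]: "p \<in> polys_over K \<Longrightarrow> q \<in> polys_over K \<Longrightarrow> p - q \<in> polys_over K"
  by (auto simp: polys_over_def)

lemma add_polys_over [intro]: "p \<in> polys_over K \<Longrightarrow> q \<in> polys_over K \<Longrightarrow> p + q \<in> polys_over K"
  by (auto simp: polys_over_def)

lemma mult_polys_over [intro]: "p \<in> polys_over K \<Longrightarrow> q \<in> polys_over K \<Longrightarrow> p * q \<in> polys_over K"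
  by (auto simp: polys_over_def coeff_mult)

lemma smult_polys_over [intro]: "x \<in> K \<Longrightarrow> q \<in> polys_over K \<Longrightarrow> smult x q \<in> polys_over K"
  by (auto simp: polys_over_def)

lemma power_polys_over [intro]: "p \<in> polys_over K \<Longrightarrow> p ^ n \<in> polys_over K"
  by (induction n) auto

lemma poly_closed [intro]: "p \<in> polys_over K \<Longrightarrow> x \<in> K \<Longrightarrow> poly p x \<in> K"
  by (auto simp: poly_altdef)

lemma pcompose_polys_over [intro]:
  assumes "p \<in> polys_over K" "q \<in> polys_over K" shows "pcompose p q \<in> polys_over K"
  using assms(1)
proof (induction p)
  case (pCons a p)
  then have "a \<in> K" "p \<in> polys_over K" by auto
  then show ?case using pCons.IH assms(2) by (auto simp: pcompose_pCons)
qed simp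

text \<open>
  Each step of long division only uses field operations on the coefficients.
\<close>

lemma division_polys_over:
  assumes g: "g \<in> polys_over K" "g \<noteq> 0" and p: "p \<in> polys_over K"
  shows "p div g \<in> polys_over K \<and> p mod g \<in> polys_over K"
  using p
proof (induction "degree p" arbitrary: p rule: less_induct)
  case less
  show ?case
  proof (cases "degree p < degree g \<or> p = 0")
    case True
    then show ?thesis using less.prems by (auto simp: div_poly_less mod_poly_less)
  next
    case False
    define t where "t = monom (lead_coeff p / lead_coeff g) (degree p - degree g)"
    define p' where "p' = p - t * g"
    have t: "t \<in> polys_over K" using g less.prems by (auto simp: t_def)
    have p': "p' \<in> polys_over K" using t g less.prems by (auto simp: p'_def)
    have p_eq: "p = p' + t * g" by (simp add: p'_def)
    have "p' div g \<in> polys_over K \<and> p' mod g \<in> polys_over K"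
    proof (cases "degree p = 0")
      case True
      then have dg: "degree g = 0" using False by simp
      obtain a where a: "p = [:a:]" using True by (metis degree_0_id)
      obtain b where b: "g = [:b:]" "b \<noteq> 0" using dg g(2) by (metis degree_0_id pCons_0_0)
      have "p' = 0" using a b by (simp add: p'_def t_def monom_0)
      then show ?thesis by simp
    next
      case pos: False
      have t: "degree t = degree p - degree g" "t \<noteq> 0"
        using False g(2) by (auto simp: t_def degree_monom_eq)
      have "lead_coeff t = lead_coeff p / lead_coeff g"
        unfolding t(1) by (simp add: t_def)
      then have "lead_coeff (t * g) = lead_coeff p" using g(2) by (simp only: lead_coeff_mult) simp
      moreover have "degree (t * g) = degree p" using False g(2) t by (simp add: degree_mult_eq)
      ultimately have "degree p' < degree p"
        using eq_zero_or_degree_less[of p' "degree p"] pos by (auto simp: p'_def degree_diff_le)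
      then show ?thesis using less.hyps p' by blast
    qed
    moreover have "p div g = p' div g + t" "p mod g = p' mod g"
      using g(2) by (simp_all add: p_eq)
    ultimately show ?thesis using t by auto
  qed
qed

lemma dvd_polys_overE:
  assumes "g dvd p" "g \<in> polys_over K" "p \<in> polys_over K" "p \<noteq> 0"
  obtains q where "q \<in> polys_over K" "p = g * q"
proof
  show "p div g \<in> polys_over K" using assms division_polys_over[of g p] by auto
qed (use assms in simp)

text \<open>
  A nonzero combination of \<open>s\<close> and \<open>G\<close> of least degree divides both of them, since remainders are again
  combinations. It divides the irreducible \<open>G\<close> without being associated to it, so it is constant.
\<close>

lemma bezout_over:
  assumes G: "irreducible_over K G" and s: "s \<in> polys_over K" and nd: "\<not> G dvd s"
  obtains u v where "u \<in> polys_over K" "v \<in> polys_over K" "u * s + v * G = 1"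
proof -
  define I where "I = {u * s + v * G | u v. u \<in> polys_over K \<and> v \<in> polys_over K}"
  have Gp: "G \<in> polys_over K" "degree G > 0" using G by (auto simp: irreducible_over_def)
  have sI: "s \<in> I" unfolding I_def by (rule CollectI, rule exI[of _ 1], rule exI[of _ 0]) auto
  have GI: "G \<in> I" unfolding I_def by (rule CollectI, rule exI[of _ 0], rule exI[of _ 1]) auto
  define g where "g = arg_min degree (\<lambda>p. p \<in> I \<and> p \<noteq> 0)"
  have "G \<noteq> 0" using Gp by auto
  then have g: "g \<in> I" "g \<noteq> 0" and gmin: "\<And>p. p \<in> I \<Longrightarrow> p \<noteq> 0 \<Longrightarrow> degree g \<le> degree p"
    using arg_min_nat_lemma[of "\<lambda>p. p \<in> I \<and> p \<noteq> 0" G degree] GI by (auto simp: g_def)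
  have gK: "g \<in> polys_over K" using g Gp s by (auto simp: I_def)
  have g_dvd: "g dvd p" if pI: "p \<in> I" for p
  proof -
    obtain u v where uv: "p = u * s + v * G" "u \<in> polys_over K" "v \<in> polys_over K"
      using pI by (auto simp: I_def)
    obtain u' v' where uv': "g = u' * s + v' * G" "u' \<in> polys_over K" "v' \<in> polys_over K"
      using g(1) by (auto simp: I_def)
    have pK: "p \<in> polys_over K" using uv s Gp by auto
    define q where "q = p div g"
    have q: "q \<in> polys_over K" using division_polys_over[OF gK g(2) pK] by (simp add: q_def)
    have "p mod g = p - q * g" by (simp add: q_def minus_div_mult_eq_mod)
    also have "\<dots> = (u - q * u') * s + (v - q * v') * G" using uv(1) uv'(1) by (simp add: algebra_simps)
    also have "\<dots> \<in> I" unfolding I_def using uv uv' q by blast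
    finally have "p mod g \<in> I" .
    then have "p mod g = 0" using gmin[of "p mod g"] degree_mod_less[of g p] g(2) by force
    then show ?thesis by auto
  qed
  obtain h where h: "h \<in> polys_over K" "G = g * h"
    using dvd_polys_overE[OF g_dvd[OF GI] gK Gp(1) \<open>G \<noteq> 0\<close>] .
  have "degree g = 0 \<or> degree h = 0" using irreducible_overD[OF G h(2) gK h(1)] .
  moreover have "degree h \<noteq> 0"
  proof
    assume "degree h = 0"
    then have "is_unit h" using h \<open>G \<noteq> 0\<close> by (simp add: is_unit_iff_degree)
    then have "G dvd g" using h(2) by (metis dvd_mult_unit_iff' dvd_refl mult.commute)
    then show False using g_dvd[OF sI] nd dvd_trans by blast
  qed
  ultimately obtain k where k: "g = [:k:]" "k \<noteq> 0" using g(2) by (metis degree_0_id pCons_0_0)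
  have kK: "inverse k \<in> K" using gK k by auto
  obtain u v where uv: "u \<in> polys_over K" "v \<in> polys_over K" "g = u * s + v * G"
    using g(1) by (auto simp: I_def)
  show ?thesis
  proof (rule that)
    show "smult (inverse k) u \<in> polys_over K" "smult (inverse k) v \<in> polys_over K"
      using uv kK by auto
    have "smult (inverse k) u * s + smult (inverse k) v * G = smult (inverse k) g"
      using uv(3) by (simp add: smult_add_right)
    then show "smult (inverse k) u * s + smult (inverse k) v * G = 1" using k by (simp add: one_pCons)
  qed
qed

lemma irreducible_over_dvd_if_common_root:
  assumes "irreducible_over K G" "s \<in> polys_over K" "poly G z = 0" "poly s z = 0"
  shows "G dvd s"
proof (rule ccontr)
  assume "\<not> G dvd s"
  then obtain u v where "u * s + v * G = 1" using bezout_over assms by metis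
  then have "poly (u * s + v * G) z = 1" by simp
  then show False using assms by simp
qed

text \<open>
  Inverses come from a Bezout relation modulo \<open>G\<close>.
\<close>

lemma subfield_adjoin:
  assumes G: "irreducible_over K G" "poly G \<alpha> = 0"
  shows "subfield (adjoin K \<alpha>)"
proof
  show "1 \<in> adjoin K \<alpha>" unfolding adjoin_def by (rule CollectI, rule exI[of _ 1]) auto
  fix x assume "x \<in> adjoin K \<alpha>"
  then obtain s where s: "s \<in> polys_over K" "x = poly s \<alpha>" by (auto simp: adjoin_def)
  show "inverse x \<in> adjoin K \<alpha>"
  proof (cases "x = 0")
    case True
    then show ?thesis unfolding adjoin_def by (intro CollectI exI[of _ 0]) auto
  next
    case False
    then have "\<not> G dvd s" using s G by (auto elim!: dvdE)
    then obtain u v where uv: "u \<in> polys_over K" "u * s + v * G = 1" using bezout_over G s by metis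
    from uv(2) have "poly (u * s + v * G) \<alpha> = 1" by simp
    then have "poly u \<alpha> * x = 1" using s G by simp
    then have "inverse x = poly u \<alpha>" by (metis inverse_unique mult.commute)
    then show ?thesis using uv by (auto simp: adjoin_def)
  qed
  fix y assume "y \<in> adjoin K \<alpha>"
  then obtain t where t: "t \<in> polys_over K" "y = poly t \<alpha>" by (auto simp: adjoin_def)
  show "x - y \<in> adjoin K \<alpha>" unfolding adjoin_def using s t by (intro CollectI exI[of _ "s - t"]) auto
  show "x * y \<in> adjoin K \<alpha>" unfolding adjoin_def using s t by (intro CollectI exI[of _ "s * t"]) auto
qed

lemma adjoin_superset: "x \<in> K \<Longrightarrow> x \<in> adjoin K \<alpha>"
  unfolding adjoin_def by (intro CollectI exI[of _ "[:x:]"]) auto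

lemma adjoin_generator: "\<alpha> \<in> adjoin K \<alpha>"
  unfolding adjoin_def by (intro CollectI exI[of _ "[:0, 1:]"]) auto

lemma polys_over_adjoin: "p \<in> polys_over K \<Longrightarrow> p \<in> polys_over (adjoin K \<alpha>)"
  by (auto simp: polys_over_def adjoin_superset)

text \<open>
  Expansion in base \<open>g\<close>, collected by powers of \<open>x\<close> rather than of \<open>g\<close>: as a module over \<open>K[g]\<close>, the ring \<open>K[x]\<close> is
  free on \<open>1, x, ..., x^(deg g - 1)\<close>.
\<close>

lemma base_expansion:
  assumes g: "g \<in> polys_over K" "degree g > 0" and A: "A \<in> polys_over K"
  shows "\<exists>s. (\<forall>j. s j \<in> polys_over K) \<and> A = (\<Sum>j<degree g. pcompose (s j) g * monom 1 j)"
  using A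
proof (induction "degree A" arbitrary: A rule: less_induct)
  case less
  have gnz: "g \<noteq> 0" using g by auto
  have dm: "A div g \<in> polys_over K" "A mod g \<in> polys_over K"
    using division_polys_over[OF g(1) gnz less.prems] by auto
  have expand: "r = (\<Sum>j<degree g. monom (coeff r j) j)" if "degree r < degree g" for r
  proof (rule poly_eqI)
    fix n show "coeff r n = coeff (\<Sum>j<degree g. monom (coeff r j) j) n"
      using that by (cases "n < degree g") (auto simp: coeff_sum coeff_eq_0 if_distrib cong: if_cong)
  qed
  have mod_less: "degree (A mod g) < degree g" using degree_mod_less[OF gnz, of A] g(2) by auto
  show ?case
  proof (cases "degree A < degree g")
    case True
    have "A = (\<Sum>j<degree g. pcompose [:coeff A j:] g * monom 1 j)"
      by (subst expand[OF True]) (simp add: smult_monom)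
    moreover have "\<forall>j. [:coeff A j:] \<in> polys_over K" using less.prems by auto
    ultimately show ?thesis by (intro exI[of _ "\<lambda>j. [:coeff A j:]"]) auto
  next
    case False
    have "degree (A div g) < degree A"
    proof (cases "A div g = 0")
      case True
      then show ?thesis using False g(2) by simp
    next
      case nz: False
      have "degree g + degree (A div g) = degree (g * (A div g))" using nz gnz by (simp add: degree_mult_eq)
      also have "g * (A div g) = A - A mod g" by (simp add: minus_mod_eq_mult_div)
      also have "degree \<dots> \<le> degree A" using False mod_less by (intro degree_diff_le) auto
      finally show ?thesis using g(2) by simp
    qed
    then obtain s where s: "\<forall>j. s j \<in> polys_over K"
      "A div g = (\<Sum>j<degree g. pcompose (s j) g * monom 1 j)"
      using less.hyps dm(1) by blast
    define s' where "s' = (\<lambda>j. pCons (coeff (A mod g) j) (s j))"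
    have "A = g * (A div g) + A mod g" by simp
    also have "\<dots> = g * (\<Sum>j<degree g. pcompose (s j) g * monom 1 j)
        + (\<Sum>j<degree g. monom (coeff (A mod g) j) j)"
      using s(2) expand[OF mod_less] by simp
    also have "\<dots> = (\<Sum>j<degree g. pcompose (s' j) g * monom 1 j)"
      by (simp add: s'_def pcompose_pCons sum_distrib_left algebra_simps smult_monom sum.distrib)
    finally show ?thesis using s(1) dm(2) by (intro exI[of _ s']) (auto simp: s'_def)
  qed
qed

text \<open>
  Capelli's lemma. One factor \<open>A\<close> of \<open>U \<circ> g\<close> shares a root with \<open>g - \<alpha>\<close> and is therefore divisible by it. Modulo
  \<open>g - \<alpha>\<close> the expansion of \<open>A\<close> in base \<open>g\<close> becomes a polynomial of degree less than that of \<open>g\<close>, with coefficients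
  \<open>s j(\<alpha>)\<close>; these must vanish. So \<open>U\<close> divides every \<open>s j\<close>, and \<open>U \<circ> g\<close> divides \<open>A\<close>.
\<close>

lemma irreducible_over_pcompose_tower:
  assumes U: "irreducible_over K U" "poly U \<alpha> = 0"
    and g: "g \<in> polys_over K" "degree g > 0"
    and irr: "irreducible_over (adjoin K \<alpha>) (g - [:\<alpha>:])"
    and root: "poly g z = \<alpha>"
  shows "irreducible_over K (pcompose U g)"
proof -
  interpret L: subfield "adjoin K \<alpha>" using subfield_adjoin[OF U] .
  have UK: "U \<in> polys_over K" "degree U > 0" using U by (auto simp: irreducible_over_def)
  have key: "degree B = 0"
    if AB: "A \<in> polys_over K" "B \<in> polys_over K" "pcompose U g = A * B" "poly A z = 0" for A B
  proof -
    obtain s where s: "\<And>j. s j \<in> polys_over K" "A = (\<Sum>j<degree g. pcompose (s j) g * monom 1 j)"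
      using base_expansion[OF g AB(1)] by blast
    define r where "r = (\<Sum>j<degree g. monom (poly (s j) \<alpha>) j)"
    have dvdA: "g - [:\<alpha>:] dvd A"
      by (rule L.irreducible_over_dvd_if_common_root[OF irr polys_over_adjoin[OF AB(1)] _ AB(4)])
        (simp add: root)
    have "g - [:\<alpha>:] dvd pcompose p g - [:poly p \<alpha>:]" for p
    proof -
      have "[:-\<alpha>, 1:] dvd p - [:poly p \<alpha>:]" by (simp add: poly_eq_0_iff_dvd [symmetric])
      then obtain q where "p - [:poly p \<alpha>:] = [:-\<alpha>, 1:] * q" by (elim dvdE)
      then have "pcompose (p - [:poly p \<alpha>:]) g = pcompose ([:-\<alpha>, 1:] * q) g" by simp
      then have "pcompose p g - [:poly p \<alpha>:] = (g - [:\<alpha>:]) * pcompose q g"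
        by (simp add: pcompose_diff pcompose_mult pcompose_pCons pcompose_smult algebra_simps)
      then show ?thesis by simp
    qed
    then have "g - [:\<alpha>:] dvd (\<Sum>j<degree g. (pcompose (s j) g - [:poly (s j) \<alpha>:]) * monom 1 j)"
      by (intro dvd_sum dvd_mult2)
    also have "(\<Sum>j<degree g. (pcompose (s j) g - [:poly (s j) \<alpha>:]) * monom 1 j) = A - r"
      by (simp add: s(2) r_def algebra_simps sum_subtractf smult_monom)
    finally have "g - [:\<alpha>:] dvd r" using dvdA by (metis dvd_diff_right_iff diff_diff_eq2 dvd_diff add_diff_cancel_left')
    moreover have "degree r < degree g"
      unfolding r_def using g(2) by (intro degree_sum_less) (auto intro: le_less_trans[OF degree_monom_le])
    moreover have "degree (g - [:\<alpha>:]) = degree g"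
      using g(2) by (cases g) (auto simp: degree_pCons_eq_if)
    ultimately have "r = 0" by (metis dvd_imp_degree_le not_le)
    have "pcompose U g dvd pcompose (s j) g" if j: "j < degree g" for j
    proof -
      have "poly (s j) \<alpha> = coeff r j" using j by (simp add: r_def coeff_sum if_distrib cong: if_cong)
      then have "poly (s j) \<alpha> = 0" using \<open>r = 0\<close> by simp
      then have "U dvd s j" by (rule irreducible_over_dvd_if_common_root[OF U(1) s(1) U(2)])
      then show ?thesis by (elim dvdE) (auto simp: pcompose_mult)
    qed
    then have "pcompose U g dvd A" unfolding s(2) by (intro dvd_sum dvd_mult2) auto
    moreover have "A \<noteq> 0" "B \<noteq> 0" using AB(3) UK(2) g(2) by (auto simp: pcompose_eq_0_iff)
    ultimately have "degree (A * B) \<le> degree A" using AB(3) by (metis dvd_imp_degree_le)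
    then show ?thesis using \<open>A \<noteq> 0\<close> \<open>B \<noteq> 0\<close> by (simp add: degree_mult_eq)
  qed
  show ?thesis unfolding irreducible_over_def
  proof (intro conjI ballI impI)
    show "pcompose U g \<in> polys_over K" using UK g by auto
    show "degree (pcompose U g) > 0" using UK g by (simp add: degree_pcompose)
    fix A B assume AB: "A \<in> polys_over K" "B \<in> polys_over K" "pcompose U g = A * B"
    have "poly (A * B) z = 0" unfolding AB(3)[symmetric] by (simp add: poly_pcompose root U(2))
    then have "poly A z = 0 \<or> poly B z = 0" by simp
    then show "degree A = 0 \<or> degree B = 0" using key[of A B] key[of B A] AB by (auto simp: mult.commute)
  qed
qed

lemma irreducible_over_shift:
  assumes "irreducible_over K p" "t \<in> K"
  shows "irreducible_over K (pcompose p [:t, 1:])"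
  unfolding irreducible_over_def
proof (intro conjI ballI impI)
  have p: "p \<in> polys_over K" "degree p > 0" using assms by (auto simp: irreducible_over_def)
  show "pcompose p [:t, 1:] \<in> polys_over K" "degree (pcompose p [:t, 1:]) > 0"
    using p assms by (auto simp: degree_pcompose)
  fix a b assume ab: "a \<in> polys_over K" "b \<in> polys_over K" "pcompose p [:t, 1:] = a * b"
  define a' b' where "a' = pcompose a [:-t, 1:]" and "b' = pcompose b [:-t, 1:]"
  have "p = pcompose (pcompose p [:t, 1:]) [:-t, 1:]"
    by (simp add: pcompose_assoc[symmetric] pcompose_pCons)
  also have "\<dots> = a' * b'" by (simp add: ab(3) a'_def b'_def pcompose_mult)
  finally have "p = a' * b'" .
  moreover have "[:-t, 1:] \<in> polys_over K" using assms by (simp add: uminus_closed)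
  then have "a' \<in> polys_over K" "b' \<in> polys_over K"
    using ab unfolding a'_def b'_def by (intro pcompose_polys_over; simp)+
  ultimately have "degree a' = 0 \<or> degree b' = 0" by (rule irreducible_overD[OF assms(1)])
  then show "degree a = 0 \<or> degree b = 0" by (simp add: a'_def b'_def degree_pcompose)
qed

text \<open>
  If \<open>k x = p y + 1\<close>, then \<open>v = v^(k x) / v^(p y)\<close> is a quotient of two \<open>p\<close>-th powers.
\<close>

lemma coprime_power_imp_power:
  assumes "v \<in> K" "w \<in> K" "v ^ k = w ^ p" "coprime k p" "k > 0"
  obtains u where "u \<in> K" "v = u ^ p"
proof (cases "v = 0")
  case True
  then show ?thesis using that[of 0] assms by (cases "p = 0") auto
next
  case False
  obtain x y where xy: "k * x = p * y + 1"
    using bezout_nat[of k p] assms(4,5) by (auto simp: coprime_iff_gcd_eq_1)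
  have "v * (v ^ y) ^ p = v ^ (k * x)" by (simp add: xy mult.commute flip: power_mult)
  also have "\<dots> = (w ^ x) ^ p" by (simp add: power_mult assms(3) mult.commute flip: power_mult) (simp add: power_mult assms(3))
  finally have "v = (w ^ x / v ^ y) ^ p" using False by (simp add: power_divide field_simps)
  then show ?thesis using that[of "w ^ x / v ^ y"] assms by auto
qed

end

lemma pcompose_power: "pcompose (p ^ n) q = pcompose p q ^ n"
  by (induction n) (simp_all add: pcompose_1 pcompose_mult)

lemma pcompose_monom_monom: "pcompose (monom 1 m) (monom 1 n) = (monom 1 (m * n) :: 'a::comm_ring_1 poly)"
  by (simp add: monom_altdef[of _ m] pcompose_power pcompose_pCons monom_power mult.commute)

locale alg_closed_subfield = subfield K for K :: "'a::alg_closed_field set"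
begin

text \<open>
  Norms lie in the ground field. The product is the resultant of two polynomials over \<open>K\<close>, and it is evaluated by the
  Euclidean algorithm: \<open>s\<close> may be replaced by its remainder modulo \<open>G\<close>, and then the two polynomials exchange their
  roles, at the price of a sign and a power of the leading coefficient, while the degree drops.
\<close>

lemma prod_roots_closed:
  assumes "(\<Prod>x\<in>#M. [:- x, 1:]) \<in> polys_over K" "s \<in> polys_over K"
  shows "(\<Prod>x\<in>#M. poly s x) \<in> K"
  using assms
proof (induction "size M" arbitrary: M s rule: less_induct)
  case less
  define G where "G = (\<Prod>x\<in>#M. [:- x, 1:])"
  have G: "G \<in> polys_over K" using less.prems by (simp add: G_def)
  have nz: "(\<Prod>x\<in>#M. [:- x, 1:]) \<noteq> 0" for M :: "'a multiset"
    by (auto simp: prod_mset_zero_iff)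
  have degG: "degree (\<Prod>x\<in>#M. [:- x, 1:]) = size M" for M :: "'a multiset"
  proof (induction M)
    case (add x M)
    have "degree ([:- x, 1:] * (\<Prod>x\<in>#M. [:- x, 1:])) = degree [:- x, 1:] + degree (\<Prod>x\<in>#M. [:- x, 1:])"
      by (rule degree_mult_eq) (use nz in auto)
    then show ?case using add by (simp del: mult_pCons_left)
  qed simp
  have poly_prod: "poly (\<Prod>x\<in>#M. [:- x, 1:]) y = (\<Prod>x\<in>#M. y - x)" for M and y :: 'a
    by (induction M) (auto simp: algebra_simps)
  have Gnz: "G \<noteq> 0" by (auto simp: G_def prod_mset_zero_iff)
  show ?case
  proof (cases "M = {#}")
    case False
    define r where "r = s mod G"
    have r: "r \<in> polys_over K" using division_polys_over[OF G Gnz less.prems(2)] by (simp add: r_def)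
    have sr: "poly s x = poly r x" if "x \<in># M" for x
    proof -
      have "poly G x = 0" using that by (auto simp: G_def poly_prod prod_mset_zero_iff)
      moreover have "s = G * (s div G) + r" by (simp add: r_def)
      then have "poly s x = poly (G * (s div G) + r) x" by simp
      ultimately show ?thesis by simp
    qed
    then have eq: "(\<Prod>x\<in>#M. poly s x) = (\<Prod>x\<in>#M. poly r x)"
      by (intro arg_cong[where f = prod_mset] image_mset_cong) auto
    show ?thesis
    proof (cases "r = 0")
      case True
      then show ?thesis unfolding eq using False by (cases M) auto
    next
      case rnz: False
      obtain A where A: "size A = degree r" "r = smult (lead_coeff r) (\<Prod>x\<in>#A. [:-x, 1:])"
        using alg_closed_imp_factorization[OF rnz] by blast
      define l where "l = lead_coeff r"
      have l: "l \<in> K" "l \<noteq> 0" using r rnz by (auto simp: l_def)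
      have "(\<Prod>x\<in>#A. [:-x, 1:]) = smult (inverse l) r"
        using arg_cong[OF A(2), of "smult (inverse l)"] l by (simp add: l_def)
      then have AK: "(\<Prod>x\<in>#A. [:-x, 1:]) \<in> polys_over K" using r l by auto
      have "degree r < degree G"
        unfolding r_def using degree_mod_less[OF Gnz, of s] rnz by (auto simp: r_def)
      then have "size A < size M" by (simp add: A(1) G_def degG)
      then have IH: "(\<Prod>y\<in>#A. poly G y) \<in> K" using less.hyps AK G by blast
      have "poly r = (\<lambda>x. l * (\<Prod>y\<in>#A. x - y))"
        by (rule ext, subst A(2)) (simp add: poly_prod l_def)
      then have "(\<Prod>x\<in>#M. poly r x) = (\<Prod>x\<in>#M. l * (\<Prod>y\<in>#A. x - y))" by simp
      also have "\<dots> = l ^ size M * (\<Prod>x\<in>#M. \<Prod>y\<in>#A. x - y)"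
        by (simp add: prod_mset.distrib prod_mset_constant)
      also have "(\<Prod>x\<in>#M. \<Prod>y\<in>#A. x - y) = (\<Prod>y\<in>#A. \<Prod>x\<in>#M. x - y)"
        by (rule prod_mset.swap)
      also have "(\<lambda>y. \<Prod>x\<in>#M. x - y) = (\<lambda>y. (-1) ^ size M * poly G y)"
      proof
        fix y
        have "(\<Prod>x\<in>#M. x - y) = (\<Prod>x\<in>#M. (-1) * (y - x))" by simp
        also have "\<dots> = (-1) ^ size M * (\<Prod>x\<in>#M. y - x)"
          by (simp only: prod_mset.distrib prod_mset_constant)
        finally show "(\<Prod>x\<in>#M. x - y) = (-1) ^ size M * poly G y" by (simp add: G_def poly_prod)
      qed
      also have "(\<Prod>y\<in>#A. (-1) ^ size M * poly G y) = ((-1) ^ size M) ^ size A * (\<Prod>y\<in>#A. poly G y)"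
        by (simp add: prod_mset.distrib prod_mset_constant)
      finally have "(\<Prod>x\<in>#M. poly r x) = l ^ size M * (((-1) ^ size M) ^ size A * (\<Prod>y\<in>#A. poly G y))" .
      then show ?thesis using IH l eq by (metis mult_closed power_closed uminus_closed one_closed)
    qed
  qed simp
qed

lemma prod_mset_power:
  fixes f :: "'b \<Rightarrow> 'c::comm_monoid_mult"
  shows "(\<Prod>x\<in>#M. f x ^ n) = (\<Prod>x\<in>#M. f x) ^ n"
  by (induction M) (auto simp: power_mult_distrib)

lemma monic_poly_at_0:
  fixes M :: "'b::comm_ring_1 multiset"
  shows "poly (\<Prod>x\<in>#M. [:-x, 1:]) 0 = (-1) ^ size M * \<Prod>\<^sub># M"
  by (induction M) (auto simp: algebra_simps)

text \<open>
  Let \<open>\<alpha>\<close> be a root of \<open>G\<close>. By Capelli's lemma \<open>x^p - \<alpha>\<close> has a factor of some degree \<open>k\<close> with \<open>0 < k < p\<close> over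
  \<open>K(\<alpha>)\<close>. Its roots are \<open>p\<close>-th roots of \<open>\<alpha>\<close>, so their product \<open>v\<close> satisfies \<open>v^p = \<alpha>^k\<close>. As \<open>k\<close> is prime to \<open>p\<close>, already \<open>\<alpha>\<close>
  is a \<open>p\<close>-th power in \<open>K(\<alpha>)\<close>, and taking norms to \<open>K\<close> gives the claim.
\<close>

lemma reducible_prime_power_substitution:
  assumes G: "irreducible_over K G" "lead_coeff G = 1" and p: "prime p"
    and red: "\<not> irreducible_over K (pcompose G (monom 1 p))"
  obtains w where "w \<in> K" "(-1) ^ degree G * poly G 0 = w ^ p"
proof -
  have GK: "G \<in> polys_over K" "degree G > 0" using G by (auto simp: irreducible_over_def)
  have p0: "p > 0" using p by (simp add: prime_gt_0_nat)
  obtain \<alpha> where \<alpha>: "poly G \<alpha> = 0" using alg_closed_imp_poly_has_root[OF GK(2)] by blast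
  interpret L: alg_closed_subfield "adjoin K \<alpha>"
    using subfield_adjoin[OF G(1) \<alpha>] by (simp add: alg_closed_subfield_def)
  define F where "F = monom 1 p - [:\<alpha>:]"
  have FL: "F \<in> polys_over (adjoin K \<alpha>)" unfolding F_def using adjoin_generator by auto
  have degF: "degree F = p" unfolding F_def
    using p0 degree_add_eq_left[of "[:-\<alpha>:]" "monom 1 p"]
    by (simp add: degree_monom_eq diff_conv_add_uminus del: add_uminus_conv_diff)
  obtain z where z: "poly F z = 0" using alg_closed_imp_poly_has_root[of F] degF p0 by auto
  have "\<not> irreducible_over (adjoin K \<alpha>) F"
    using irreducible_over_pcompose_tower[OF G(1) \<alpha>, of "monom 1 p" z] red z p0
    by (auto simp: F_def degree_monom_eq)
  then obtain a b where ab: "a \<in> polys_over (adjoin K \<alpha>)" "b \<in> polys_over (adjoin K \<alpha>)" "F = a * b"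
    "degree a > 0" "degree b > 0"
    using FL degF p0 by (auto simp: irreducible_over_def)
  then have nz: "a \<noteq> 0" "b \<noteq> 0" by auto
  define k where "k = degree a"
  have k: "0 < k" "k < p" using ab degF nz by (auto simp: k_def degree_mult_eq)
  obtain A where A: "size A = k" "a = smult (lead_coeff a) (\<Prod>x\<in>#A. [:-x, 1:])"
    using alg_closed_imp_factorization[OF nz(1)] by (auto simp: k_def)
  define v where "v = \<Prod>\<^sub># A"
  have "poly a 0 = lead_coeff a * ((-1) ^ k * v)"
    by (subst A(2)) (simp add: monic_poly_at_0 v_def A(1))
  then have "v = (-1) ^ k * (poly a 0 / lead_coeff a)"
    using nz by (simp add: field_simps flip: power_mult_distrib)
  also have "\<dots> \<in> adjoin K \<alpha>"
    by (intro L.mult_closed L.divide_closed L.power_closed L.uminus_closed L.one_closed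
        L.poly_closed L.coeff_closed L.zero_closed ab)
  finally have vL: "v \<in> adjoin K \<alpha>" .
  have "x ^ p = \<alpha>" if "x \<in># A" for x
  proof -
    have "[:-x, 1:] dvd a" using that by (subst A(2)) (auto intro!: dvd_smult dvd_prod_mset)
    then have "poly a x = 0" by (simp add: poly_eq_0_iff_dvd)
    then have "poly F x = 0" by (simp add: ab(3))
    then show ?thesis by (simp add: F_def poly_monom)
  qed
  then have "image_mset (\<lambda>x. x ^ p) A = image_mset (\<lambda>_. \<alpha>) A" by (intro image_mset_cong) auto
  moreover have "v ^ p = (\<Prod>x\<in>#A. x ^ p)" using prod_mset_power[of "\<lambda>x. x" p A] by (simp add: v_def)
  ultimately have "\<alpha> ^ k = v ^ p" by (simp add: A(1) prod_mset_constant)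
  moreover have "coprime k p" using k p by (metis coprime_commute nat_dvd_not_less prime_imp_coprime)
  ultimately obtain u where u: "u \<in> adjoin K \<alpha>" "\<alpha> = u ^ p"
    using L.coprime_power_imp_power[OF adjoin_generator vL] k by metis
  then obtain s where s: "s \<in> polys_over K" "u = poly s \<alpha>" by (auto simp: adjoin_def)
  have "G dvd s ^ p - [:0, 1:]"
    using s u \<alpha> by (intro irreducible_over_dvd_if_common_root[OF G(1) _ \<alpha>]) (auto simp: poly_power)
  then have root: "poly s x ^ p = x" if "poly G x = 0" for x using that
    by (metis (no_types, lifting) dvdE mult_zero_left poly_mult poly_diff poly_power right_minus_eq
        poly_pCons poly_0 mult_zero_right add_0 mult_1_right add_0_right)
  have "G \<noteq> 0" using GK by auto
  obtain M where M: "size M = degree G" "G = (\<Prod>x\<in>#M. [:-x, 1:])"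
    using alg_closed_imp_factorization[of G] G(2) \<open>G \<noteq> 0\<close> by auto
  have "poly s x ^ p = x" if "x \<in># M" for x
  proof -
    have "[:-x, 1:] dvd G" using that by (subst M(2)) (auto intro!: dvd_prod_mset)
    then show ?thesis using root by (simp add: poly_eq_0_iff_dvd)
  qed
  then have "image_mset (\<lambda>x. poly s x ^ p) M = image_mset (\<lambda>x. x) M" by (intro image_mset_cong) auto
  then have "(\<Prod>x\<in>#M. poly s x) ^ p = \<Prod>\<^sub># M"
    using prod_mset_power[of "poly s" p M] by simp
  moreover have "(-1) ^ degree G * poly G 0 = \<Prod>\<^sub># M"
    by (subst (2) M(2)) (simp add: monic_poly_at_0 M(1) flip: mult.assoc power_mult_distrib)
  moreover have "(\<Prod>x\<in>#M. poly s x) \<in> K" using prod_roots_closed s(1) GK M(2) by metis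
  ultimately show ?thesis using that by metis
qed

text \<open>
  Composing with \<open>x^p\<close> for one prime factor of \<open>d\<close> at a time does not change the value at zero, so the first prime at
  which irreducibility is lost decides. The parity hypothesis makes the sign \<open>(-1)^(deg G)\<close> trivial or absorbable into
  an odd power.
\<close>

lemma reducible_power_substitution:
  assumes "irreducible_over K G" "lead_coeff G = 1" "d > 0" "even (degree G) \<or> odd d"
    and "\<not> irreducible_over K (pcompose G (monom 1 d))"
  obtains p w where "prime p" "p dvd d" "w \<in> K" "poly G 0 = w ^ p"
proof -
  have "\<exists>p w. prime p \<and> p dvd d \<and> w \<in> K \<and> poly G 0 = w ^ p"
    using assms
  proof (induction d arbitrary: G rule: less_induct)
    case (less d)
    have "monom 1 1 = [:0, 1 :: 'a:]" by (simp add: monom_altdef)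
    then have "d \<noteq> 1" using less.prems by auto
    then obtain p where p: "prime p" "p dvd d" using prime_factor_nat by blast
    then obtain d' where d': "d = p * d'" by auto
    have p0: "p > 1" by (rule prime_gt_1_nat[OF p(1)])
    show ?case
    proof (cases "irreducible_over K (pcompose G (monom 1 p))")
      case True
      define G' where "G' = pcompose G (monom 1 p)"
      have "pcompose G' (monom 1 d') = pcompose G (monom 1 d)"
        by (simp add: G'_def d' pcompose_monom_monom flip: pcompose_assoc)
      moreover have "lead_coeff G' = 1"
        using less.prems(2) p0 by (simp add: G'_def lead_coeff_comp degree_monom_eq)
      moreover have "even (degree G') \<or> odd d'" "d' < d" "d' > 0"
        using less.prems(3,4) p0 by (auto simp: G'_def d' degree_pcompose degree_monom_eq)
      ultimately obtain q w where "prime q" "q dvd d'" "w \<in> K" "poly G' 0 = w ^ q"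
        using less.IH[of d' G'] less.prems(5) True by (auto simp: G'_def)
      moreover have "poly G' 0 = poly G 0" using p0 by (simp add: G'_def poly_pcompose poly_monom zero_power)
      ultimately show ?thesis using d' by (metis dvd_mult)
    next
      case False
      then obtain w where w: "w \<in> K" "(-1) ^ degree G * poly G 0 = w ^ p"
        using reducible_prime_power_substitution less.prems p by metis
      show ?thesis
      proof (cases "even (degree G)")
        case True
        then show ?thesis using w p by auto
      next
        case False
        then have "odd p" using less.prems p by (metis dvd_trans)
        moreover have "- poly G 0 = w ^ p" using w False by simp
        ultimately have "poly G 0 = (- w) ^ p" by (metis minus_minus power_minus_odd)
        then show ?thesis using w p by blast
      qed
    qed
  qed
  then show ?thesis using that by blast
qed

end

section \<open>Numerators of the critical orbit\<close>

lemma coprime_mult_eq_power: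
  fixes x y z :: nat
  assumes "coprime x y" "x * y = z ^ m"
  obtains u v where "x = u ^ m" "y = v ^ m"
proof -
  have "is_nth_power m (x * y)" using assms(2) by (auto intro: is_nth_powerI)
  then have "is_nth_power m x \<and> is_nth_power m y"
    using is_nth_power_mult_coprime_nat_iff[OF assms(1)] by simp
  then show ?thesis using that by (auto elim!: is_nth_powerE)
qed

lemma coprime_nat_primeI:
  fixes a b :: nat
  assumes "\<And>q. prime q \<Longrightarrow> q dvd a \<Longrightarrow> q dvd b \<Longrightarrow> False"
  shows "coprime a b"
proof (rule ccontr)
  assume "\<not> coprime a b"
  then have "gcd a b \<noteq> 1" by (simp add: coprime_iff_gcd_eq_1)
  then obtain q where q: "prime q" "q dvd gcd a b" using prime_factor_nat by blast
  show False by (rule assms[OF q(1)]) (use q(2) in auto)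
qed

lemma prime_not_dvd_coprime:
  fixes a b q :: nat
  assumes "coprime a b" "prime q" "q dvd a" "q dvd b" shows False
  using assms coprime_common_divisor_nat[of a b q] by (simp add: prime_nat_iff)

text \<open>
  A relation of coprime integers with arbitrary signs: after moving terms, the absolute values form a relation
  \<open>x + y = z\<close> of naturals, and \<open>M\<close> is the largest of the three.
\<close>

lemma abc_power_bound_int:
  fixes A B C :: int and K :: nat
  assumes abc: explicit_abc_conjecture
    and sum: "A + B + C = 0" and nz: "A \<noteq> 0" "B \<noteq> 0" "C \<noteq> 0" and cop: "coprime A B"
    and K: "K > 0" "\<And>p. prime p \<Longrightarrow> int p dvd A * B * C \<Longrightarrow> p dvd K"
  obtains M where "nat \<bar>A\<bar> \<le> M" "nat \<bar>B\<bar> \<le> M" "nat \<bar>C\<bar> \<le> M" "M ^ 8 < K ^ 15"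
proof -
  have main: "(nat \<bar>x\<bar> + nat \<bar>y\<bar>) ^ 8 < K ^ 15"
    if "coprime x y" "nat \<bar>z\<bar> = nat \<bar>x\<bar> + nat \<bar>y\<bar>" "x * y * z = A * B * C" for x y z
  proof (rule abc_power_bound[OF abc])
    show "nat \<bar>x\<bar> > 0" "nat \<bar>y\<bar> > 0" using that(3) nz by auto
    show "coprime (nat \<bar>x\<bar>) (nat \<bar>y\<bar>)" using that(1) by (simp add: coprime_nat_abs_left_iff coprime_nat_abs_right_iff)
    fix p assume p: "prime p" "p dvd nat \<bar>x\<bar> * nat \<bar>y\<bar> * (nat \<bar>x\<bar> + nat \<bar>y\<bar>)"
    have "nat \<bar>x\<bar> * nat \<bar>y\<bar> * (nat \<bar>x\<bar> + nat \<bar>y\<bar>) = nat \<bar>x * y * z\<bar>"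
      unfolding that(2)[symmetric] by (simp add: abs_mult nat_mult_distrib)
    then have "p dvd nat \<bar>x * y * z\<bar>" using p(2) by simp
    then have "int p dvd int (nat \<bar>x * y * z\<bar>)" by (simp only: int_dvd_int_iff)
    then have "int p dvd A * B * C" using that(3) by simp
    then show "p dvd K" by (rule K(2)[OF p(1)])
  qed (use K in auto)
  have C: "C = - (A + B)" using sum by simp
  have gcds: "coprime B C" "coprime A C"
    using cop unfolding C coprime_minus_right_iff
    by (simp_all add: coprime_iff_gcd_eq_1 gcd.commute[of B])
  have "nat \<bar>C\<bar> = nat \<bar>A\<bar> + nat \<bar>B\<bar> \<or> nat \<bar>A\<bar> = nat \<bar>B\<bar> + nat \<bar>C\<bar> \<or> nat \<bar>B\<bar> = nat \<bar>A\<bar> + nat \<bar>C\<bar>"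
    using sum by linarith
  then show ?thesis
  proof (elim disjE)
    assume *: "nat \<bar>C\<bar> = nat \<bar>A\<bar> + nat \<bar>B\<bar>"
    show ?thesis by (rule that[of "nat \<bar>C\<bar>"], use * in linarith, use * in linarith, simp)
        (use main[OF cop * refl] * in metis)
  next
    assume *: "nat \<bar>A\<bar> = nat \<bar>B\<bar> + nat \<bar>C\<bar>"
    show ?thesis by (rule that[of "nat \<bar>A\<bar>"], simp, use * in linarith, use * in linarith)
        (use main[OF gcds(1) *] * in \<open>simp add: ac_simps\<close>)
  next
    assume *: "nat \<bar>B\<bar> = nat \<bar>A\<bar> + nat \<bar>C\<bar>"
    show ?thesis by (rule that[of "nat \<bar>B\<bar>"], use * in linarith, simp, use * in linarith)
        (use main[OF gcds(2) *] * in \<open>simp add: ac_simps\<close>)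
  qed
qed

lemma le_power_Suc: "d \<ge> 1 \<Longrightarrow> d \<le> (d::nat) ^ Suc k"
  by (rule self_le_power) auto

text \<open>
  The orbit of the critical point zero of \<open>f = z^d + 1/c\<close>: the value of the \<open>(k+1)\<close>-st iterate at zero is
  \<open>iterate_num d c k / c^(d^k)\<close>.
\<close>

fun iterate_num :: "nat \<Rightarrow> int \<Rightarrow> nat \<Rightarrow> int" where
  "iterate_num d c 0 = 1"
| "iterate_num d c (Suc k) = iterate_num d c k ^ d + c ^ (d ^ Suc k - 1)"

lemma coprime_iterate_num:
  assumes "d \<ge> 2" shows "coprime (iterate_num d c k) c"
proof (induction k)
  case (Suc k)
  have "d ^ Suc k - 1 = Suc (d ^ Suc k - 2)"
    using assms le_power_Suc[of d k] by linarith
  then have "iterate_num d c (Suc k) = iterate_num d c k ^ d + c * c ^ (d ^ Suc k - 2)"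
    by simp
  also have "gcd c \<dots> = gcd c (iterate_num d c k ^ d)"
    by (metis add.commute gcd_add_mult mult.commute)
  then have "coprime (iterate_num d c k ^ d + c * c ^ (d ^ Suc k - 2)) c"
    using Suc by (metis coprime_iff_gcd_eq_1 coprime_power_left_iff gcd.commute)
  finally show ?case .
qed simp

lemma iterate_num_pos: "c > 0 \<Longrightarrow> iterate_num d c k > 0"
  by (induction k) (simp_all add: add_pos_pos)

lemma five_power_le_eight_power: "d \<ge> 5 \<Longrightarrow> 8 * 5 ^ d \<le> (8::nat) ^ d"
proof (induction d rule: nat_induct_at_least)
  case (Suc n)
  then show ?case by simp
qed simp

text \<open>
  The summand \<open>c^(d^k - 1)\<close> dominates the numerator, so the \<open>d\<close>-th power of the numerator has the size of
  \<open>c^(d^(k+1) - d)\<close>. The claim leaves room for a constant factor \<open>(5/4)^d\<close> in the induction, which \<open>d \<ge> 5\<close> provides;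
  for \<open>d = 4\<close> and \<open>c = 2\<close> the orbit escapes and the inequality fails at \<open>k = 2\<close>.
\<close>

lemma iterate_num_bound:
  assumes "d \<ge> 5" "\<bar>c\<bar> \<ge> 2"
  shows "2 * nat \<bar>iterate_num d c k\<bar> ^ d \<le> nat \<bar>c\<bar> ^ (d ^ Suc k - 2)"
proof (induction k)
  case 0
  have "(2::nat) ^ 1 \<le> nat \<bar>c\<bar> ^ (d - 2)"
    using assms by (intro order.trans[OF power_increasing[of 1 "d - 2" 2] power_mono]) auto
  then show ?case by simp
next
  case (Suc k)
  define e n n' M where "e = nat \<bar>c\<bar>" and "n = nat \<bar>iterate_num d c k\<bar>"
    and "n' = nat \<bar>iterate_num d c (Suc k)\<bar>" and "M = d ^ Suc k"
  define E where "E = e ^ (M - 2)"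
  have e: "e \<ge> 2" using assms by (simp add: e_def)
  have M: "M \<ge> 5" using assms le_power_Suc[of d k] unfolding M_def by linarith
  have "M - 1 = Suc (M - 2)" using M by simp
  then have eM: "e ^ (M - 1) = E * e" by (simp only: E_def power_Suc2)
  have "n' \<le> n ^ d + e ^ (M - 1)"
    unfolding n'_def n_def e_def M_def iterate_num.simps
    using abs_triangle_ineq[of "iterate_num d c k ^ d" "c ^ (d ^ Suc k - 1)"]
    by (simp add: nat_le_iff power_abs del: power_Suc)
  then have "4 * n' \<le> 4 * n ^ d + 4 * (E * e)" using eM by linarith
  also have "4 * n ^ d \<le> 2 * E" using Suc by (simp add: E_def M_def e_def n_def)
  also have "2 * E + 4 * (E * e) \<le> E * (5 * e)" using e by (cases e) (auto simp: algebra_simps)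
  finally have "(4 * n') ^ d \<le> (E * (5 * e)) ^ d" by (intro power_mono) auto
  then have "8 * (4 ^ d * n' ^ d) \<le> (8 * 5 ^ d) * (E * e) ^ d"
    by (simp add: power_mult_distrib algebra_simps)
  also have "\<dots> \<le> 8 ^ d * (E * e) ^ d"
    by (intro mult_right_mono five_power_le_eight_power assms) auto
  also have "\<dots> = 4 ^ d * (4 * 2 ^ (d - 2) * (E * e) ^ d)"
  proof -
    have "(8::nat) ^ d = 4 ^ d * 2 ^ d" by (simp flip: power_mult_distrib)
    also have "d = 2 + (d - 2)" using assms by simp
    then have "(2::nat) ^ d = 2 ^ (2 + (d - 2))" by (rule arg_cong)
    also have "\<dots> = 4 * 2 ^ (d - 2)" by (simp only: power_add) simp
    finally show ?thesis by simp
  qed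
  finally have "2 * n' ^ d \<le> 2 ^ (d - 2) * (E * e) ^ d" by (simp add: mult.commute)
  also have "\<dots> \<le> e ^ (d - 2) * (E * e) ^ d" using e by (intro mult_right_mono power_mono) auto
  also have "\<dots> = e ^ ((d - 2) + (M - 1) * d)"
    by (simp add: eM[symmetric] power_add power_mult)
  also have "(d - 2) + (M - 1) * d = d * M - 2" using assms M by (simp add: diff_mult_distrib algebra_simps)
  finally show ?case by (simp add: n'_def e_def M_def)
qed

lemma iterate_num_le:
  assumes "d \<ge> 5" "\<bar>c\<bar> \<ge> 2"
  shows "nat \<bar>iterate_num d c k\<bar> \<le> nat \<bar>c\<bar> ^ (d ^ k)"
proof -
  have e: "nat \<bar>c\<bar> \<ge> 1" using assms by simp
  have "nat \<bar>iterate_num d c k\<bar> ^ d \<le> nat \<bar>c\<bar> ^ (d ^ Suc k - 2)"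
    using iterate_num_bound[OF assms, of k] by linarith
  also have "\<dots> \<le> nat \<bar>c\<bar> ^ (d ^ Suc k)" using e by (intro power_increasing) auto
  also have "\<dots> = (nat \<bar>c\<bar> ^ (d ^ k)) ^ d" by (simp add: mult.commute flip: power_mult)
  finally show ?thesis using assms by (subst (asm) power_mono_iff) auto
qed

text \<open>
  With \<open>c = -e\<close> and \<open>d\<close> even, the recursion subtracts \<open>e^(d^(k+1) - 1)\<close> from a nonnegative but smaller \<open>d\<close>-th power,
  which gives both the sign and the bound.
\<close>

lemma iterate_num_neg_step:
  assumes d: "even d" "d \<ge> 2" and c: "c \<le> -2"
    and le: "\<bar>iterate_num d c k\<bar> \<le> (-c) ^ (d ^ k - 1)"
  shows "iterate_num d c (Suc k) < 0 \<and> \<bar>iterate_num d c (Suc k)\<bar> \<le> (-c) ^ (d ^ Suc k - 1)"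
proof -
  define e m where "e = - c" and "m = d ^ Suc k - 1"
  have "odd m" using d le_power_Suc[of d k] by (simp add: m_def)
  then have cm: "c ^ m = - (e ^ m)" by (simp add: e_def)
  have "iterate_num d c k ^ d = \<bar>iterate_num d c k\<bar> ^ d" using d by (simp add: power_even_abs)
  also have "\<dots> \<le> (e ^ (d ^ k - 1)) ^ d" using le by (intro power_mono) (auto simp: e_def)
  also have "\<dots> = e ^ ((d ^ k - 1) * d)" by (simp only: power_mult)
  also have "\<dots> < e ^ m"
  proof (rule power_strict_increasing)
    have "(d ^ k - 1) * d = d ^ Suc k - d"
      by (simp only: diff_mult_distrib power_Suc mult_1 mult.commute[of "d ^ k"])
    then show "(d ^ k - 1) * d < m" using d le_power_Suc[of d k] unfolding m_def by linarith
  qed (use c in \<open>simp add: e_def\<close>)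
  finally have "iterate_num d c k ^ d < e ^ m" .
  moreover have "iterate_num d c k ^ d \<ge> 0" using d by (simp add: zero_le_even_power)
  moreover have "iterate_num d c (Suc k) = iterate_num d c k ^ d - e ^ m" using cm by (simp add: m_def)
  ultimately show ?thesis unfolding e_def[symmetric] m_def[symmetric] by linarith
qed

lemma iterate_num_neg:
  assumes "even d" "d \<ge> 2" "c \<le> -2"
  shows "iterate_num d c (Suc k) < 0"
proof -
  have "\<bar>iterate_num d c k\<bar> \<le> (-c) ^ (d ^ k - 1)" for k
    by (induction k) (use iterate_num_neg_step[OF assms] in auto)
  then show ?thesis using iterate_num_neg_step[OF assms] by blast
qed

text \<open>
  The \<open>abc\<close> inequality for \<open>a^d + c^m = y^p\<close> with \<open>m = d^(k+1) - 1\<close>. If \<open>M\<close> is the largest of the three terms in absolute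
  value, then \<open>y\<close> is at most \<open>M^(1/p)\<close> and \<open>a c\<close> is at most \<open>M^(1/(d-1))\<close>. The extreme case is \<open>d = 6\<close>, \<open>p = 3\<close>,
  where the exponents add up to exactly \<open>8/15\<close>.
\<close>

lemma iterate_num_not_odd_prime_power:
  assumes abc: explicit_abc_conjecture
    and d: "d \<ge> 5" and c: "\<bar>c\<bar> \<ge> 2" and p: "prime p" "odd p" "p dvd d"
  shows "iterate_num d c (Suc k) \<noteq> y ^ p"
proof
  assume eq: "iterate_num d c (Suc k) = y ^ p"
  define M' m n e where "M' = d ^ k" and "m = d ^ Suc k - 1"
    and "n = nat \<bar>iterate_num d c k\<bar>" and "e = nat \<bar>c\<bar>"
  have e: "e \<ge> 2" using c by (simp add: e_def)
  have m: "m = d * M' - 1" by (simp add: m_def M'_def)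
  have m5: "m \<ge> 4" using le_power_Suc[of d k] d by (simp add: m_def del: power_Suc)
  have cop: "coprime (iterate_num d c k) c" by (rule coprime_iterate_num) (use d in simp)
  have p3: "p \<ge> 3" using p by (metis One_nat_def Suc_leI Suc_lessI dvd_refl not_less_eq_eq numeral_2_eq_2 numeral_3_eq_3 prime_gt_1_nat)
  have sum: "iterate_num d c k ^ d + c ^ m + - (y ^ p) = 0" using eq by (simp add: m_def)
  have n0: "iterate_num d c k \<noteq> 0" using cop c by auto
  have c0: "c \<noteq> 0" using c by auto
  have y0: "y \<noteq> 0"
  proof
    assume "y = 0"
    then have "iterate_num d c k ^ d = - (c ^ m)" using sum p3 by (simp add: zero_power)
    moreover have "coprime (iterate_num d c k ^ d) (c ^ m)" using cop by simp
    ultimately have "is_unit (c ^ m)" by (simp only: coprime_minus_left_iff coprime_self)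
    then have "is_unit c" using m5 is_unit_power_iff[of c m] by simp
    then show False using c by simp
  qed
  have K: "prime q \<Longrightarrow> int q dvd iterate_num d c k ^ d * c ^ m * - (y ^ p) \<Longrightarrow> q dvd n * e * nat \<bar>y\<bar>" for q
    unfolding n_def e_def
    by (auto simp: prime_dvd_mult_iff prime_dvd_power_iff dest!: prime_dvd_power[rotated] simp flip: int_dvd_int_iff)
  obtain M where M: "nat \<bar>iterate_num d c k ^ d\<bar> \<le> M" "nat \<bar>c ^ m\<bar> \<le> M" "nat \<bar>- (y ^ p)\<bar> \<le> M"
    "M ^ 8 < (n * e * nat \<bar>y\<bar>) ^ 15"
    using abc_power_bound_int[OF abc sum _ _ _ _ _ K] n0 c0 y0 cop by (auto simp: n_def e_def)
  have em: "e ^ m \<le> M" using M(2) by (simp add: e_def power_abs nat_power_eq)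
  have yp: "nat \<bar>y\<bar> ^ p \<le> M" using M(3) by (simp add: power_abs nat_power_eq)
  have M1: "M' = 1 \<and> k = 0 \<or> M' \<ge> d" using le_power_Suc[of d] d unfolding M'_def by (cases k) auto
  have ne: "(n * e) ^ j \<le> M" if "j * (M' + 1) \<le> d * M' - 1 \<or> M' = 1 \<and> j \<le> d - 1" "j > 0" for j
  proof -
    have "(n * e) ^ j \<le> e ^ m"
    proof (cases "k = 0")
      case True
      then have "j \<le> m" using that m5 m d by (auto simp: M'_def)
      then show ?thesis using True e by (simp add: n_def power_increasing)
    next
      case False
      then have "M' > 1" using d M1 by auto
      have "n * e \<le> e ^ (M' + 1)" using iterate_num_le[OF d c, of k] by (simp add: n_def e_def M'_def mult.commute)
      then have "(n * e) ^ j \<le> (e ^ (M' + 1)) ^ j" by (intro power_mono) auto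
      also have "\<dots> = e ^ (j * (M' + 1))" by (simp only: mult.commute flip: power_mult)
      also have "\<dots> \<le> e ^ m" using that \<open>M' > 1\<close> e m by (intro power_increasing) auto
      finally show ?thesis .
    qed
    then show ?thesis using em by linarith
  qed
  \<comment> \<open>The exponent 8 is distributed as 5 + 3 between n e and y when d = 5, and as 3 + 5 when d > 5.\<close>
  have "(n * e * nat \<bar>y\<bar>) ^ 15 \<le> M ^ 8"
  proof (cases "d = 5")
    case True
    then have "p = 5" using p by (simp add: primes_dvd_imp_eq)
    have "(n * e) ^ 3 \<le> M" by (rule ne) (use M1 True in auto)
    then have "((n * e) ^ 3) ^ 5 * (nat \<bar>y\<bar> ^ 5) ^ 3 \<le> M ^ 5 * M ^ 3"
      using yp \<open>p = 5\<close> by (intro mult_mono power_mono) auto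
    then show ?thesis by (simp add: power_mult_distrib flip: power_mult power_add)
  next
    case False
    have "5 * (M' + 1) \<le> d * M' - 1 \<or> M' = 1 \<and> 5 \<le> d - 1"
    proof (cases "M' = 1")
      case False
      then have "M' \<ge> 6" using M1 d \<open>d \<noteq> 5\<close> by auto
      then have "5 * (M' + 1) + 1 \<le> 6 * M'" by simp
      also have "\<dots> \<le> d * M'" using d \<open>d \<noteq> 5\<close> by (intro mult_right_mono) auto
      finally have "5 * (M' + 1) + 1 \<le> d * M'" .
      then have "5 * (M' + 1) \<le> d * M' - 1" by (rule add_le_imp_le_diff)
      then show ?thesis ..
    qed (use d \<open>d \<noteq> 5\<close> in auto)
    then have "(n * e) ^ 5 \<le> M" by (rule ne) auto
    moreover have "nat \<bar>y\<bar> ^ 3 \<le> nat \<bar>y\<bar> ^ p" using y0 p3 by (intro power_increasing) auto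
    then have "nat \<bar>y\<bar> ^ 3 \<le> M" using yp by linarith
    ultimately have "((n * e) ^ 5) ^ 3 * (nat \<bar>y\<bar> ^ 3) ^ 5 \<le> M ^ 3 * M ^ 5"
      by (intro mult_mono power_mono) auto
    then show ?thesis by (simp add: power_mult_distrib flip: power_mult power_add)
  qed
  then show False using M(4) by linarith
qed

text \<open>
  Write the equation as \<open>z^2 - b^2 = e^m\<close> with \<open>b^2 = n^d\<close> a good deal smaller than \<open>e^m\<close>. For odd \<open>e\<close> the factors \<open>z - b\<close>
  and \<open>z + b\<close> are coprime, hence \<open>m\<close>-th powers of odd numbers, and two such powers are too far apart to differ by
  \<open>2 b\<close>. For even \<open>e\<close> put \<open>r = (z - b) / 2\<close>; the \<open>abc\<close> inequality for the sum of \<open>r\<close> and \<open>b\<close> suffices, since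
  \<open>4 r (r + b) = e^m\<close> shows that only primes of \<open>e n\<close> occur.
\<close>

lemma iterate_num_not_square:
  assumes abc: explicit_abc_conjecture
    and d: "even d" "d \<ge> 6" and c: "c \<ge> 2"
  shows "iterate_num d c (Suc k) \<noteq> y ^ 2"
proof
  assume eq: "iterate_num d c (Suc k) = y ^ 2"
  define M' m n e b z where "M' = d ^ k" and "m = d ^ Suc k - 1"
    and "n = nat (iterate_num d c k)" and "e = nat c" and "b = n ^ (d div 2)" and "z = nat \<bar>y\<bar>"
  have n: "n > 0" "int n = iterate_num d c k" using iterate_num_pos[of c d k] c by (auto simp: n_def)
  have e: "e \<ge> 2" "int e = c" using c by (auto simp: e_def)
  have M': "M' = 1 \<and> k = 0 \<or> M' \<ge> d" using le_power_Suc[of d] d unfolding M'_def by (cases k) auto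
  have m: "m = d * M' - 1" by (simp add: m_def M'_def)
  have m5: "m \<ge> 5" using le_power_Suc[of d k] d by (simp add: m_def del: power_Suc)
  have "coprime (int n) (int e)" using coprime_iterate_num[of d c k] d n(2) e(2) by simp
  then have cop: "coprime n e" by (simp only: coprime_int_iff)
  have b2: "b ^ 2 = n ^ d" using d by (simp add: b_def flip: power_mult)
  have copb: "coprime b e" using cop by (simp add: b_def)
  have b0: "b > 0" using n by (simp add: b_def)
  have "int (z ^ 2) = int (n ^ d + e ^ m)" using eq by (simp add: z_def n(2) e(2) m_def del: of_nat_power_eq_of_nat_cancel_iff)
  then have z2: "z ^ 2 = b ^ 2 + e ^ m" by (simp only: of_nat_eq_iff b2)
  have zb: "z > b" using z2 e by (intro power_less_imp_less_base[of b 2 z]) auto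
  have fac: "(z - b) * (z + b) = e ^ m"
  proof -
    obtain t where "z = b + t" using zb less_imp_add_positive by blast
    then show ?thesis using z2 by (simp add: power2_eq_square algebra_simps)
  qed
  have nd: "2 * n ^ d \<le> e ^ (m - 1)"
    using iterate_num_bound[of d c k] d c n e by (simp add: m_def n_def e_def numeral_2_eq_2)
  show False
  proof (cases "odd e")
    case True
    have "coprime (z - b) (z + b)"
    proof (rule coprime_nat_primeI)
      fix q assume q: "prime q" "q dvd z - b" "q dvd z + b"
      have qe: "q dvd e" using q fac prime_dvd_power by (metis dvd_mult2)
      have "q \<noteq> 2" using qe True by auto
      have "q dvd (z + b) - (z - b)" by (rule dvd_diff_nat[OF q(3,2)])
      then have "q dvd 2 * b" using zb by (simp add: mult_2)
      then have "q dvd 2 \<or> q dvd b" using q(1) by (simp add: prime_dvd_mult_iff)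
      then have "q dvd b" using primes_dvd_imp_eq[OF q(1) two_is_prime_nat] \<open>q \<noteq> 2\<close> by blast
      then show False using prime_not_dvd_coprime copb qe q by blast
    qed
    then obtain u v where uv: "z - b = u ^ m" "z + b = v ^ m" using coprime_mult_eq_power fac by metis
    have "(u * v) ^ m = e ^ m" using fac uv by (simp add: power_mult_distrib)
    then have uve: "u * v = e" using m5 by (simp add: power_eq_iff_eq_base)
    then have "odd u" "odd v" using True by auto
    have "u ^ m < v ^ m" using uv zb b0 by linarith
    then have "u < v" by (rule power_less_imp_less_base) simp
    then have "u + 2 \<le> v" using \<open>odd u\<close> \<open>odd v\<close> by presburger
    have mS: "m = Suc (m - 1)" using m5 by simp
    have "u ^ m = u * u ^ (m - 1)" by (subst mS) (simp only: power_Suc)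
    also have "\<dots> \<le> u * v ^ (m - 1)" using \<open>u < v\<close> by (intro mult_left_mono power_mono) auto
    finally have "u ^ m + 2 * v ^ (m - 1) \<le> (u + 2) * v ^ (m - 1)" by (simp add: algebra_simps)
    also have "\<dots> \<le> v * v ^ (m - 1)" using \<open>u + 2 \<le> v\<close> by (intro mult_right_mono) auto
    also have "\<dots> = v ^ m" by (subst (2) mS) (simp only: power_Suc)
    finally have "v ^ (m - 1) \<le> b" using uv zb by linarith
    have "e ^ (m - 1) \<le> (v * v) ^ (m - 1)" using uve \<open>u < v\<close> by (intro power_mono) auto
    also have "\<dots> = (v ^ (m - 1)) ^ 2" by (simp add: power2_eq_square power_mult_distrib)
    also have "\<dots> \<le> b ^ 2" using \<open>v ^ (m - 1) \<le> b\<close> by (intro power_mono) auto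
    also have "\<dots> = n ^ d" by (rule b2)
    finally have "e ^ (m - 1) \<le> n ^ d" .
    moreover have "n ^ d > 0" using n by simp
    ultimately show False using nd by linarith
  next
    case False
    have "odd b" using prime_not_dvd_coprime[OF copb two_is_prime_nat] False by blast
    moreover have "even (e ^ m)" using False m5 by simp
    then have "odd (z ^ 2)" using z2 \<open>odd b\<close> by simp
    then have "odd z" by simp
    ultimately obtain r where r: "z - b = 2 * r" using zb by (metis dvdE even_diff_nat odd_add)
    have r0: "r > 0" using r zb by auto
    have zr: "z = b + 2 * r" using r zb by simp
    have rs: "4 * (r * (r + b)) = e ^ m" using fac zr by (simp add: algebra_simps)
    have qre: "q dvd e" if "prime q" "q dvd r \<or> q dvd r + b" for q
      using that rs by (metis dvd_mult dvd_mult2 prime_dvd_power)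
    have cr: "coprime r b"
    proof (rule coprime_nat_primeI)
      fix q assume q: "prime q" "q dvd r" "q dvd b"
      then show False using qre[of q] copb prime_not_dvd_coprime by blast
    qed
    have "(r + b) ^ 8 < (e * n) ^ 15"
    proof (rule abc_power_bound[OF abc r0 b0 cr])
      fix q assume q: "prime q" "q dvd r * b * (r + b)"
      then have "q dvd r \<or> q dvd r + b \<or> q dvd b" by (auto simp: prime_dvd_mult_iff)
      then show "q dvd e * n" using qre q by (auto simp: b_def dest: prime_dvd_power)
    qed (use e n in auto)
    moreover have "e ^ (4 * m) \<le> 256 * (r + b) ^ 8"
    proof -
      have "e ^ m \<le> 4 * (r + b) ^ 2" using rs by (simp add: power2_eq_square flip: rs)
      then have "(e ^ m) ^ 4 \<le> (4 * (r + b) ^ 2) ^ 4" by (intro power_mono) auto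
      then show ?thesis by (simp add: power_mult_distrib mult.commute flip: power_mult)
    qed
    ultimately have main: "e ^ (4 * m) < 256 * (e * n) ^ 15" by linarith
    show False
    proof (cases "k = 0")
      case k0: True
      then have n1: "n = 1" and m1: "m = d - 1" by (simp_all add: n_def m_def)
      have "e ^ (4 * m) < e ^ 15 * 256" using main n1 by simp
      moreover have "e ^ (4 * m) = e ^ 15 * e ^ (4 * m - 15)" using m5 by (simp flip: power_add)
      ultimately have small: "e ^ (4 * m - 15) < 256" by simp
      show False
      proof (cases "d = 6")
        case True
        then have e5: "e ^ 5 < 256" using small m1 by simp
        have "e < 4"
        proof (rule ccontr)
          assume "\<not> e < 4"
          then have "4 ^ 5 \<le> e ^ 5" by (intro power_mono) auto
          then show False using e5 by simp
        qed
        \<comment> \<open>Here abc leaves only the pair d = 6, e = 2, and 1 + 2^5 = 33 is not a square.\<close>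
        then have "e = 2" using e False by presburger
        then have "z ^ 2 = 33" using z2 True m1 n1 by (simp add: b_def)
        moreover have "z < 6 \<Longrightarrow> z ^ 2 \<le> 5 ^ 2" by (intro power_mono) auto
        moreover have "z \<ge> 6 \<Longrightarrow> 6 ^ 2 \<le> z ^ 2" by (intro power_mono) auto
        ultimately show False by (cases "z < 6") auto
      next
        case False
        then have "d \<ge> 8" using d by presburger
        then have "(2::nat) ^ 8 \<le> 2 ^ (4 * m - 15)" using m1 by (intro power_increasing) auto
        also have "\<dots> \<le> e ^ (4 * m - 15)" using e by (intro power_mono) auto
        finally show False using small by simp
      qed
    next
      case False
      then have M6: "M' \<ge> 6" using M' d by auto
      have "n \<le> e ^ M'" using iterate_num_le[of d c k] d c n e by (simp add: M'_def n_def e_def)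
      then have "(e * n) ^ 15 \<le> (e * e ^ M') ^ 15" by (intro power_mono) auto
      also have "\<dots> = e ^ (15 * M' + 15)" by (simp add: power_add power_mult_distrib mult.commute flip: power_mult)
      finally have "256 * (e * n) ^ 15 \<le> 2 ^ 8 * e ^ (15 * M' + 15)" by simp
      also have "\<dots> \<le> e ^ 8 * e ^ (15 * M' + 15)" using e by (intro mult_right_mono power_mono) auto
      also have "\<dots> = e ^ (15 * M' + 23)" by (simp add: add.commute flip: power_add)
      also have "\<dots> \<le> e ^ (4 * m)"
      proof (rule power_increasing)
        have "15 * M' + 23 \<le> 4 * (6 * M' - 1)" using M6 by linarith
        also have "6 * M' - 1 \<le> d * M' - 1" using d by (intro diff_le_mono mult_right_mono) auto
        finally show "15 * M' + 23 \<le> 4 * m" using m by simp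
      qed (use e in simp)
      finally show False using main by linarith
    qed
  qed
qed

lemma iterate_num_not_prime_power:
  assumes abc: explicit_abc_conjecture
    and d: "d \<ge> 5 \<or> d = 4 \<and> c < 0" and c: "c \<noteq> 0" "c \<noteq> -1" and p: "prime p" "p dvd d"
  shows "iterate_num d c (Suc k) \<noteq> y ^ p"
proof
  assume eq: "iterate_num d c (Suc k) = y ^ p"
  consider "c = 1" | "c \<le> -2" "p = 2" | "c \<ge> 2" "p = 2" | "\<bar>c\<bar> \<ge> 2" "odd p"
    using c prime_odd_nat[OF p(1)] prime_ge_2_nat[OF p(1)] by linarith
  then show False
  proof cases
    case 1
    have pos: "iterate_num d c k > 0" using iterate_num_pos 1 by simp
    \<comment> \<open>For c = 1 the equation reads y^p = b^p + 1.\<close>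
    obtain j where j: "d = p * j" using p by auto
    define b where "b = iterate_num d c k ^ j"
    have b: "b \<ge> 1" using pos by (simp add: b_def)
    have "y ^ p = b ^ p + 1" using eq 1 by (simp add: b_def j mult.commute flip: power_mult)
    then have "\<bar>y\<bar> ^ p = b ^ p + 1" using b by (metis abs_of_nonneg add_nonneg_nonneg int_one_le_iff_zero_less order_less_imp_le power_abs zero_le_one zero_le_power less_le_trans zero_less_one)
    then have "b ^ p < \<bar>y\<bar> ^ p" by simp
    then have "b < \<bar>y\<bar>" by (rule power_less_imp_less_base) simp
    then have "(b + 1) ^ p \<le> \<bar>y\<bar> ^ p" using b by (intro power_mono) auto
    moreover have "(b + 1) ^ p > b ^ p + 1"
    proof -
      have "p = Suc (Suc (p - 2))" using prime_ge_2_nat[OF p(1)] by simp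
      then obtain i where i: "p = Suc (Suc i)" by blast
      have "b ^ Suc i < (b + 1) ^ Suc i" using b by (intro power_strict_mono) auto
      then have "b * b ^ Suc i < b * (b + 1) ^ Suc i" using b by simp
      moreover have "(b + 1) ^ Suc i \<ge> 1" using b by (intro one_le_power) simp
      moreover have "(b + 1) ^ p = b * (b + 1) ^ Suc i + (b + 1) ^ Suc i" "b ^ p = b * b ^ Suc i"
        by (simp_all only: i power_Suc[of _ "Suc i"] ring_distribs mult_1_left)
      ultimately show ?thesis by linarith
    qed
    ultimately show False using \<open>\<bar>y\<bar> ^ p = b ^ p + 1\<close> by linarith
  next
    case 2
    have "iterate_num d c (Suc k) < 0" by (rule iterate_num_neg) (use 2 d p in auto)
    then show False using eq 2 by (metis not_less zero_le_power2)
  next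
    case 3
    have "even d" "d \<ge> 5" using 3 d p by auto
    then have "d \<ge> 6" by presburger
    then show False using iterate_num_not_square[OF abc] eq 3 \<open>even d\<close> by blast
  next
    case 4
    have "d \<ge> 5"
    proof (rule ccontr)
      assume "\<not> d \<ge> 5"
      then have "p dvd 2 ^ 2" using d p by simp
      then have "p dvd 2" using p(1) prime_dvd_power by blast
      then show False using 4 primes_dvd_imp_eq[OF p(1) two_is_prime_nat] by simp
    qed
    then show False using iterate_num_not_odd_prime_power[OF abc _ 4(1) p(1) 4(2) p(2)] eq by blast
  qed
qed

section \<open>Diophantine input for degree four\<close>

text \<open>
  For \<open>m = 2 t + 1\<close> the base is \<open>z / g^t\<close>, an integer because \<open>(g^t)^m = z^(2 t)\<close> divides \<open>z^m\<close>.
\<close>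

lemma square_eq_odd_power:
  fixes z g :: nat
  assumes "z ^ 2 = g ^ m" "odd m"
  obtains \<gamma> where "z = \<gamma> ^ m"
proof (cases "g = 0")
  case True
  then have "z = 0 ^ m" using assms by (cases m) auto
  then show ?thesis using that by blast
next
  case False
  obtain t where t: "m = 2 * t + 1" using assms(2) by (elim oddE)
  have "(g ^ t) ^ m = (z ^ 2) ^ t" unfolding assms(1) by (simp only: mult.commute flip: power_mult)
  also have "z * \<dots> = z ^ m" by (simp add: t flip: power_mult)
  finally have zm: "z ^ m = z * (g ^ t) ^ m" by simp
  then have "(g ^ t) ^ m dvd z ^ m" by simp
  then have "g ^ t dvd z" using t by (subst (asm) pow_divides_pow_iff) auto
  then obtain w where w: "z = g ^ t * w" by auto
  then have "z ^ m = (g ^ t) ^ m * w ^ m" by (simp only: power_mult_distrib)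
  then have "(g ^ t) ^ m * z = (g ^ t) ^ m * w ^ m" using zm by (simp only: mult.commute)
  then have "z = w ^ m" using False by (simp only: mult_cancel1 power_eq_0_iff) simp
  then show ?thesis using that by blast
qed

lemma power_Suc_base_gap:
  fixes u :: nat
  assumes "m \<ge> 2" "u \<ge> 1"
  shows "(u + 1) ^ m \<ge> u ^ m + 3"
proof -
  obtain i where i: "m = Suc (Suc i)" using assms(1) by (metis add_2_eq_Suc nat_le_iff_add)
  define A B C where "A = u * (u + 1) ^ Suc i" and "B = (u + 1) ^ Suc i" and "C = u * u ^ Suc i"
  have "u ^ Suc i < (u + 1) ^ Suc i" by (intro power_strict_mono) auto
  then have "C < A" unfolding A_def C_def using assms by (intro mult_strict_left_mono) auto
  moreover have "2 ^ 1 \<le> B" unfolding B_def using assms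
    by (intro order.trans[OF power_increasing[of 1 "Suc i" 2] power_mono]) auto
  moreover have "(u + 1) ^ m = A + B" "u ^ m = C" unfolding A_def B_def C_def
    by (simp_all only: i power_Suc[of _ "Suc i"] distrib_right mult_1_left)
  ultimately show ?thesis by simp
qed

lemma powers_differ_by_at_least_3:
  fixes u v :: nat
  assumes "u ^ m < v ^ m" "m \<ge> 2" "u \<ge> 1"
  shows "u ^ m + 3 \<le> v ^ m"
proof -
  have "u < v" by (rule power_less_imp_less_base[OF assms(1)]) simp
  then have "(u + 1) ^ m \<le> v ^ m" by (intro power_mono) auto
  then show ?thesis using power_Suc_base_gap[OF assms(2,3)] by linarith
qed

text \<open>
  Fermat's equation with small coefficients. The primes of \<open>x y (x + y)\<close> divide \<open>u v w\<close>, and \<open>(u v w)^m\<close> is at most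
  \<open>27 (x + y)^3\<close>; as \<open>3 \<cdot> 15 < 8 m\<close>, the inequality fails once \<open>x + y\<close> beats the constant.
\<close>

lemma abc_sum_of_almost_powers:
  fixes x y u v w :: nat
  assumes abc: explicit_abc_conjecture
    and xy: "x > 0" "y > 0" "coprime x y"
    and pow: "i * x = u ^ m" "j * y = v ^ m" "x + y = w ^ m" and ij: "i * j \<le> 27" "i > 0" "j > 0"
    and m: "m \<ge> 8" and big: "x + y \<ge> 16"
  shows False
proof -
  define X where "X = x + y"
  have m0: "m > 0" using m by simp
  have uvw: "u > 0" "v > 0" "w > 0" using pow xy ij m0 by (auto intro!: Nat.gr0I simp: power_0_left)
  have "X ^ 8 < (u * v * w) ^ 15" unfolding X_def
  proof (rule abc_power_bound[OF abc xy])
    fix p assume p: "prime p" "p dvd x * y * (x + y)"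
    then have "p dvd i * x \<or> p dvd j * y \<or> p dvd x + y" by (auto simp: prime_dvd_mult_iff)
    then have "p dvd u \<or> p dvd v \<or> p dvd w" using pow prime_dvd_power[OF p(1)] by metis
    then show "p dvd u * v * w" by (auto simp: prime_dvd_mult_iff)
  qed (use uvw in auto)
  then have "(X ^ 8) ^ m < ((u * v * w) ^ 15) ^ m" by (intro power_strict_mono) (use m0 in auto)
  also have "\<dots> = ((u ^ m) * (v ^ m) * (w ^ m)) ^ 15"
    by (simp add: power_mult_distrib mult.commute flip: power_mult)
  also have "\<dots> \<le> (27 * X ^ 3) ^ 15"
  proof (rule power_mono)
    have "(u ^ m) * (v ^ m) * (w ^ m) = (i * j) * (x * y * X)" by (simp add: pow[symmetric] X_def)
    also have "\<dots> \<le> 27 * (X * X * X)" using ij(1) by (intro mult_mono) (auto simp: X_def)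
    finally show "(u ^ m) * (v ^ m) * (w ^ m) \<le> 27 * X ^ 3" by (simp add: power3_eq_cube)
  qed simp
  also have "\<dots> = 27 ^ 15 * X ^ 45" by (simp add: power_mult_distrib flip: power_mult)
  also have "\<dots> < X ^ 19 * X ^ 45"
  proof (rule mult_strict_right_mono)
    have "(27::nat) ^ 15 < 16 ^ 19" by simp
    also have "\<dots> \<le> X ^ 19" using big by (intro power_mono) (auto simp: X_def)
    finally show "27 ^ 15 < X ^ 19" .
  qed (use xy in \<open>simp add: X_def\<close>)
  also have "\<dots> = X ^ (8 * 8)" by (simp flip: power_add)
  also have "\<dots> \<le> X ^ (8 * m)" using m xy by (intro power_increasing) (auto simp: X_def)
  also have "\<dots> = (X ^ 8) ^ m" by (rule power_mult)
  finally show False by simp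
qed

text \<open>
  The factors \<open>X\<close>, \<open>X - a\<close>, \<open>X + a\<close> are coprime up to powers of two, so each is almost an \<open>m\<close>-th power. If \<open>X\<close> is even,
  then \<open>2 X = (X - a) + (X + a)\<close> is a relation between three \<open>m\<close>-th powers. If \<open>X\<close> is odd, then so is the relation
  \<open>X = (X - a)/2 + (X + a)/2\<close>, up to a factor \<open>16\<close> in one summand. For \<open>m = 3\<close>, where \<open>abc\<close> is too weak, \<open>a = 1\<close> makes two
  cubes differ by two in the first case; in the second case \<open>X\<close> and one of \<open>X \<plusminus> 1\<close> are cubes.
\<close>

lemma quartic_obstruction:
  fixes a c X :: nat
  assumes abc: explicit_abc_conjecture
    and aX: "0 < a" "a < X" and cop: "coprime a c"
    and eq: "4 * X ^ 2 * ((X - a) * (X + a)) = c ^ m"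
    and m: "odd m" "a = 1 \<and> m = 3 \<or> m \<ge> 8"
  shows False
proof -
  have m2: "m \<ge> 2" using m by auto
  have dvdc: "p dvd c" if "prime p" "p dvd 2 * X" for p
  proof -
    have "4 * X ^ 2 * ((X - a) * (X + a)) = 2 * X * (2 * X * ((X - a) * (X + a)))"
      by (simp add: power2_eq_square)
    then have "p dvd 4 * X ^ 2 * ((X - a) * (X + a))" using that(2) by (metis dvd_mult2)
    then show ?thesis unfolding eq using that(1) prime_dvd_power by blast
  qed
  have oda: "odd a" using dvdc[of 2] prime_not_dvd_coprime[OF cop two_is_prime_nat] by auto
  have copX: "coprime X a"
    by (rule coprime_nat_primeI) (meson dvdc prime_not_dvd_coprime[OF cop] dvd_mult)
  show False
  proof (cases "even X")
    case True
    have "odd (X - a)" "odd (X + a)" using True oda aX by auto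
    have "coprime (X - a) (X + a)"
    proof (rule coprime_nat_primeI)
      fix q assume q: "prime q" "q dvd X - a" "q dvd X + a"
      have "q dvd (X - a) + (X + a)" "q dvd (X + a) - (X - a)" using q by (auto intro: dvd_diff_nat)
      then have "q dvd 2 * X" "q dvd 2 * a" using aX by (auto simp: mult_2)
      moreover have "\<not> q dvd 2" using q \<open>odd (X - a)\<close> primes_dvd_imp_eq[OF q(1) two_is_prime_nat] by auto
      ultimately have "q dvd X" "q dvd a" using q(1) by (auto simp: prime_dvd_mult_iff)
      then show False using prime_not_dvd_coprime[OF copX q(1)] by blast
    qed
    have cX: "coprime ((2 * X) ^ 2) ((X - a) * (X + a))"
    proof (rule coprime_nat_primeI)
      fix q assume q: "prime q" "q dvd (2 * X) ^ 2" "q dvd (X - a) * (X + a)"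
      have q2: "q dvd 2 * X" using q prime_dvd_power by blast
      have qa: "q dvd X - a \<or> q dvd X + a" using q by (simp add: prime_dvd_mult_iff)
      have "q \<noteq> 2" using qa \<open>odd (X - a)\<close> \<open>odd (X + a)\<close> by auto
      then have "q dvd X" using q2 q(1) primes_dvd_imp_eq[OF q(1) two_is_prime_nat] by (auto simp: prime_dvd_mult_iff)
      moreover have "q dvd a" using qa
      proof
        assume "q dvd X - a"
        then have "q dvd X - (X - a)" by (rule dvd_diff_nat[OF \<open>q dvd X\<close>])
        then show ?thesis using aX by simp
      next
        assume "q dvd X + a"
        then show ?thesis using \<open>q dvd X\<close> by (simp add: dvd_add_right_iff)
      qed
      ultimately show False using prime_not_dvd_coprime[OF copX q(1)] by blast
    qed
    have "(2 * X) ^ 2 * ((X - a) * (X + a)) = c ^ m" using eq by (simp add: power_mult_distrib)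
    then obtain g f where gf: "(2 * X) ^ 2 = g ^ m" "(X - a) * (X + a) = f ^ m"
      using coprime_mult_eq_power[OF cX] by metis
    obtain \<gamma> where \<gamma>: "2 * X = \<gamma> ^ m" using square_eq_odd_power gf(1) m(1) by metis
    obtain u v where uv: "X - a = u ^ m" "X + a = v ^ m"
      using coprime_mult_eq_power[OF \<open>coprime (X - a) (X + a)\<close> gf(2)] by metis
    from m(2) show False
    proof
      assume "a = 1 \<and> m = 3"
      then have "v ^ m = u ^ m + 2" using uv aX by simp
      moreover have "u \<ge> 1" using uv aX m2 by (auto intro!: Nat.gr0I simp: Suc_le_eq power_0_left)
      ultimately show False using powers_differ_by_at_least_3[of u m v] m2 by simp
    next
      assume m8: "m \<ge> 8"
      have "\<gamma> \<ge> 2"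
      proof (rule ccontr)
        assume "\<not> \<gamma> \<ge> 2"
        then have "\<gamma> = 0 \<or> \<gamma> = 1" by auto
        then show False using \<gamma> aX m2 by (auto simp: power_0_left)
      qed
      then have "2 ^ 8 \<le> \<gamma> ^ m" using m8 by (intro order.trans[OF power_increasing[of 8 m 2] power_mono]) auto
      have sum: "X - a + (X + a) = \<gamma> ^ m" using \<gamma> aX by simp
      show False
      proof (rule abc_sum_of_almost_powers[OF abc _ _ \<open>coprime (X - a) (X + a)\<close>])
        show "1 * (X - a) = u ^ m" "1 * (X + a) = v ^ m" using uv by simp_all
        show "16 \<le> X - a + (X + a)" using sum \<open>2 ^ 8 \<le> \<gamma> ^ m\<close> by simp
      qed (use aX m8 sum in simp_all)
    qed
  next
    case False
    define r s where "r = (X - a) div 2" and "s = (X + a) div 2"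
    have rs: "X - a = 2 * r" "X + a = 2 * s" using False oda aX by (auto simp: r_def s_def)
    have Xrs: "X = r + s" "s = r + a" using rs aX by linarith+
    have r0: "r > 0" using rs aX by auto
    have eq': "X ^ 2 * (16 * (r * s)) = c ^ m" using eq rs by (simp add: ac_simps)
    have crs: "coprime r s"
    proof (rule coprime_nat_primeI)
      fix q assume q: "prime q" "q dvd r" "q dvd s"
      then have "q dvd X" "q dvd a" using Xrs by (auto simp: dvd_add_right_iff)
      then show False using prime_not_dvd_coprime[OF copX q(1)] by blast
    qed
    have "coprime (X ^ 2) (16 * (r * s))"
    proof (rule coprime_nat_primeI)
      fix q assume q: "prime q" "q dvd X ^ 2" "q dvd 16 * (r * s)"
      have qX: "q dvd X" using q prime_dvd_power by blast
      then have "q \<noteq> 2" using False by auto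
      have "q dvd 2 ^ 4 * (r * s)" using q by simp
      then have "q dvd 2 \<or> q dvd r \<or> q dvd s"
        using q(1) prime_dvd_power[of q 2 4] by (auto simp: prime_dvd_mult_iff)
      then have "q dvd r \<or> q dvd s" using primes_dvd_imp_eq[OF q(1) two_is_prime_nat] \<open>q \<noteq> 2\<close> by blast
      then have "q dvd r \<and> q dvd s" using qX Xrs(1) by (auto simp: dvd_add_right_iff dvd_add_left_iff)
      then show False using prime_not_dvd_coprime[OF crs q(1)] by blast
    qed
    then obtain g f where gf: "X ^ 2 = g ^ m" "16 * (r * s) = f ^ m"
      using coprime_mult_eq_power eq' by metis
    obtain \<eta> where \<eta>: "X = \<eta> ^ m" using square_eq_odd_power gf(1) m(1) by metis
    \<comment> \<open>Exactly one of the coprime summands r, s of the odd number X is even; it absorbs the factor 16.\<close>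
    have core: False if xy: "even x" "odd y" "x + y = X" "coprime x y" "16 * (x * y) = f ^ m"
      "x > 0" "y > 0" "x = y + a \<or> y = x + a" for x y
    proof -
      have "coprime (16 * x) y"
      proof (rule coprime_nat_primeI)
        fix q assume q: "prime q" "q dvd 16 * x" "q dvd y"
        have "q dvd 2 ^ 4 * x" using q by simp
        then have "q dvd 2 \<or> q dvd x" using q(1) prime_dvd_power[of q 2 4] by (auto simp: prime_dvd_mult_iff)
        moreover have "q \<noteq> 2" using q xy by auto
        ultimately have "q dvd x" using primes_dvd_imp_eq[OF q(1) two_is_prime_nat] by blast
        then show False using prime_not_dvd_coprime[OF xy(4) q(1)] q by blast
      qed
      moreover have "16 * x * y = f ^ m" using xy(5) by simp
      ultimately obtain u v where uv: "16 * x = u ^ m" "y = v ^ m" using coprime_mult_eq_power by metis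
      from m(2) show False
      proof
        assume am: "a = 1 \<and> m = 3"
        have "even (u ^ m)" using uv(1) by (metis dvd_mult2 even_numeral)
        then obtain t where t: "u = 2 * t" by (auto elim: evenE)
        \<comment> \<open>The even summand x satisfies 2 x = X + 1 or 2 x = X - 1, and now 2 x is a cube as well.\<close>
        have "16 * x = 8 * t ^ 3" using uv(1) am t by (simp add: power_mult_distrib)
        then have "t ^ m = 2 * x" using am by simp
        then have "t ^ m = \<eta> ^ m + 1 \<or> \<eta> ^ m = t ^ m + 1" using xy am \<eta> by auto
        moreover have "t \<ge> 1" using \<open>t ^ m = 2 * x\<close> xy m2 by (auto intro!: Nat.gr0I simp: Suc_le_eq power_0_left)
        moreover have "\<eta> \<ge> 1" using \<eta> aX m2 by (auto intro!: Nat.gr0I simp: Suc_le_eq power_0_left)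
        ultimately show False
          using powers_differ_by_at_least_3[of t m \<eta>] powers_differ_by_at_least_3[of \<eta> m t] m2 by auto
      next
        assume m8: "m \<ge> 8"
        have "\<eta> \<ge> 2"
        proof (rule ccontr)
          assume "\<not> \<eta> \<ge> 2"
          then have "\<eta> = 0 \<or> \<eta> = 1" by auto
          then show False using \<eta> aX m2 by (auto simp: power_0_left)
        qed
        then have "2 ^ 8 \<le> \<eta> ^ m" using m8 by (intro order.trans[OF power_increasing[of 8 m 2] power_mono]) auto
        then show False
          using abc_sum_of_almost_powers[OF abc, of x y 16 u m 1 v \<eta>] uv \<eta> m8 xy by simp
      qed
    qed
    have "s > 0" using Xrs aX by simp
    show False
    proof (cases "even r")
      case True
      then have "odd s" using Xrs False by auto
      then show False using core[of r s] True Xrs crs gf(2) r0 \<open>s > 0\<close> by auto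
    next
      case odd_r: False
      then have "even s" using Xrs False by auto
      then show False using core[of s r] odd_r Xrs crs gf(2) r0 \<open>s > 0\<close> by (auto simp: ac_simps coprime_commute)
    qed
  qed
qed

section \<open>Diophantine input for degree three\<close>

text \<open>
  Descent in the Gaussian integers. Reducing \<open>c\<close> modulo \<open>y\<close> gives \<open>r\<close> with \<open>r^2 + 1 = y y'\<close> and \<open>y' < y\<close>. The representation of \<open>y'\<close>
  is the norm of some \<open>s + t i\<close> dividing \<open>r + i\<close>, and the quotient has norm \<open>y\<close>. The congruence says that this quotient
  divides \<open>c + i\<close>.
\<close>

lemma sum_two_squares_factor:
  fixes y c :: int
  assumes "y > 0" "y dvd c ^ 2 + 1"
  shows "\<exists>p q. y = p ^ 2 + q ^ 2 \<and> y dvd p - c * q"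
  using assms
proof (induction "nat y" arbitrary: y c rule: less_induct)
  case less
  show ?case
  proof (cases "y = 1")
    case True
    then show ?thesis by (intro exI[of _ 1] exI[of _ 0]) auto
  next
    case False
    define r where "r = (let t = c mod y in if 2 * t \<le> y then t else t - y)"
    have r: "y dvd c - r" "2 * \<bar>r\<bar> \<le> y"
    proof -
      have t: "0 \<le> c mod y" "c mod y < y" using less.prems(1) by auto
      then show "2 * \<bar>r\<bar> \<le> y" by (auto simp: r_def Let_def)
      have "y dvd c - c mod y" by (simp add: minus_mod_eq_mult_div)
      moreover from this have "y dvd c - c mod y + y" by (rule dvd_add) simp
      ultimately show "y dvd c - r" by (auto simp: r_def Let_def algebra_simps)
    qed
    have "y dvd r ^ 2 + 1"
    proof -
      have "c ^ 2 + 1 - (c - r) * (c + r) = r ^ 2 + 1" by (simp add: power2_eq_square algebra_simps)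
      then show ?thesis using less.prems(2) r(1) by (metis dvd_diff dvd_mult2)
    qed
    then obtain y' where y': "r ^ 2 + 1 = y * y'" by auto
    have y'0: "y' > 0" using y' less.prems(1) by (metis add_pos_nonneg add.commute zero_le_power2 zero_less_mult_pos zero_less_one)
    have "y' < y"
    proof -
      have "4 * r ^ 2 \<le> y ^ 2" using power_mono[OF r(2), of 2] by (simp add: power_mult_distrib)
      then have "4 * (y * y') \<le> y ^ 2 + 4" using y' by simp
      also have "\<dots> < 4 * y ^ 2"
      proof -
        have "2 * 2 \<le> y * y" using False less.prems(1) by (intro mult_mono) auto
        then show ?thesis by (simp add: power2_eq_square)
      qed
      finally have "y * y' < y * y" by (simp add: power2_eq_square)
      then show ?thesis using less.prems(1) by simp
    qed
    then obtain s t where st: "y' = s ^ 2 + t ^ 2" "y' dvd s - r * t"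
      using less.hyps[of y' r] y' y'0 by (metis dvd_triv_right nat_mono_iff less.prems(1))
    obtain q' where q': "s - r * t = y' * q'" using st(2) by auto
    have "r * s + t = r * (s - r * t) + t * (r ^ 2 + 1)" by (simp add: power2_eq_square algebra_simps)
    also have "\<dots> = y' * (r * q' + t * y)" by (simp only: q' y') (simp add: algebra_simps)
    finally obtain p where p: "r * s + t = y' * p" by blast
    \<comment> \<open>r + i = (s + t i)(p + q' i) in the Gaussian integers\<close>
    have e1: "y' * (s * p - t * q') = y' * r"
    proof -
      have "y' * (s * p - t * q') = s * (y' * p) - t * (y' * q')" by (simp add: algebra_simps)
      also have "\<dots> = s * (r * s + t) - t * (s - r * t)" by (simp only: p q')
      also have "\<dots> = (s ^ 2 + t ^ 2) * r" by (simp add: power2_eq_square algebra_simps)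
      finally show ?thesis by (simp add: st(1))
    qed
    have e2: "y' * (s * q' + t * p) = y' * 1"
    proof -
      have "y' * (s * q' + t * p) = s * (y' * q') + t * (y' * p)" by (simp add: algebra_simps)
      also have "\<dots> = s * (s - r * t) + t * (r * s + t)" by (simp only: p q')
      also have "\<dots> = s ^ 2 + t ^ 2" by (simp add: power2_eq_square algebra_simps)
      finally show ?thesis by (simp add: st(1))
    qed
    have re: "s * p - t * q' = r" and im: "s * q' + t * p = 1"
      using e1 e2 y'0 by (simp_all only: mult_cancel_left) auto
    have "y' * (p ^ 2 + q' ^ 2) = (s * p - t * q') ^ 2 + (s * q' + t * p) ^ 2"
      by (simp add: st(1) power2_eq_square algebra_simps)
    also have "\<dots> = y' * y" using y' by (simp add: re im)
    finally have norm: "p ^ 2 + q' ^ 2 = y" using y'0 by simp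
    have "p - r * q' = p * (s * q' + t * p) - (s * p - t * q') * q'" by (simp add: re im)
    also have "\<dots> = t * (p ^ 2 + q' ^ 2)" by (simp add: power2_eq_square algebra_simps)
    finally have "y dvd p - r * q'" by (simp add: norm)
    moreover have "p - c * q' = (p - r * q') - (c - r) * q'" by (simp add: algebra_simps)
    ultimately have "y dvd p - c * q'" using r(1) by (metis dvd_diff dvd_mult2)
    then show ?thesis using norm by blast
  qed
qed

lemma prime_factor_coprimeI:
  fixes a b :: int
  assumes "\<And>q. prime q \<Longrightarrow> q dvd a \<Longrightarrow> q dvd b \<Longrightarrow> False" "a \<noteq> 0 \<or> b \<noteq> 0"
  shows "coprime a b"
proof (rule ccontr)
  assume "\<not> coprime a b"
  then have "\<not> is_unit (gcd a b)" by (simp add: coprime_iff_gcd_eq_1)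
  then obtain q where q: "prime q" "q dvd gcd a b" using prime_divisor_exists[of "gcd a b"] assms(2) by auto
  show False by (rule assms(1)[OF q(1)]) (use q(2) in auto)
qed

lemma abs_mult_eq_1D: "\<bar>x * y\<bar> = 1 \<Longrightarrow> \<bar>x\<bar> = 1 \<and> \<bar>y\<bar> = (1::int)"
  using abs_zmult_eq_1[of x y] abs_zmult_eq_1[of y x] by (simp add: mult.commute)

text \<open>
  In the Gaussian integers \<open>c + i\<close> and \<open>c - i\<close> are coprime, so \<open>c + i\<close> is a unit times the cube \<open>U + V i\<close> of some \<open>p + q i\<close>.
  Unique factorization is replaced by the congruence of the previous lemma: it shows that \<open>y\<close> is prime to \<open>U + c V\<close>,
  so that \<open>y^3\<close> divides \<open>U - c V\<close> and \<open>c + i\<close> and \<open>U + V i\<close>, which have the same norm, differ by a unit. The unit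
  is determined by \<open>k\<close>, and comparing imaginary parts leaves no nonzero \<open>c\<close>.
\<close>

lemma square_plus_one_eq_cube:
  fixes c y :: int
  assumes eq: "c ^ 2 + 1 = y ^ 3"
  shows "c = 0"
proof -
  have "y ^ 3 > 0" unfolding eq[symmetric] by (simp add: add_nonneg_pos)
  then have y0: "y > 0" by (simp add: zero_less_power_eq)
  have "odd y"
  proof
    assume "even y"
    then obtain w where w: "y = 2 * w" by (elim evenE)
    have "c ^ 2 + 1 = 8 * w ^ 3" using eq by (simp add: w power_mult_distrib)
    then have "(c ^ 2 + 1) mod 4 = 0" by (simp add: mod_eq_0_iff_dvd)
    moreover have "c mod 4 = 0 \<or> c mod 4 = 1 \<or> c mod 4 = 2 \<or> c mod 4 = 3" by presburger
    then have "(c ^ 2 + 1) mod 4 = 1 \<or> (c ^ 2 + 1) mod 4 = 2"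
      by (elim disjE) (simp_all add: power2_eq_square mod_simps flip: mod_add_left_eq mod_mult_eq)
    ultimately show False by auto
  qed
  have ydvd: "y dvd c ^ 2 + 1" unfolding eq by (simp add: power3_eq_cube)
  obtain p q where pq: "y = p ^ 2 + q ^ 2" "y dvd p - c * q"
    using sum_two_squares_factor[OF y0 ydvd] by blast
  then obtain w where w: "p = c * q + y * w" by (metis add.commute diff_add_cancel dvdE)
  have "y * 1 = (c * q + y * w) ^ 2 + q ^ 2" using pq(1) w by simp
  also have "\<dots> = q ^ 2 * (c ^ 2 + 1) + 2 * c * q * y * w + y ^ 2 * w ^ 2"
    by (simp add: power2_eq_square algebra_simps)
  also have "\<dots> = y * (q * (q * y ^ 2 + 2 * c * w) + y * w ^ 2)"
    unfolding eq by (simp add: power2_eq_square power3_eq_cube algebra_simps)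
  finally have unit: "q * (q * y ^ 2 + 2 * c * w) + y * w ^ 2 = 1" using y0 by simp
  define U V where "U = p ^ 3 - 3 * p * q ^ 2" and "V = 3 * p ^ 2 * q - q ^ 3"
  have UV: "U ^ 2 + V ^ 2 = y ^ 3" unfolding U_def V_def pq(1) by algebra
  have cop: "coprime (y ^ 3) (U + c * V)"
  proof (rule prime_factor_coprimeI)
    fix l :: int assume l: "prime l" "l dvd y ^ 3" "l dvd U + c * V"
    have ly: "l dvd y" using l prime_dvd_power by blast
    \<comment> \<open>Modulo a prime factor l of y, p is c q and c^2 is -1, so U + c V is -8 c q^3.\<close>
    have "2 ^ 3 * c * q ^ 3 = (p - c * q) * (p ^ 2 + c * p * q + c ^ 2 * q ^ 2 - 3 * q ^ 2 + 3 * c * q * (p + c * q))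
        + (c ^ 2 + 1) * (4 * c * q ^ 3) - (U + c * V)"
      unfolding U_def V_def by algebra
    moreover have "l dvd p - c * q" and lc: "l dvd c ^ 2 + 1" using ly pq(2) ydvd dvd_trans by blast+
    then have "l dvd (p - c * q) * (p ^ 2 + c * p * q + c ^ 2 * q ^ 2 - 3 * q ^ 2 + 3 * c * q * (p + c * q))
        + (c ^ 2 + 1) * (4 * c * q ^ 3) - (U + c * V)"
      by (intro dvd_diff[OF dvd_add l(3)] dvd_mult2)
    ultimately have "l dvd 2 ^ 3 * c * q ^ 3" by simp
    then have "l dvd 2 \<or> l dvd c \<or> l dvd q"
      using prime_dvd_multD[OF l(1)] prime_dvd_power[OF l(1)] by blast
    moreover have False if "l dvd 2"
    proof -
      have "l = 2" using that l(1) by (simp add: primes_dvd_imp_eq)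
      then show False using ly \<open>odd y\<close> by simp
    qed
    moreover have False if "l dvd c"
    proof -
      have "l dvd c ^ 2 + 1 - c * c" using dvd_diff[OF lc dvd_mult2[OF that]] .
      then have "l dvd 1" by (simp add: power2_eq_square)
      then show False using l(1) not_prime_unit by blast
    qed
    moreover have False if "l dvd q"
    proof -
      have "l dvd q * (q * y ^ 2 + 2 * c * w) + y * w ^ 2" by (intro dvd_add dvd_mult2 that ly)
      then show False using l(1) not_prime_unit unfolding unit by blast
    qed
    ultimately show False by blast
  qed (use y0 in simp)
  have "(U - c * V) * (U + c * V) = (U ^ 2 + V ^ 2) - (c ^ 2 + 1) * V ^ 2" by algebra
  also have "\<dots> = y ^ 3 * (1 - V ^ 2)" unfolding UV eq by algebra
  finally have "y ^ 3 dvd (U - c * V) * (U + c * V)" by simp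
  then have "y ^ 3 dvd U - c * V" using cop by (simp add: coprime_dvd_mult_left_iff)
  then obtain k where "U - c * V = y ^ 3 * k" by blast
  then have k: "U = c * V + (c ^ 2 + 1) * k" unfolding eq by simp
  have "(c ^ 2 + 1) * ((V + c * k) ^ 2 + k ^ 2) = (c ^ 2 + 1) * 1"
    using UV unfolding eq[symmetric] k by algebra
  moreover have "c ^ 2 + 1 \<noteq> 0" unfolding eq using y0 by simp
  ultimately have unit_circle: "(V + c * k) ^ 2 + k ^ 2 = 1" by (simp only: mult_cancel_left) simp
  have "k ^ 2 \<le> 1" using unit_circle zero_le_power2[of "V + c * k"] by linarith
  then have "\<bar>k\<bar> \<le> 1" by (simp add: abs_square_le_1)
  then consider "k = 0" | "\<bar>k\<bar> = 1" by linarith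
  then show ?thesis
  proof cases
    case 1
    have "V ^ 2 = 1" using unit_circle 1 by simp
    then have "\<bar>V\<bar> = 1" by (auto simp: power2_eq_1_iff)
    then have "\<bar>q * (3 * p ^ 2 - q ^ 2)\<bar> = 1" by (simp add: V_def power2_eq_square power3_eq_cube algebra_simps)
    then have "\<bar>q\<bar> = 1" "\<bar>3 * p ^ 2 - q ^ 2\<bar> = 1" using abs_mult_eq_1D by blast+
    then have "q ^ 2 = 1" "\<bar>3 * p ^ 2 - 1\<bar> = 1" by (metis one_power2 power2_abs)+
    then have "p ^ 2 = 0" by presburger
    then have "U = 0" by (simp add: U_def)
    then show ?thesis using k 1 \<open>\<bar>V\<bar> = 1\<close> by auto
  next
    case 2
    have "k ^ 2 = 1" using 2 by (metis one_power2 power2_abs)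
    then have "V = - c * k" using unit_circle by simp
    then have "U = k" using k \<open>k ^ 2 = 1\<close> by (simp add: power2_eq_square algebra_simps)
    then have "\<bar>p * (p ^ 2 - 3 * q ^ 2)\<bar> = 1" using 2
      by (simp add: U_def power2_eq_square power3_eq_cube algebra_simps)
    then have "\<bar>p\<bar> = 1" "\<bar>p ^ 2 - 3 * q ^ 2\<bar> = 1" using abs_mult_eq_1D by blast+
    then have "\<bar>1 - 3 * q ^ 2\<bar> = 1" by (metis one_power2 power2_abs)
    then have "q ^ 2 = 0" by presburger
    then have "V = 0" by (simp add: V_def)
    then show ?thesis using \<open>V = - c * k\<close> 2 by auto
  qed
qed

lemma even_power_mod_3:
  fixes u :: nat
  assumes "even m" "\<not> 3 dvd u ^ m" "m > 0"
  shows "u ^ m mod 3 = 1"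
proof -
  have "\<not> 3 dvd u" using assms(2,3) dvd_trans[OF _ dvd_power[of m u]] by blast
  then have "u mod 3 = 1 \<or> u mod 3 = 2" by presburger
  then have "u ^ 2 mod 3 = 1" by (elim disjE) (simp_all add: power2_eq_square flip: mod_mult_eq)
  then have "(u ^ 2) ^ (m div 2) mod 3 = 1" using power_mod[of "u ^ 2" 3 "m div 2"] by simp
  then show ?thesis using assms(1) by (simp flip: power_mult)
qed

lemma coprime_prod4_eq_power:
  fixes x y z t c :: nat
  assumes "coprime x y" "coprime x z" "coprime y z" "coprime t x" "coprime t y" "coprime t z"
    and "x * y * z * t = c ^ m"
  obtains u v w where "x = u ^ m" "y = v ^ m" "z = w ^ m"
proof -
  have 1: "coprime x (y * z * t)" using assms by (simp add: coprime_commute)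
  have 2: "coprime y (x * z * t)" using assms by (simp add: coprime_commute)
  have 3: "coprime z (x * y * t)" using assms by (simp add: coprime_commute)
  obtain u where "x = u ^ m" using coprime_mult_eq_power[OF 1, of c m] assms(7) by (metis mult.assoc)
  moreover obtain v where "y = v ^ m" using coprime_mult_eq_power[OF 2, of c m] assms(7) by (metis mult.assoc mult.left_commute)
  moreover obtain w where "z = w ^ m" using coprime_mult_eq_power[OF 3, of c m] assms(7) by (metis mult.assoc mult.left_commute mult.commute)
  ultimately show ?thesis using that by blast
qed

text \<open>
  The hypotheses make \<open>x\<close>, \<open>y\<close> and \<open>27 z\<close> perfect \<open>m\<close>-th powers. Even powers prime to three are \<open>1\<close> modulo three, so \<open>x + y\<close>
  cannot be the multiple \<open>z\<close> of three; the other two sign patterns are excluded by \<open>abc\<close>.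
\<close>

lemma no_abc_triple_divisible_by_3:
  fixes x y z t c :: nat
  assumes abc: explicit_abc_conjecture
    and m: "even m" "m \<ge> 8" and pos: "x > 0" "y > 0" "z > 0"
    and sum: "x + y = z \<or> x = y + z \<or> y = x + z"
    and cop: "coprime x y" "coprime x z" "coprime y z" "coprime t x" "coprime t y" "coprime t z"
    and t3: "\<not> 3 dvd t" and z3: "3 dvd z"
    and eq: "27 * (x * y * z) * t = c ^ m"
  shows False
proof -
  have p3: "prime (3::nat)" by simp
  have n3: "\<not> 3 dvd x" "\<not> 3 dvd y"
    using prime_not_dvd_coprime[OF cop(2) p3] prime_not_dvd_coprime[OF cop(3) p3] z3 by auto
  have c27: "coprime k 27" if "\<not> 3 dvd k" for k :: nat
  proof -
    have "coprime k 3" using that prime_imp_coprime[OF p3] by (simp add: coprime_commute)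
    then have "coprime k (3 ^ 3)" by (simp only: coprime_power_right_iff) simp
    then show ?thesis by simp
  qed
  have cop27: "coprime x (27 * z)" "coprime y (27 * z)" "coprime t (27 * z)"
    using c27 n3 t3 cop by simp_all
  have "x * y * (27 * z) * t = c ^ m" using eq by (simp add: ac_simps)
  then obtain u v w where uvw: "x = u ^ m" "y = v ^ m" "27 * z = w ^ m"
    by (rule coprime_prod4_eq_power[OF cop(1) cop27(1,2) cop(4,5) cop27(3)])
  have m0: "m > 0" using m by simp
  have "x mod 3 = 1" "y mod 3 = 1" using even_power_mod_3[OF m(1) _ m0] n3 uvw by auto
  then have "\<not> 3 dvd x + y" by presburger
  then have sum': "x = y + z \<or> y = x + z" using sum z3 by auto
  have two: "2 ^ 8 \<le> k ^ m" if "k ^ m > 1" for k :: nat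
  proof -
    have "k \<ge> 2"
    proof (rule ccontr)
      assume "\<not> k \<ge> 2"
      then have "k = 0 \<or> k = 1" by auto
      then show False using that m0 by (auto simp: power_0_left)
    qed
    then show ?thesis using m by (intro order.trans[OF power_increasing[of 8 m 2] power_mono]) auto
  qed
  from sum' show False
  proof
    assume s: "x = y + z"
    have "2 ^ 8 \<le> u ^ m" by (rule two) (use s uvw pos in linarith)
    then show False
      using abc_sum_of_almost_powers[OF abc pos(2,3) cop(3), of 1 v m 27 w u] uvw s m by simp
  next
    assume s: "y = x + z"
    have "2 ^ 8 \<le> v ^ m" by (rule two) (use s uvw pos in linarith)
    then show False
      using abc_sum_of_almost_powers[OF abc pos(1,3) cop(2), of 1 u m 27 w v] uvw s m by simp
  qed
qed

text \<open>
  All three numbers are even powers prime to three and hence \<open>1\<close> modulo three, but \<open>1 + 1\<close> is not \<open>1\<close>.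
\<close>

lemma no_abc_triple_prime_to_3:
  fixes x y z t c :: nat
  assumes m: "even m" "m > 0"
    and sum: "x + y = z \<or> x = y + z \<or> y = x + z"
    and cop: "coprime x y" "coprime x z" "coprime y z" "coprime t x" "coprime t y" "coprime t z"
    and n3: "\<not> 3 dvd x" "\<not> 3 dvd y" "\<not> 3 dvd z"
    and eq: "x * y * z * t = c ^ m"
  shows False
proof -
  obtain u v w where uvw: "x = u ^ m" "y = v ^ m" "z = w ^ m"
    by (rule coprime_prod4_eq_power[OF cop eq])
  have *: "x mod 3 = 1" "y mod 3 = 1" "z mod 3 = 1" using even_power_mod_3[OF m(1) _ m(2)] n3 uvw by auto
  have two: "(k + l) mod 3 = 2" if "k mod 3 = 1" "l mod 3 = 1" for k l :: nat using that by presburger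
  show False using sum two[OF *(1,2)] two[OF *(2,3)] two[OF *(1,3)] * by auto
qed

lemma coprime_add_mult_right_int: "coprime (x + y * k) y \<longleftrightarrow> coprime x (y::int)"
  by (metis add.commute coprime_iff_gcd_eq_1 gcd.commute gcd_add_mult mult.commute)

text \<open>
  Comparing the reduced forms of the fraction \<open>a^3 / c^m\<close>.
\<close>

lemma coprime_cubes_dvd_imp_abs_eq:
  fixes a c F A :: int
  assumes "a ^ 3 * A = - (c ^ m * F ^ 3)" "coprime F A" "coprime a c" "F \<noteq> 0"
  shows "\<bar>A\<bar> = \<bar>c\<bar> ^ m"
proof -
  have "F ^ 3 dvd a ^ 3 * A" unfolding assms(1) by simp
  then have "F ^ 3 dvd a ^ 3" using assms(2) by (simp add: coprime_dvd_mult_left_iff)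
  moreover have "a ^ 3 dvd c ^ m * F ^ 3" using assms(1) by (metis dvd_minus_iff dvd_triv_left)
  then have "a ^ 3 dvd F ^ 3" using assms(3) by (simp add: coprime_dvd_mult_right_iff)
  ultimately have aF: "\<bar>a ^ 3\<bar> = \<bar>F ^ 3\<bar>" by (simp add: zdvd_antisym_abs)
  have "\<bar>a ^ 3\<bar> * \<bar>A\<bar> = \<bar>c\<bar> ^ m * \<bar>F ^ 3\<bar>"
    using assms(1) by (metis abs_minus_cancel abs_mult power_abs)
  then have "\<bar>F ^ 3\<bar> * \<bar>A\<bar> = \<bar>F ^ 3\<bar> * \<bar>c\<bar> ^ m" by (simp only: aF mult.commute)
  then show ?thesis using assms(4) by simp
qed

text \<open>
  The forms \<open>F\<close> and \<open>27 p q r T^3\<close> are coprime apart from powers of three, so the equation identifies \<open>c^m\<close> with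
  \<open>27 p q r T^3\<close> up to sign, or with \<open>p q r (T/3)^3\<close> in case \<open>p\<close>, \<open>q\<close>, \<open>r\<close> are congruent modulo three. As \<open>p\<close>, \<open>q\<close>, \<open>r\<close>
  and \<open>T\<close> are pairwise coprime, \<open>p + q + r = 0\<close> becomes a relation between \<open>m\<close>-th powers.
\<close>

lemma cubic_obstruction:
  fixes a c p q r :: int
  assumes abc: explicit_abc_conjecture
    and m: "even m" "m \<ge> 8"
    and sum: "p + q + r = 0" and nz: "p \<noteq> 0" "q \<noteq> 0" "r \<noteq> 0" and cop: "coprime p q" "coprime a c"
    and T: "T = p ^ 2 + p * q + q ^ 2"
    and F: "F = p ^ 3 - 3 * p ^ 2 * q - 6 * p * q ^ 2 - q ^ 3"
    and eq: "27 * a ^ 3 * (p * q * r) * T ^ 3 = - (c ^ m * F ^ 3)"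
  shows False
proof -
  have r: "r = - (p + q)" using sum by simp
  have pr: "coprime p r" "coprime q r"
    unfolding r coprime_minus_right_iff using cop(1) by (simp_all add: coprime_iff_gcd_eq_1 gcd.commute[of q])
  have T0: "T > 0"
  proof -
    have "4 * T = (2 * p + q) ^ 2 + 3 * q ^ 2" unfolding T by algebra
    moreover have "q ^ 2 > 0" using nz by simp
    ultimately show ?thesis using zero_le_power2[of "2 * p + q"] by linarith
  qed
  have Tc: "coprime T p" "coprime T q" "coprime T r"
  proof -
    have "T = q ^ 2 + p * (p + q)" "T = p ^ 2 + q * (p + q)" "T = q ^ 2 + r * (- p)"
      unfolding T r by algebra+
    then show "coprime T p" "coprime T q" "coprime T r"
      using cop(1) pr by (metis coprime_add_mult_right_int coprime_power_left_iff coprime_commute)+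
  qed
  have Fc: "coprime F p" "coprime F q" "coprime F r"
  proof -
    have "F = (- q) ^ 3 + p * (p ^ 2 - 3 * p * q - 6 * q ^ 2)" "F = p ^ 3 + q * (- 3 * p ^ 2 - 6 * p * q - q ^ 2)"
      "F = q ^ 3 + r * (- (p ^ 2 - 4 * p * q - 2 * q ^ 2))"
      unfolding F r by algebra+
    then show "coprime F p" "coprime F q" "coprime F r"
      using cop(1) pr by (metis coprime_add_mult_right_int coprime_power_left_iff coprime_commute coprime_minus_left_iff)+
  qed
  have sum_nat: "nat \<bar>p\<bar> + nat \<bar>q\<bar> = nat \<bar>r\<bar> \<or> nat \<bar>p\<bar> = nat \<bar>q\<bar> + nat \<bar>r\<bar> \<or> nat \<bar>q\<bar> = nat \<bar>p\<bar> + nat \<bar>r\<bar>"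
    using sum by linarith
  have pos: "nat \<bar>p\<bar> > 0" "nat \<bar>q\<bar> > 0" "nat \<bar>r\<bar> > 0" using nz by auto
  have cn: "coprime (nat \<bar>x\<bar>) (nat \<bar>y\<bar>)" if "coprime x y" for x y :: int
    using that by (simp add: coprime_nat_abs_left_iff coprime_nat_abs_right_iff)
  have d3: "3 dvd nat \<bar>x\<bar> \<longleftrightarrow> 3 dvd x" for x :: int
    by (metis dvd_abs_iff int_dvd_int_iff int_nat_eq abs_ge_zero of_nat_numeral)
  note cops = cn[OF cop(1)] cn[OF pr(1)] cn[OF pr(2)]
  show False
  proof (cases "3 dvd F")
    case False
    have F0: "F \<noteq> 0" using False by auto
    have FT: "coprime F T"
    proof (rule prime_factor_coprimeI)
      fix l assume l: "prime l" "l dvd F" "l dvd T"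
      have "F = 3 * (q * q) * (q - p) + T * (p - 4 * q)" unfolding F T by algebra
      then have "l dvd 3 * (q * q) * (q - p)" using l by (metis dvd_add_left_iff dvd_mult2)
      moreover have "\<not> l dvd 3" using False l(2) primes_dvd_imp_eq[OF l(1), of 3] by auto
      moreover have "\<not> l dvd q" using Tc(2) l using coprime_common_divisor not_prime_unit by blast
      ultimately have lqp: "l dvd q - p" using l(1) by (auto simp: prime_dvd_mult_iff)
      have "T = (q - p) * (q - p) + 3 * (p * q)" unfolding T by algebra
      then have "l dvd 3 * (p * q)" using lqp l by (metis dvd_add_right_iff dvd_mult2)
      then have "l dvd p" using \<open>\<not> l dvd 3\<close> \<open>\<not> l dvd q\<close> l(1) by (auto simp: prime_dvd_mult_iff)
      then show False using Tc(1) l using coprime_common_divisor not_prime_unit by blast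
    qed (use F0 in simp)
    have "coprime F 3" using False prime_imp_coprime[of 3 F] by (simp add: coprime_commute)
    then have "coprime F (3 ^ 3)" by (simp only: coprime_power_right_iff) simp
    then have F3: "coprime F 27" by simp
    have "a ^ 3 * (27 * (p * q * r) * T ^ 3) = - (c ^ m * F ^ 3)" using eq by (simp add: ac_simps)
    moreover have "coprime F (27 * (p * q * r) * T ^ 3)" using FT Fc F3 by simp
    ultimately have "\<bar>27 * (p * q * r) * T ^ 3\<bar> = \<bar>c\<bar> ^ m"
      by (rule coprime_cubes_dvd_imp_abs_eq[OF _ _ cop(2) F0])
    then have "int (27 * (nat \<bar>p\<bar> * nat \<bar>q\<bar> * nat \<bar>r\<bar>) * nat T ^ 3) = int (nat \<bar>c\<bar> ^ m)"
      using T0 by (simp add: abs_mult power_abs)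
    then have main: "27 * (nat \<bar>p\<bar> * nat \<bar>q\<bar> * nat \<bar>r\<bar>) * nat T ^ 3 = nat \<bar>c\<bar> ^ m"
      by (simp only: of_nat_eq_iff)
    have "\<not> 3 dvd p - q"
    proof
      assume "3 dvd p - q"
      then have "3 dvd (p - q) * (p ^ 2 + p * q + q ^ 2) - 3 * (p ^ 2 * q + 2 * p * q ^ 2)" by (intro dvd_diff) auto
      also have "(p - q) * (p ^ 2 + p * q + q ^ 2) - 3 * (p ^ 2 * q + 2 * p * q ^ 2) = F" unfolding F by algebra
      finally show False using False by simp
    qed
    then have "3 dvd p \<or> 3 dvd q \<or> 3 dvd r" unfolding r by presburger
    have Tn3: "\<not> 3 dvd nat T ^ 3"
    proof
      assume "3 dvd nat T ^ 3"
      then have "3 dvd nat T" using prime_dvd_power[of "3::nat"] by simp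
      then have "3 dvd T" using d3[of T] T0 by simp
      moreover have "T = (p - q) ^ 2 + 3 * (p * q)" unfolding T by algebra
      ultimately have "3 dvd (p - q) ^ 2" by presburger
      then have "3 dvd p - q" using prime_dvd_power[of "3::int" "p - q" 2] by simp
      then show False using \<open>\<not> 3 dvd p - q\<close> by simp
    qed
    have ct: "coprime (nat T ^ 3) (nat \<bar>p\<bar>)" "coprime (nat T ^ 3) (nat \<bar>q\<bar>)" "coprime (nat T ^ 3) (nat \<bar>r\<bar>)"
      using cn[OF Tc(1)] cn[OF Tc(2)] cn[OF Tc(3)] T0 by simp_all
    have cops': "coprime (nat \<bar>q\<bar>) (nat \<bar>p\<bar>)" "coprime (nat \<bar>r\<bar>) (nat \<bar>p\<bar>)" "coprime (nat \<bar>r\<bar>) (nat \<bar>q\<bar>)"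
      using cops by (simp_all only: coprime_commute)
    have main_q: "27 * (nat \<bar>p\<bar> * nat \<bar>r\<bar> * nat \<bar>q\<bar>) * nat T ^ 3 = nat \<bar>c\<bar> ^ m"
      and main_p: "27 * (nat \<bar>q\<bar> * nat \<bar>r\<bar> * nat \<bar>p\<bar>) * nat T ^ 3 = nat \<bar>c\<bar> ^ m"
      using main by (simp_all only: ac_simps)
    from \<open>3 dvd p \<or> 3 dvd q \<or> 3 dvd r\<close> show False
    proof (elim disjE)
      assume "3 dvd r"
      then have z: "3 dvd nat \<bar>r\<bar>" using d3 by blast
      show False
        by (rule no_abc_triple_divisible_by_3[OF abc m pos sum_nat cops ct Tn3 z main])
    next
      assume "3 dvd q"
      then have z: "3 dvd nat \<bar>q\<bar>" using d3 by blast
      show False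
        by (rule no_abc_triple_divisible_by_3[OF abc m pos(1,3,2) _ cops(2,1) cops'(3) ct(1,3,2) Tn3 z main_q])
          (use sum_nat in linarith)
    next
      assume "3 dvd p"
      then have z: "3 dvd nat \<bar>p\<bar>" using d3 by blast
      show False
        by (rule no_abc_triple_divisible_by_3[OF abc m pos(2,3,1) _ cops(3) cops'(1,2) ct(2,3,1) Tn3 z main_p])
          (use sum_nat in linarith)
    qed
  next
    case True
    have "(p - q) * (p ^ 2 + p * q + q ^ 2) = F + 3 * (p ^ 2 * q + 2 * p * q ^ 2)" unfolding F by algebra
    then have "3 dvd (p - q) * (p ^ 2 + p * q + q ^ 2)" using True by simp
    then have "3 dvd p - q \<or> 3 dvd p ^ 2 + p * q + q ^ 2" by (simp add: prime_dvd_mult_iff)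
    moreover have "p ^ 2 + p * q + q ^ 2 = (p - q) ^ 2 + 3 * (p * q)" by algebra
    ultimately have "3 dvd p - q \<or> 3 dvd (p - q) ^ 2" by presburger
    then have "3 dvd q - p" using prime_dvd_power[of "3::int" "p - q" 2] by (auto simp: dvd_diff_commute)
    then obtain x where x: "q - p = 3 * x" by blast
    then have p: "p = q - 3 * x" by simp
    \<comment> \<open>Dividing out the common powers of three: T is 3 T' and F is 9 F', with F' prime to three.\<close>
    define T' F' where "T' = 3 * x ^ 2 + p * q" and "F' = - 3 * x ^ 3 - q ^ 3 + 3 * x * q ^ 2"
    have T': "T = 3 * T'" unfolding T T'_def p by algebra
    have F': "F = 9 * F'" unfolding F F'_def p by algebra
    have q3: "\<not> 3 dvd q"
    proof
      assume "3 dvd q"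
      then have "3 dvd p" unfolding p by simp
      then show False using \<open>3 dvd q\<close> coprime_common_divisor[OF cop(1), of 3] by simp
    qed
    then have n3: "\<not> 3 dvd p" "\<not> 3 dvd r" unfolding r p by presburger+
    have F'3: "\<not> 3 dvd F'"
    proof
      assume "3 dvd F'"
      then have "3 dvd 3 * (x * q ^ 2 - x ^ 3) - F'" by (intro dvd_diff) auto
      also have "3 * (x * q ^ 2 - x ^ 3) - F' = q ^ 3" unfolding F'_def by algebra
      finally show False using q3 prime_dvd_power[of "3::int" q 3] by simp
    qed
    then have F'0: "F' \<noteq> 0" by auto
    have T'c: "coprime T' p" "coprime T' q" "coprime T' r" using Tc unfolding T' by simp_all
    have F'c: "coprime F' p" "coprime F' q" "coprime F' r" using Fc unfolding F' by simp_all
    have FT: "coprime F' T'"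
    proof (rule prime_factor_coprimeI)
      fix l assume l: "prime l" "l dvd F'" "l dvd T'"
      have "q * q * x = F' + T' * (x + q)" unfolding F'_def T'_def p by algebra
      then have "l dvd q * q * x" using l by simp
      moreover have nq: "\<not> l dvd q" using T'c(2) l using coprime_common_divisor not_prime_unit by blast
      ultimately have "l dvd x" using l(1) by (auto simp: prime_dvd_mult_iff)
      then have "l dvd T' - 3 * (x * x)" using l by (intro dvd_diff) auto
      also have "T' - 3 * (x * x) = p * q" unfolding T'_def by algebra
      finally have "l dvd p" using nq l(1) by (auto simp: prime_dvd_mult_iff)
      then show False using T'c(1) l using coprime_common_divisor not_prime_unit by blast
    qed (use F'0 in simp)
    have "729 * (a ^ 3 * (p * q * r * T' ^ 3)) = 729 * (- (c ^ m * F' ^ 3))"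
      using eq unfolding T' F' by (simp add: power_mult_distrib)
    then have "a ^ 3 * (p * q * r * T' ^ 3) = - (c ^ m * F' ^ 3)"
      by (simp only: mult_cancel_left) simp
    moreover have "coprime F' (p * q * r * T' ^ 3)" using FT F'c by simp
    ultimately have "\<bar>p * q * r * T' ^ 3\<bar> = \<bar>c\<bar> ^ m"
      by (rule coprime_cubes_dvd_imp_abs_eq[OF _ _ cop(2) F'0])
    then have "int (nat \<bar>p\<bar> * nat \<bar>q\<bar> * nat \<bar>r\<bar> * nat T' ^ 3) = int (nat \<bar>c\<bar> ^ m)"
      using T0 T' by (simp add: abs_mult power_abs)
    then have main: "nat \<bar>p\<bar> * nat \<bar>q\<bar> * nat \<bar>r\<bar> * nat T' ^ 3 = nat \<bar>c\<bar> ^ m"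
      by (simp only: of_nat_eq_iff)
    have ct: "coprime (nat T' ^ 3) (nat \<bar>p\<bar>)" "coprime (nat T' ^ 3) (nat \<bar>q\<bar>)" "coprime (nat T' ^ 3) (nat \<bar>r\<bar>)"
      using cn[OF T'c(1)] cn[OF T'c(2)] cn[OF T'c(3)] T0 T' by simp_all
    have m0: "m > 0" using m by simp
    have n3': "\<not> 3 dvd nat \<bar>p\<bar>" "\<not> 3 dvd nat \<bar>q\<bar>" "\<not> 3 dvd nat \<bar>r\<bar>" using d3 n3 q3 by auto
    show False
      by (rule no_abc_triple_prime_to_3[OF m(1) m0 sum_nat cops ct n3' main])
  qed
qed

section \<open>Iterates of a unicritical polynomial\<close>

lemma alg_closed_subfield_Rats: "alg_closed_subfield (\<rat> :: 'a::{alg_closed_field, field_char_0} set)"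
  by unfold_locales auto

abbreviation poly_of_rat :: "rat poly \<Rightarrow> complex poly"
  where "poly_of_rat \<equiv> map_poly of_rat"

lemma coeff_poly_of_rat: "coeff (poly_of_rat p) i = of_rat (coeff p i)"
  by (simp add: coeff_map_poly)

lemma poly_of_rat_mult: "poly_of_rat (p * q) = poly_of_rat p * poly_of_rat q"
  by (rule poly_eqI) (simp add: coeff_poly_of_rat coeff_mult of_rat_sum of_rat_mult)

lemma poly_of_rat_power: "poly_of_rat (p ^ n) = poly_of_rat p ^ n"
  by (induction n) (simp_all add: poly_of_rat_mult)

lemma poly_of_rat_add: "poly_of_rat (p + q) = poly_of_rat p + poly_of_rat q"
  by (rule poly_eqI) (simp add: coeff_poly_of_rat of_rat_add)

lemma poly_of_rat_eq_iff: "poly_of_rat p = poly_of_rat q \<longleftrightarrow> p = q"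
  by (simp add: poly_eq_iff coeff_poly_of_rat)

lemma degree_poly_of_rat: "degree (poly_of_rat p) = degree p"
  by (rule degree_map_poly) simp

lemma polys_over_Rats_iff: "p \<in> polys_over \<rat> \<longleftrightarrow> (\<exists>q. p = poly_of_rat q)"
proof
  assume p: "p \<in> polys_over \<rat>"
  define q where "q = map_poly (inv of_rat) p"
  have inv: "inv of_rat (of_rat x :: complex) = x" for x by (rule inv_f_f) (auto intro: injI)
  have "inv of_rat (0 :: complex) = (0 :: rat)" using inv[of 0] by simp
  then have "coeff (poly_of_rat q) i = coeff p i" for i
    using p inv by (auto simp: coeff_poly_of_rat q_def coeff_map_poly polys_over_def Rats_def elim!: allE[of _ i])
  then show "\<exists>q. p = poly_of_rat q" by (metis poly_eqI)
qed (auto simp: polys_over_def coeff_poly_of_rat)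

lemma irreducible_over_Rats_iff: "irreducible_over \<rat> (poly_of_rat p) \<longleftrightarrow> irreducible p"
proof
  assume irr: "irreducible_over \<rat> (poly_of_rat p)"
  then have deg: "degree p > 0" by (simp add: irreducible_over_def degree_poly_of_rat)
  show "irreducible p"
  proof (rule irreducibleI)
    show "p \<noteq> 0" using deg by auto
    then show "\<not> is_unit p" using deg is_unit_iff_degree[of p] by simp
    fix a b assume ab: "p = a * b"
    have "degree (poly_of_rat a) = 0 \<or> degree (poly_of_rat b) = 0"
      by (rule irreducible_overD[OF irr]) (auto simp: ab poly_of_rat_mult polys_over_Rats_iff)
    then show "is_unit a \<or> is_unit b"
      using ab \<open>p \<noteq> 0\<close> by (auto simp: degree_poly_of_rat is_unit_iff_degree)
  qed
next
  assume irr: "irreducible p"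
  then have nz: "p \<noteq> 0" "\<not> is_unit p" by (simp_all add: irreducible_def)
  show "irreducible_over \<rat> (poly_of_rat p)" unfolding irreducible_over_def
  proof (intro conjI ballI impI)
    show "poly_of_rat p \<in> polys_over \<rat>" by (auto simp: polys_over_Rats_iff)
    show "degree (poly_of_rat p) > 0" using nz by (auto simp: degree_poly_of_rat is_unit_iff_degree)
    fix A B assume AB: "A \<in> polys_over \<rat>" "B \<in> polys_over \<rat>" "poly_of_rat p = A * B"
    then obtain a b where ab: "A = poly_of_rat a" "B = poly_of_rat b" by (auto simp: polys_over_Rats_iff)
    then have "p = a * b" using AB(3) by (simp add: poly_of_rat_eq_iff flip: poly_of_rat_mult)
    then have "is_unit a \<or> is_unit b" "a \<noteq> 0" "b \<noteq> 0" using irr nz by (auto dest: irreducibleD)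
    then show "degree A = 0 \<or> degree B = 0" by (auto simp: ab degree_poly_of_rat is_unit_iff_degree)
  qed
qed

abbreviation unicritical :: "nat \<Rightarrow> int \<Rightarrow> 'a::field_char_0 poly"
  where "unicritical d c \<equiv> monom 1 d + [:1 / of_int c:]"

lemma pcompose_unicritical:
  "pcompose (unicritical d c) q = q ^ d + [:1 / of_int c :: 'a::field_char_0:]"
proof -
  have "pcompose (monom 1 d) q = (q ^ d :: 'a poly)"
    by (simp add: monom_altdef[of _ d] pcompose_power pcompose_pCons)
  then show ?thesis by (simp add: pcompose_add)
qed

lemma poly_of_rat_iterate:
  "poly_of_rat (poly_iterate n (unicritical d c)) = poly_iterate n (unicritical d c)"
proof (induction n)
  case 0
  then show ?case by (simp add: poly_iterate_def map_poly_pCons)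
next
  case (Suc n)
  have "poly_of_rat [:1 / of_int c:] = [:1 / of_int c:]" by (simp add: map_poly_pCons of_rat_divide)
  then show ?case using Suc
    by (simp add: poly_iterate_Suc pcompose_unicritical poly_of_rat_add poly_of_rat_power)
qed

lemma poly_iterate_Suc': "poly_iterate (Suc n) f = pcompose (poly_iterate n f) (f :: 'a::comm_ring_1 poly)"
proof (induction n)
  case 0
  then show ?case by (simp add: poly_iterate_def pcompose_pCons)
next
  case (Suc n)
  then show ?case by (metis poly_iterate_Suc pcompose_assoc)
qed

lemma degree_unicritical: "d > 0 \<Longrightarrow> degree (unicritical d c) = d"
  using degree_add_eq_left[of "[:1 / of_int c:]" "monom 1 d"] by (simp add: degree_monom_eq)

lemma monic_iterate:
  assumes "d > 0"
  shows "degree (poly_iterate n (unicritical d c :: 'a::field_char_0 poly)) = d ^ n"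
    and "lead_coeff (poly_iterate n (unicritical d c :: 'a poly)) = 1"
proof -
  have lc: "lead_coeff (unicritical d c :: 'a poly) = 1"
    using assms by (simp only: degree_unicritical[OF assms]) (simp add: coeff_pCons split: nat.split)
  have "degree (poly_iterate n (unicritical d c :: 'a poly)) = d ^ n \<and>
      lead_coeff (poly_iterate n (unicritical d c :: 'a poly)) = 1"
  proof (induction n)
    case 0
    then show ?case by (simp add: poly_iterate_def)
  next
    case (Suc n)
    let ?q = "poly_iterate n (unicritical d c :: 'a poly)"
    have "degree ?q > 0" using Suc assms by simp
    then have "lead_coeff (pcompose (unicritical d c) ?q) = 1"
      using Suc lc by (subst lead_coeff_comp) auto
    moreover have "degree (pcompose (unicritical d c) ?q) = d * d ^ n"
      using Suc by (simp add: degree_pcompose degree_unicritical[OF assms])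
    ultimately show ?case by (simp add: poly_iterate_Suc)
  qed
  then show "degree (poly_iterate n (unicritical d c :: 'a poly)) = d ^ n"
    "lead_coeff (poly_iterate n (unicritical d c :: 'a poly)) = 1" by auto
qed

lemma poly_iterate_0_eq:
  assumes "d > 0" "c \<noteq> 0"
  shows "poly (poly_iterate (Suc k) (unicritical d c)) 0 =
    (of_int (iterate_num d c k) / of_int c ^ (d ^ k) :: 'a::field_char_0)"
proof (induction k)
  case 0
  then show ?case using assms by (simp add: poly_iterate_def poly_monom zero_power)
next
  case (Suc k)
  have "c ^ (d ^ Suc k) = c * c ^ (d ^ Suc k - 1)"
    using assms by (metis Suc_pred' power_Suc zero_less_power)
  then have e: "(of_int c :: 'a) ^ (d ^ Suc k) = of_int c * of_int c ^ (d ^ Suc k - 1)"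
    by (metis of_int_mult of_int_power)
  have "poly (poly_iterate (Suc (Suc k)) (unicritical d c)) 0 =
      (of_int (iterate_num d c k) / of_int c ^ (d ^ k)) ^ d + 1 / (of_int c :: 'a)"
    by (subst poly_iterate_Suc) (simp add: poly_pcompose Suc poly_monom)
  also have "\<dots> = of_int (iterate_num d c k) ^ d / of_int c ^ (d ^ Suc k) + 1 / of_int c"
    by (simp add: power_divide mult.commute flip: power_mult)
  also have "\<dots> = of_int (iterate_num d c (Suc k)) / of_int c ^ (d ^ Suc k)"
    unfolding e using assms by (simp add: field_simps)
  finally show ?case .
qed

lemma poly_iterate_inverse_c:
  assumes "d > 0"
  shows "poly (poly_iterate n (unicritical d c)) (1 / of_int c) = poly (poly_iterate (Suc n) (unicritical d c)) 0"
  using assms by (simp add: poly_iterate_Suc' poly_pcompose poly_monom zero_power)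

context alg_closed_subfield begin

text \<open>
  After the shift \<open>x \<mapsto> x + 1/c\<close> the inner polynomial \<open>f\<close> is a pure power of \<open>x\<close>, and the value at zero of the shifted
  polynomial is \<open>P(1/c)\<close>.
\<close>

lemma iterate_step:
  assumes irr: "irreducible_over K P" "lead_coeff P = 1" and d: "d > 0" "even (degree P) \<or> odd d"
    and c: "1 / of_int c \<in> K"
    and red: "\<not> irreducible_over K (pcompose P (monom 1 d + [:1 / of_int c:]))"
  obtains p w where "prime p" "p dvd d" "w \<in> K" "poly P (1 / of_int c) = w ^ p"
proof -
  define G where "G = pcompose P [:1 / of_int c, 1:]"
  have "pcompose [:1 / of_int c, 1:] (monom 1 d) = (monom 1 d + [:1 / of_int c:] :: 'a poly)"
    by (simp add: pcompose_pCons)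
  then have "pcompose G (monom 1 d) = pcompose P (monom 1 d + [:1 / of_int c:])"
    by (simp add: G_def flip: pcompose_assoc)
  moreover have "irreducible_over K G" unfolding G_def by (rule irreducible_over_shift[OF irr(1) c])
  moreover have "lead_coeff G = 1" using irr(2) by (simp add: G_def lead_coeff_comp)
  moreover have "even (degree G) \<or> odd d" using d(2) by (simp add: G_def degree_pcompose)
  ultimately obtain p w where "prime p" "p dvd d" "w \<in> K" "poly G 0 = w ^ p"
    using reducible_power_substitution[of G d] d(1) red by auto
  then show ?thesis using that by (simp add: G_def poly_pcompose)
qed

end

section \<open>Stability\<close>

lemma Rats_power_of_int_imp_Ints:
  fixes x :: complex
  assumes "x \<in> \<rat>" "x ^ p = of_int N" "p > 0"
  shows "x \<in> \<int>"
proof -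
  have "algebraic_int (of_int N :: complex)" by (rule int_imp_algebraic_int) simp
  then have "algebraic_int x"
    using assms(2,3) algebraic_int_root[of "of_int N" "monom 1 p" x] by (simp add: poly_monom degree_monom_eq)
  then show ?thesis using rational_algebraic_int_is_int assms(1) by blast
qed

text \<open>
  Over \<open>K = \<rat>\<close> the value \<open>f^(k+1)(1/c) = f^(k+2)(0)\<close> would be a \<open>p\<close>-th power with \<open>p\<close> dividing \<open>d\<close>. Its denominator
  \<open>c^(d^(k+1))\<close> is a \<open>p\<close>-th power too, so the numerator is one as well.
\<close>

lemma irreducible_iterate_generic:
  assumes abc: explicit_abc_conjecture
    and d: "d \<ge> 5 \<or> d = 4 \<and> c < 0" and c: "c \<noteq> 0" "c \<noteq> -1"
    and irr: "irreducible_over \<rat> (unicritical d c :: complex poly)"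
  shows "irreducible_over \<rat> (poly_iterate (Suc k) (unicritical d c) :: complex poly)"
proof (induction k)
  case 0
  then show ?case using irr by (simp add: poly_iterate_def)
next
  case (Suc k)
  interpret alg_closed_subfield "\<rat> :: complex set" by (rule alg_closed_subfield_Rats)
  let ?F = "poly_iterate (Suc k) (unicritical d c) :: complex poly"
  have d0: "d > 0" using d by auto
  show ?case
  proof (rule ccontr)
    assume "\<not> ?case"
    then have "\<not> irreducible_over \<rat> (pcompose ?F (unicritical d c))" by (subst (asm) poly_iterate_Suc')
    moreover have "even (degree ?F) \<or> odd d" unfolding monic_iterate(1)[OF d0] by auto
    ultimately obtain p w where pw: "prime p" "p dvd d" "w \<in> \<rat>" "poly ?F (1 / of_int c) = w ^ p"
      using iterate_step[OF Suc monic_iterate(2)[OF d0] d0] by auto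
    obtain j where j: "d ^ Suc k = p * j" using pw(2) by (metis dvd_def dvd_power dvd_trans zero_less_Suc)
    have "of_int (iterate_num d c (Suc k)) / of_int c ^ (d ^ Suc k) = w ^ p"
      using pw(4) by (simp only: poly_iterate_inverse_c[OF d0] poly_iterate_0_eq[OF d0 c(1)])
    then have "of_int (iterate_num d c (Suc k)) = w ^ p * of_int c ^ (p * j)"
      using c(1) unfolding j by (simp add: field_simps)
    then have eq: "(w * of_int c ^ j) ^ p = of_int (iterate_num d c (Suc k))"
      by (simp add: power_mult_distrib mult.commute flip: power_mult)
    moreover have "w * of_int c ^ j \<in> \<rat>" using pw(3) by auto
    ultimately have "w * of_int c ^ j \<in> \<int>"
      using Rats_power_of_int_imp_Ints pw(1) prime_gt_0_nat by blast
    then obtain y where "w * of_int c ^ j = of_int y" by (elim Ints_cases)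
    then have "(of_int (y ^ p) :: complex) = of_int (iterate_num d c (Suc k))" using eq by simp
    then have "iterate_num d c (Suc k) = y ^ p" by (simp only: of_int_eq_iff)
    then show False using iterate_num_not_prime_power[OF abc d c pw(1,2)] by blast
  qed
qed

lemma adjoin_quadratic:
  assumes "subfield (K :: 'a::field set)" "\<delta> ^ 2 \<in> K" "w \<in> adjoin K \<delta>"
  obtains x z where "x \<in> K" "z \<in> K" "w = x + z * \<delta>"
proof -
  interpret subfield K by fact
  obtain s where s: "s \<in> polys_over K" "w = poly s \<delta>" using assms(3) by (auto simp: adjoin_def)
  have "\<exists>x z. x \<in> K \<and> z \<in> K \<and> poly s \<delta> = x + z * \<delta>" using s(1)
  proof (induction s)
    case 0
    then show ?case by (intro exI[of _ 0]) auto
  next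
    case (pCons a s)
    then obtain x z where xz: "x \<in> K" "z \<in> K" "poly s \<delta> = x + z * \<delta>" by auto
    have "poly (pCons a s) \<delta> = (a + z * \<delta> ^ 2) + x * \<delta>" using xz(3) by (simp add: algebra_simps power2_eq_square)
    then show ?case using xz pCons.prems assms(2) by (intro exI[of _ "a + z * \<delta> ^ 2"] exI[of _ x]) auto
  qed
  then show ?thesis using that s(2) by blast
qed

lemma adjoin_cubic:
  assumes "subfield (K :: 'a::field set)" "\<alpha> ^ 3 \<in> K" "w \<in> adjoin K \<alpha>"
  obtains x y z where "x \<in> K" "y \<in> K" "z \<in> K" "w = x + y * \<alpha> + z * \<alpha> ^ 2"
proof -
  interpret subfield K by fact
  obtain s where s: "s \<in> polys_over K" "w = poly s \<alpha>" using assms(3) by (auto simp: adjoin_def)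
  have "\<exists>x y z. x \<in> K \<and> y \<in> K \<and> z \<in> K \<and> poly s \<alpha> = x + y * \<alpha> + z * \<alpha> ^ 2" using s(1)
  proof (induction s)
    case 0
    then show ?case by (intro exI[of _ 0]) auto
  next
    case (pCons a s)
    then obtain x y z where xyz: "x \<in> K" "y \<in> K" "z \<in> K" "poly s \<alpha> = x + y * \<alpha> + z * \<alpha> ^ 2" by auto
    have "poly (pCons a s) \<alpha> = (a + z * \<alpha> ^ 3) + x * \<alpha> + y * \<alpha> ^ 2"
      using xyz(4) by (simp add: algebra_simps power2_eq_square power3_eq_cube)
    then show ?case using xyz pCons.prems assms(2)
      by (intro exI[of _ "a + z * \<alpha> ^ 3"] exI[of _ x] exI[of _ y]) auto
  qed
  then show ?thesis using that s(2) by blast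
qed

text \<open>
  The equation is monic of degree four in \<open>2 X\<close>, hence \<open>2 X\<close> is an integer; the right side is even after multiplication by
  four, so this integer is even.
\<close>

lemma quartic_equation_Ints:
  fixes X :: complex and a c :: int
  assumes "X \<in> \<rat>" "4 * X ^ 2 * (X ^ 2 - of_int a ^ 2) = of_int c ^ m"
  obtains N where "X = of_int N"
proof -
  define q :: "complex poly" where "q = [:- 4 * of_int c ^ m, 0, - 4 * of_int a ^ 2, 0, 1:]"
  have "poly q (2 * X) = 4 * (4 * X ^ 2 * (X ^ 2 - of_int a ^ 2) - of_int c ^ m)"
    by (simp add: q_def algebra_simps power2_eq_square)
  then have "poly q (2 * X) = 0" using assms(2) by simp
  moreover have "lead_coeff q = 1" by (simp add: q_def)
  moreover have "coeff q i \<in> \<int>" for i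
    by (auto simp: q_def coeff_pCons split: nat.split)
  ultimately have "algebraic_int (2 * X)" by (auto simp: algebraic_int.simps)
  moreover have "2 * X \<in> \<rat>" using assms(1) by auto
  ultimately have "2 * X \<in> \<int>" by (rule rational_algebraic_int_is_int)
  then obtain k where k: "2 * X = of_int k" by (elim Ints_cases)
  have "of_int (k ^ 2 * (k ^ 2 - 4 * a ^ 2)) = (2 * X) ^ 2 * ((2 * X) ^ 2 - 4 * of_int a ^ 2)" by (simp add: k)
  also have "\<dots> = 4 * (4 * X ^ 2 * (X ^ 2 - of_int a ^ 2))" by (simp add: power_mult_distrib algebra_simps)
  also have "\<dots> = of_int (4 * c ^ m)" by (simp add: assms(2))
  finally have "k ^ 2 * (k ^ 2 - 4 * a ^ 2) = 4 * c ^ m" by (simp only: of_int_eq_iff)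
  then have "even (k ^ 2 * (k ^ 2 - 4 * a ^ 2))" by simp
  then have "even k" by simp
  then obtain N where "k = 2 * N" by (elim evenE)
  then show ?thesis using that[of N] k by simp
qed

text \<open>
  With \<open>w = x + z \<delta>\<close> and \<open>v\<close> the value at zero, comparing coordinates in \<open>v^2 - \<delta> = w^2\<close> yields \<open>v^2 = x^2 - z^2 / c\<close> and
  \<open>2 x z = -1\<close>. Elimination of \<open>z\<close> and clearing denominators gives \<open>4 X^2 (X^2 - a^2) = c^m\<close> for \<open>X = x c^D\<close>, with
  \<open>D = 4^k\<close> and \<open>m = 4 D - 1\<close>. Positivity of \<open>c\<close> makes \<open>\<delta>\<close> irrational.
\<close>

lemma quartic_norm_equation:
  fixes \<delta> w :: complex
  assumes abc: explicit_abc_conjecture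
    and \<delta>: "\<delta> ^ 2 = - 1 / of_int c" and c: "c > 0"
    and w: "w \<in> adjoin \<rat> \<delta>"
    and eq: "(of_int (iterate_num 4 c k) / of_int c ^ (4 ^ k)) ^ 2 - \<delta> = w ^ 2"
  shows False
proof -
  interpret alg_closed_subfield "\<rat> :: complex set" by (rule alg_closed_subfield_Rats)
  define a where "a = iterate_num 4 c k"
  define D :: nat where "D = 4 ^ k"
  define v :: complex where "v = of_int a / of_int c ^ D"
  have a: "a > 0" unfolding a_def by (rule iterate_num_pos[OF c])
  have D: "D \<ge> 1" by (simp add: D_def)
  have vQ: "v \<in> \<rat>" by (auto simp: v_def)
  have "- 1 / of_int c \<in> (\<rat> :: complex set)" by auto
  then have dQ: "\<delta> ^ 2 \<in> \<rat>" by (simp only: \<delta>)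
  obtain x z where xz: "x \<in> \<rat>" "z \<in> \<rat>" "w = x + z * \<delta>"
    using adjoin_quadratic[OF subfield_axioms dQ w] .
  have "v ^ 2 - x ^ 2 + z ^ 2 / of_int c = (1 + 2 * x * z) * \<delta>"
  proof -
    have "v ^ 2 - \<delta> = x ^ 2 + 2 * x * z * \<delta> + z ^ 2 * \<delta> ^ 2"
      using eq by (simp add: v_def a_def D_def xz(3) power2_eq_square algebra_simps)
    then show ?thesis unfolding \<delta> by (simp add: algebra_simps)
  qed
  moreover have "\<delta> \<notin> \<rat>"
  proof
    assume "\<delta> \<in> \<rat>"
    then obtain t where "\<delta> = of_rat t" by (elim Rats_cases)
    then have "of_rat (t ^ 2) = (of_rat (- 1 / of_int c) :: complex)" using \<delta> by (simp add: of_rat_power of_rat_divide of_rat_minus)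
    then have "t ^ 2 = - 1 / of_int c" by (simp only: of_rat_eq_iff)
    then have "t ^ 2 < 0" using c by simp
    then show False using zero_le_power2[of t] by linarith
  qed
  moreover have "v ^ 2 - x ^ 2 + z ^ 2 / of_int c \<in> \<rat>" "1 + 2 * x * z \<in> \<rat>" using vQ xz by auto
  ultimately have lin: "1 + 2 * x * z = 0" "v ^ 2 - x ^ 2 + z ^ 2 / of_int c = 0"
    by (metis Rats_divide nonzero_mult_div_cancel_left, metis Rats_divide nonzero_mult_div_cancel_left mult_zero_left)
  define X where "X = x * of_int c ^ D"
  have XQ: "X \<in> \<rat>" using xz by (auto simp: X_def)
  have vc: "v * of_int c ^ D = of_int a" using c by (simp add: v_def)
  have "of_int c * (X ^ 2 - of_int a ^ 2) = of_int c * (of_int c ^ D) ^ 2 * (x ^ 2 - v ^ 2)"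
    unfolding vc[symmetric] X_def by (simp add: power_mult_distrib algebra_simps)
  also have "x ^ 2 - v ^ 2 = z ^ 2 / of_int c" using lin(2) by (simp add: algebra_simps)
  also have "of_int c * (of_int c ^ D) ^ 2 * (z ^ 2 / of_int c) = (of_int c ^ D) ^ 2 * z ^ 2" using c by simp
  finally have cW: "of_int c * (X ^ 2 - of_int a ^ 2) = (of_int c ^ D) ^ 2 * z ^ 2" .
  have "of_int c * (4 * X ^ 2 * (X ^ 2 - of_int a ^ 2)) = 4 * X ^ 2 * (of_int c * (X ^ 2 - of_int a ^ 2))"
    by simp
  also have "\<dots> = (of_int c ^ D) ^ 4 * (2 * x * z) ^ 2"
    unfolding cW unfolding X_def by (simp add: power_mult_distrib mult.commute[of D] flip: power_mult power_add)
  also have "(2 * x * z) ^ 2 = 1" using lin(1) by (metis add_eq_0_iff power2_minus one_power2)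
  also have "(of_int c ^ D) ^ 4 * 1 = of_int c * (of_int c ^ (4 * D - 1) :: complex)"
  proof -
    have "D * 4 = Suc (4 * D - 1)" using D by simp
    then show ?thesis by (metis mult_1_right power_Suc power_mult)
  qed
  finally have main: "4 * X ^ 2 * (X ^ 2 - of_int a ^ 2) = of_int c ^ (4 * D - 1)" using c by simp
  obtain N where N: "X = of_int N" by (rule quartic_equation_Ints[OF XQ main])
  have "of_int (4 * N ^ 2 * (N ^ 2 - a ^ 2)) = (of_int (c ^ (4 * D - 1)) :: complex)" using main N by simp
  then have Neq: "4 * N ^ 2 * (N ^ 2 - a ^ 2) = c ^ (4 * D - 1)" by (simp only: of_int_eq_iff)
  have "c ^ (4 * D - 1) > 0" using c by simp
  then have "4 * N ^ 2 * (N ^ 2 - a ^ 2) > 0" by (simp only: Neq)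
  then have "N ^ 2 - a ^ 2 > 0" using zero_le_power2[of N] by (auto simp: zero_less_mult_iff)
  then have aN: "a < \<bar>N\<bar>" using a abs_le_square_iff[of N a] by simp
  define A C Y where "A = nat a" and "C = nat c" and "Y = nat \<bar>N\<bar>"
  have nats: "int A = a" "int C = c" "int Y = \<bar>N\<bar>" using a c by (auto simp: A_def C_def Y_def)
  have AY: "0 < A" "A < Y" using a aN by (auto simp: A_def Y_def)
  have "int (4 * Y ^ 2 * ((Y - A) * (Y + A))) = 4 * N ^ 2 * (N ^ 2 - a ^ 2)"
    using AY nats by (simp add: of_nat_diff) (simp add: power2_eq_square algebra_simps abs_mult_self)
  also have "\<dots> = int (C ^ (4 * D - 1))" using Neq nats by simp
  finally have nat_eq: "4 * Y ^ 2 * ((Y - A) * (Y + A)) = C ^ (4 * D - 1)" by (simp only: of_nat_eq_iff)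
  have "coprime (int A) (int C)" unfolding nats a_def by (rule coprime_iterate_num) simp
  then have cop: "coprime A C" by (simp only: coprime_int_iff)
  have m: "odd (4 * D - 1)" using D by simp
  have "A = 1 \<and> 4 * D - 1 = 3 \<or> 4 * D - 1 \<ge> 8"
  proof (cases k)
    case 0
    then show ?thesis by (simp add: A_def a_def D_def)
  next
    case (Suc k')
    then have "D \<ge> 4" by (simp add: D_def)
    then show ?thesis by linarith
  qed
  then show False by (rule quartic_obstruction[OF abc AY cop nat_eq m])
qed

text \<open>
  Since \<open>f = U(x^2)\<close> for \<open>U = x^2 + 1/c\<close>, the \<open>(k+1)\<close>-st iterate is \<open>U\<close> composed with the square of the \<open>k\<close>-th one. By Capelli's
  lemma it is enough that \<open>P k = (f^k)^2 - \<delta>\<close> is irreducible over \<open>\<rat>(\<delta>)\<close>, and this follows by induction from \<open>P (j+1) = P j \<circ> f\<close>.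
\<close>

lemma irreducible_iterate_quartic:
  assumes abc: explicit_abc_conjecture and c: "c > 0"
    and irr: "irreducible_over \<rat> (unicritical 4 c :: complex poly)"
  shows "irreducible_over \<rat> (poly_iterate (Suc k) (unicritical 4 c) :: complex poly)"
proof -
  interpret Q: alg_closed_subfield "\<rat> :: complex set" by (rule alg_closed_subfield_Rats)
  define \<delta> where "\<delta> = csqrt (- 1 / of_int c)"
  have \<delta>: "\<delta> ^ 2 = - 1 / of_int c" by (simp add: \<delta>_def)
  define U :: "complex poly" where "U = unicritical 2 c"
  have dQ: "\<delta> ^ 2 \<in> \<rat>" unfolding \<delta> by auto
  have Uroot: "poly U \<delta> = 0" using \<delta> by (simp add: U_def poly_monom)
  have degU: "degree U = 2" unfolding U_def by (rule degree_unicritical) simp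
  have UQ: "U \<in> polys_over \<rat>"
    unfolding U_def by (intro Q.add_polys_over Q.monom_polys_over Q.const_polys_over) auto
  have f_U: "unicritical 4 c = pcompose U (monom 1 2)"
    by (simp add: U_def pcompose_add pcompose_monom_monom)
  have Uirr: "irreducible_over \<rat> U" unfolding irreducible_over_def
  proof (intro conjI ballI impI)
    fix a b assume ab: "a \<in> polys_over \<rat>" "b \<in> polys_over \<rat>" "U = a * b"
    have "unicritical 4 c = pcompose a (monom 1 2) * pcompose b (monom 1 2)"
      unfolding f_U ab(3) by (rule pcompose_mult)
    moreover have "pcompose a (monom 1 2) \<in> polys_over \<rat>" "pcompose b (monom 1 2) \<in> polys_over \<rat>"
      using ab by auto
    ultimately have "degree (pcompose a (monom 1 2)) = 0 \<or> degree (pcompose b (monom 1 2)) = 0"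
      by (rule irreducible_overD[OF irr])
    then show "degree a = 0 \<or> degree b = 0" by (simp add: degree_pcompose degree_monom_eq)
  qed (use UQ degU in auto)
  define K where "K = adjoin \<rat> \<delta>"
  interpret K: alg_closed_subfield K
    unfolding K_def alg_closed_subfield_def by (rule Q.subfield_adjoin[OF Uirr Uroot])
  have QK: "x \<in> \<rat> \<Longrightarrow> x \<in> K" for x unfolding K_def by (rule Q.adjoin_superset)
  have dK: "\<delta> \<in> K" unfolding K_def by (rule Q.adjoin_generator)
  define F where "F = (\<lambda>j. poly_iterate j (unicritical 4 c) :: complex poly)"
  define P where "P = (\<lambda>j. F j ^ 2 - [:\<delta>:])"
  have FQ: "F j \<in> polys_over \<rat>" for j
    unfolding F_def by (subst poly_of_rat_iterate[symmetric]) (auto simp: polys_over_Rats_iff)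
  have FK: "F j \<in> polys_over K" for j using Q.polys_over_adjoin[OF FQ] by (simp add: K_def)
  have PK: "P j \<in> polys_over K" for j unfolding P_def using FK dK by auto
  have degF: "degree (F j) = 4 ^ j" "lead_coeff (F j) = 1" for j
    unfolding F_def by (rule monic_iterate; simp)+
  have degF2: "degree (F j ^ 2) = 2 * 4 ^ j" for j
    by (subst degree_power_eq) (use degF[of j] in auto)
  have degP: "degree (P j) = 2 * 4 ^ j" and lcP: "lead_coeff (P j) = 1" for j
  proof -
    have P: "P j = [:-\<delta>:] + F j ^ 2" by (simp add: P_def)
    have lt: "degree [:-\<delta>:] < degree (F j ^ 2)" by (simp add: degF2)
    show "degree (P j) = 2 * 4 ^ j" unfolding P by (subst degree_add_eq_right[OF lt]) (rule degF2)
    show "lead_coeff (P j) = 1" unfolding P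
      by (subst lead_coeff_add_le[OF lt]) (use degF in \<open>simp add: lead_coeff_power\<close>)
  qed
  have P_irr: "irreducible_over K (P j)" for j
  proof (induction j)
    case 0
    have P0: "P 0 = monom 1 2 - [:\<delta>:]"
      by (simp add: P_def F_def poly_iterate_def monom_altdef)
    show ?case unfolding irreducible_over_def
    proof (intro conjI ballI impI)
      fix a b assume ab: "a \<in> polys_over K" "b \<in> polys_over K" "P 0 = a * b"
      show "degree a = 0 \<or> degree b = 0"
      proof (rule ccontr)
        assume neg: "\<not> (degree a = 0 \<or> degree b = 0)"
        have nz: "a \<noteq> 0" "b \<noteq> 0" using ab(3) degP[of 0] by auto
        have "degree a + degree b = 2" using degP[of 0] ab(3) nz by (simp add: degree_mult_eq)
        then have "degree a = 1" using neg by linarith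
        then obtain a0 a1 where a: "a = [:a0, a1:]" "a1 \<noteq> 0"
          by (cases a) (auto split: if_splits elim!: degree_eq_zeroE)
        define \<gamma> where "\<gamma> = - a0 / a1"
        have "a0 \<in> K" "a1 \<in> K" using ab(1) a by auto
        then have "\<gamma> \<in> K" by (auto simp: \<gamma>_def)
        have "poly (P 0) \<gamma> = 0" using a by (simp add: ab(3) \<gamma>_def)
        then have \<gamma>2: "\<gamma> ^ 2 = \<delta>" by (simp add: P0 poly_monom)
        obtain x z where xz: "x \<in> \<rat>" "z \<in> \<rat>" "\<gamma> = x + z * \<delta>"
          using adjoin_quadratic[OF Q.subfield_axioms dQ] \<open>\<gamma> \<in> K\<close> K_def by metis
        \<comment> \<open>The conjugate of \<gamma> over the rationals is x - z \<delta>, so \<gamma> is a root of this rational quadratic.\<close>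
        define q where "q = [:x ^ 2 - z ^ 2 * \<delta> ^ 2, - 2 * x, 1:]"
        have "q \<in> polys_over \<rat>" unfolding q_def using xz dQ by auto
        moreover have "poly q \<gamma> = 0" by (simp add: q_def xz(3) power2_eq_square algebra_simps)
        moreover have "poly (unicritical 4 c) \<gamma> = 0"
          using \<gamma>2 \<delta> by (simp add: poly_monom power4_eq_xxxx power2_eq_square algebra_simps)
        ultimately have "unicritical 4 c dvd q"
          using Q.irreducible_over_dvd_if_common_root[OF irr] by blast
        moreover have "q \<noteq> 0" "degree q = 2" by (auto simp: q_def)
        ultimately have "degree (unicritical 4 c :: complex poly) \<le> 2" by (metis dvd_imp_degree_le)
        then show False using degree_unicritical[of 4 c, where 'a = complex] by simp
      qed
    qed (use PK degP[of 0] in auto)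
  next
    case (Suc j)
    have step: "P (Suc j) = pcompose (P j) (unicritical 4 c)"
      by (simp add: P_def F_def poly_iterate_Suc' pcompose_diff pcompose_power)
    show ?case
    proof (rule ccontr)
      assume "\<not> ?case"
      then have red: "\<not> irreducible_over K (pcompose (P j) (unicritical 4 c))" by (subst (asm) step)
      obtain p w where pw: "prime p" "p dvd 4" "w \<in> K" "poly (P j) (1 / of_int c) = w ^ p"
        by (rule K.iterate_step[OF Suc lcP _ _ _ red]) (use degP[of j] QK in auto)
      have "p dvd 2 ^ 2" using pw(2) by simp
      then have "p dvd 2" using pw(1) prime_dvd_power by blast
      then have "p = 2" using pw(1) primes_dvd_imp_eq two_is_prime_nat by blast
      have "poly (F j) (1 / of_int c) = of_int (iterate_num 4 c j) / of_int c ^ (4 ^ j)"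
        unfolding F_def using c by (subst poly_iterate_inverse_c) (simp_all add: poly_iterate_0_eq)
      then have "(of_int (iterate_num 4 c j) / of_int c ^ (4 ^ j)) ^ 2 - \<delta> = w ^ 2"
        using pw(4) \<open>p = 2\<close> by (simp add: P_def)
      then show False using quartic_norm_equation[OF abc \<delta> c] pw(3) K_def by blast
    qed
  qed
  have "degree (P k) > 0" using degP by simp
  then obtain z where "poly (P k) z = 0" using alg_closed_imp_poly_has_root by blast
  then have z: "poly (F k ^ 2) z = \<delta>" by (simp add: P_def)
  have "irreducible_over \<rat> (pcompose U (F k ^ 2))"
    by (rule Q.irreducible_over_pcompose_tower[OF Uirr Uroot _ _ _ z])
      (use FQ degF2 P_irr[of k] in \<open>auto simp: P_def K_def\<close>)
  also have "pcompose U (F k ^ 2) = poly_iterate (Suc k) (unicritical 4 c)"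
    by (simp add: U_def F_def pcompose_unicritical poly_iterate_Suc flip: power_mult)
  finally show ?thesis .
qed

lemma Rats_coprime_ratio:
  fixes P Q :: "'a::field_char_0"
  assumes "P \<in> \<rat>" "Q \<in> \<rat>" "Q \<noteq> 0"
  obtains p q :: int and \<rho> where "coprime p q" "q \<noteq> 0" "P = \<rho> * of_int p" "Q = \<rho> * of_int q" "\<rho> \<noteq> 0"
proof -
  have "P / Q \<in> \<rat>" using assms by auto
  then obtain t where t: "P / Q = of_rat t" by (elim Rats_cases)
  obtain p q where pq: "t = of_int p / of_int q" "q > 0" "coprime p q"
    by (metis quotient_of_denom_pos quotient_of_div quotient_of_coprime surj_pair)
  have "P / Q = of_int p / of_int q" unfolding t pq(1) by (simp add: of_rat_divide)
  then have "P = Q / of_int q * of_int p" "Q = Q / of_int q * of_int q"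
    using pq(2) assms(3) by (simp_all add: field_simps)
  then show ?thesis using that[of p q "Q / of_int q"] pq assms(3) by auto
qed

lemma cubic_cube_identities:
  fixes \<alpha> t :: "'a::comm_ring_1"
  assumes "\<alpha> ^ 3 = t"
  shows "(x + y * \<alpha> + z * \<alpha> ^ 2) ^ 3 =
    (x ^ 3 + t * y ^ 3 + t ^ 2 * z ^ 3 + 6 * t * x * y * z)
    + 3 * (x ^ 2 * y + t * y ^ 2 * z + t * x * z ^ 2) * \<alpha>
    + 3 * (x ^ 2 * z + x * y ^ 2 + t * y * z ^ 2) * \<alpha> ^ 2"
  unfolding assms[symmetric] by (simp add: power2_eq_square power3_eq_cube algebra_simps)

text \<open>
  The last equation says that \<open>P1 = x^2 z\<close>, \<open>P2 = x y^2\<close>, \<open>P3 = t y z^2\<close> have sum zero. The remaining quantities are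
  expressible by them: with \<open>\<pi> = x y z\<close> one has \<open>P1 P2 + P2 P3 + P3 P1 = -\<pi>/3\<close>, \<open>P1 P2 P3 = t \<pi>^3\<close>, and \<open>v \<pi>^2\<close> is a cubic
  form in the \<open>Pi\<close>. Replacing them by proportional coprime integers \<open>p\<close>, \<open>q\<close>, \<open>r\<close> and eliminating \<open>\<pi>\<close> and the factor
  \<open>\<rho>\<close> of proportionality leaves one homogeneous equation. This avoids any discussion of the ring of integers of
  \<open>\<rat>(\<alpha>)\<close>.
\<close>

lemma cubic_coordinates_obstruction:
  fixes x y z t v :: complex
  assumes abc: explicit_abc_conjecture
    and Q: "x \<in> \<rat>" "y \<in> \<rat>" "z \<in> \<rat>" and c: "c \<noteq> 0"
    and t: "t = - 1 / of_int c" and v: "v = of_int a / of_int c ^ D" and cop: "coprime a c"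
    and D: "odd D" "D \<ge> 3"
    and e1: "x ^ 3 + t * y ^ 3 + t ^ 2 * z ^ 3 + 6 * t * x * y * z = v"
    and e2: "3 * (x ^ 2 * y + t * y ^ 2 * z + t * x * z ^ 2) = - 1"
    and e3: "x ^ 2 * z + x * y ^ 2 + t * y * z ^ 2 = 0"
  shows False
proof -
  have t0: "t \<noteq> 0" using c t by simp
  have xyz: "x \<noteq> 0" "y \<noteq> 0" "z \<noteq> 0" using e2 e3 t0 by auto
  define P1 P2 P3 where "P1 = x ^ 2 * z" and "P2 = x * y ^ 2" and "P3 = t * y * z ^ 2"
  define \<pi> where "\<pi> = x * y * z"
  have tQ: "t \<in> \<rat>" unfolding t by auto
  have PQ: "P1 \<in> \<rat>" "P2 \<in> \<rat>" unfolding P1_def P2_def using Q by auto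
  have P0: "P1 \<noteq> 0" "P2 \<noteq> 0" "P3 \<noteq> 0" "\<pi> \<noteq> 0" using xyz t0 by (auto simp: P1_def P2_def P3_def \<pi>_def)
  have sum: "P1 + P2 + P3 = 0" using e3 by (simp add: P1_def P2_def P3_def)
  have s2: "3 * (P1 * P2 + P2 * P3 + P3 * P1) = - \<pi>"
  proof -
    have "3 * (P1 * P2 + P2 * P3 + P3 * P1) = \<pi> * (3 * (x ^ 2 * y + t * y ^ 2 * z + t * x * z ^ 2))"
      unfolding P1_def P2_def P3_def \<pi>_def by algebra
    then show ?thesis by (simp only: e2 mult_minus_right mult_1_right)
  qed
  have s3: "P1 * P2 * P3 = t * \<pi> ^ 3" unfolding P1_def P2_def P3_def \<pi>_def by algebra
  have s4: "v * \<pi> ^ 2 = P1 ^ 2 * P2 + P2 ^ 2 * P3 + P3 ^ 2 * P1 + 6 * P1 * P2 * P3"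
    unfolding P1_def P2_def P3_def \<pi>_def e1[symmetric] by algebra
  obtain p q :: int and \<rho> where pq: "coprime p q" "q \<noteq> 0" "P1 = \<rho> * of_int p" "P2 = \<rho> * of_int q" "\<rho> \<noteq> 0"
    using Rats_coprime_ratio[OF PQ P0(2)] by metis
  define r where "r = - (p + q)"
  have P3r: "P3 = \<rho> * of_int r" using sum pq(3,4) by (simp add: r_def algebra_simps eq_neg_iff_add_eq_0)
  have nz: "p \<noteq> 0" "q \<noteq> 0" "r \<noteq> 0" using P0 pq(3,4) P3r by auto
  define T F where "T = p ^ 2 + p * q + q ^ 2" and "F = p ^ 3 - 3 * p ^ 2 * q - 6 * p * q ^ 2 - q ^ 3"
  have eT: "3 * \<rho> ^ 2 * of_int T = \<pi>"
  proof -
    have "\<pi> = - (3 * (P1 * P2 + P2 * P3 + P3 * P1))" using s2 by simp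
    also have "\<dots> = 3 * \<rho> ^ 2 * of_int T"
      unfolding pq(3,4) P3r r_def T_def by (simp add: algebra_simps power2_eq_square)
    finally show ?thesis by simp
  qed
  have ep: "\<rho> ^ 3 * of_int (p * q * r) = t * \<pi> ^ 3"
    unfolding s3[symmetric] pq(3,4) P3r by (simp add: power3_eq_cube)
  have eF: "v * \<pi> ^ 2 = \<rho> ^ 3 * of_int F"
    unfolding s4 pq(3,4) P3r r_def F_def by (simp add: algebra_simps power2_eq_square power3_eq_cube)
  have "\<rho> ^ 9 * (27 * v ^ 3 * of_int (p * q * r) * of_int T ^ 3) = v ^ 3 * (\<rho> ^ 3 * of_int (p * q * r)) * (3 * \<rho> ^ 2 * of_int T) ^ 3"
    by (simp add: power_mult_distrib flip: power_mult)
  also have "\<dots> = t * (v * \<pi> ^ 2) ^ 3" unfolding ep eT by (simp add: power_mult_distrib flip: power_mult)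
  also have "\<dots> = \<rho> ^ 9 * (t * of_int F ^ 3)" unfolding eF by (simp add: power_mult_distrib flip: power_mult)
  finally have main: "27 * v ^ 3 * of_int (p * q * r) * of_int T ^ 3 = t * of_int F ^ 3"
    using pq(5) by simp
  have cD: "(of_int c :: complex) ^ (3 * D) = of_int c * of_int c ^ (3 * D - 1)"
    using D by (metis Suc_pred' mult_pos_pos odd_pos power_Suc zero_less_numeral)
  have "of_int (27 * a ^ 3 * (p * q * r) * T ^ 3) = of_int c ^ (3 * D) * (27 * v ^ 3 * of_int (p * q * r) * of_int T ^ 3)"
    using c by (simp add: v power_divide power_mult mult.commute[of 3])
  also have "\<dots> = of_int (- (c ^ (3 * D - 1) * F ^ 3))"
    unfolding main t cD using c by simp
  finally have eq: "27 * a ^ 3 * (p * q * r) * T ^ 3 = - (c ^ (3 * D - 1) * F ^ 3)"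
    by (simp only: of_int_eq_iff)
  have "even (3 * D - 1)" "3 * D - 1 \<ge> 8" using D by auto
  then show False
    by (rule cubic_obstruction[OF abc _ _ _ nz pq(1) cop T_def F_def eq]) (simp add: r_def)
qed

text \<open>
  The passage from the first iterate to the second, where \<open>v = 1/c\<close>. The norm of \<open>v - \<alpha>\<close> is \<open>1/c^3 + 1/c\<close> and equals the cube of the norm \<open>N\<close> of
  \<open>x + y \<alpha> + z \<alpha>^2\<close>, so \<open>c^2 + 1 = (c N)^3\<close>.
\<close>

lemma cubic_norm_obstruction:
  fixes x y z t :: complex
  assumes Q: "x \<in> \<rat>" "y \<in> \<rat>" "z \<in> \<rat>" and c: "c \<noteq> 0" and t: "t = - 1 / of_int c"
    and e1: "x ^ 3 + t * y ^ 3 + t ^ 2 * z ^ 3 + 6 * t * x * y * z = 1 / of_int c"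
    and e2: "3 * (x ^ 2 * y + t * y ^ 2 * z + t * x * z ^ 2) = - 1"
    and e3: "x ^ 2 * z + x * y ^ 2 + t * y * z ^ 2 = 0"
  shows False
proof -
  define N where "N = x ^ 3 + t * y ^ 3 + t ^ 2 * z ^ 3 - 3 * t * x * y * z"
  have id: "N ^ 3 = (x ^ 3 + t * y ^ 3 + t ^ 2 * z ^ 3 + 6 * t * x * y * z) ^ 3
      + t * (3 * (x ^ 2 * y + t * y ^ 2 * z + t * x * z ^ 2)) ^ 3
      + t ^ 2 * (3 * (x ^ 2 * z + x * y ^ 2 + t * y * z ^ 2)) ^ 3
      - 3 * t * (x ^ 3 + t * y ^ 3 + t ^ 2 * z ^ 3 + 6 * t * x * y * z)
        * (3 * (x ^ 2 * y + t * y ^ 2 * z + t * x * z ^ 2)) * (3 * (x ^ 2 * z + x * y ^ 2 + t * y * z ^ 2))"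
    unfolding N_def by algebra
  have "N ^ 3 = (1 / of_int c) ^ 3 + 1 / of_int c"
    unfolding id e1 e2 e3 by (simp add: t)
  then have eq: "(of_int c * N) ^ 3 = of_int (c ^ 2 + 1)"
    using c by (simp add: power_mult_distrib power_divide field_simps power2_eq_square power3_eq_cube)
  have "t \<in> \<rat>" unfolding t by auto
  then have "of_int c * N \<in> \<rat>" unfolding N_def using Q by auto
  then have "of_int c * N \<in> \<int>" by (rule Rats_power_of_int_imp_Ints[OF _ eq]) simp
  then obtain w where "of_int c * N = of_int w" by (elim Ints_cases)
  then have "of_int (w ^ 3) = (of_int (c ^ 2 + 1) :: complex)" using eq by simp
  then have "c ^ 2 + 1 = w ^ 3" by (simp only: of_int_eq_iff)
  then show False using square_plus_one_eq_cube c by blast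
qed

text \<open>
  Capelli's lemma with the outer polynomial \<open>f\<close> itself: the \<open>(k+1)\<close>-st iterate is \<open>f\<close> composed with the \<open>k\<close>-th one. For
  \<open>P j = f^j - \<alpha>\<close> the recursion \<open>P (j+1) = P j \<circ> f\<close> reduces irreducibility of \<open>P k\<close> over \<open>\<rat>(\<alpha>)\<close> to the fact that no \<open>v - \<alpha>\<close> on the critical orbit is a cube
  there.
\<close>

lemma irreducible_iterate_cubic:
  assumes abc: explicit_abc_conjecture and c: "c \<noteq> 0"
    and irr: "irreducible_over \<rat> (unicritical 3 c :: complex poly)"
  shows "irreducible_over \<rat> (poly_iterate (Suc k) (unicritical 3 c) :: complex poly)"
proof -
  interpret Q: alg_closed_subfield "\<rat> :: complex set" by (rule alg_closed_subfield_Rats)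
  define U :: "complex poly" where "U = unicritical 3 c"
  have degU: "degree U = 3" unfolding U_def by (rule degree_unicritical) simp
  obtain \<alpha> where \<alpha>: "poly U \<alpha> = 0" using alg_closed_imp_poly_has_root[of U] degU by auto
  define t :: complex where "t = - 1 / of_int c"
  have \<alpha>3: "\<alpha> ^ 3 = t" using \<alpha> by (simp add: U_def t_def poly_monom eq_neg_iff_add_eq_0)
  have tQ: "t \<in> \<rat>" unfolding t_def by auto
  have Uirr: "irreducible_over \<rat> U" using irr by (simp add: U_def)
  define K where "K = adjoin \<rat> \<alpha>"
  interpret K: alg_closed_subfield K
    unfolding K_def alg_closed_subfield_def by (rule Q.subfield_adjoin[OF Uirr \<alpha>])
  have QK: "x \<in> \<rat> \<Longrightarrow> x \<in> K" for x unfolding K_def by (rule Q.adjoin_superset)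
  have aK: "\<alpha> \<in> K" unfolding K_def by (rule Q.adjoin_generator)
  define F where "F = (\<lambda>j. poly_iterate j (unicritical 3 c) :: complex poly)"
  define P where "P = (\<lambda>j. F j - [:\<alpha>:])"
  have FQ: "F j \<in> polys_over \<rat>" for j
    unfolding F_def by (subst poly_of_rat_iterate[symmetric]) (auto simp: polys_over_Rats_iff)
  have FK: "F j \<in> polys_over K" for j using Q.polys_over_adjoin[OF FQ] by (simp add: K_def)
  have PK: "P j \<in> polys_over K" for j unfolding P_def using FK aK by auto
  have degF: "degree (F j) = 3 ^ j" "lead_coeff (F j) = 1" for j
    unfolding F_def by (rule monic_iterate; simp)+
  have degP: "degree (P j) = 3 ^ j" and lcP: "lead_coeff (P j) = 1" for j
  proof -
    have P: "P j = [:-\<alpha>:] + F j" by (simp add: P_def)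
    have lt: "degree [:-\<alpha>:] < degree (F j)" by (simp add: degF)
    show "degree (P j) = 3 ^ j" unfolding P by (subst degree_add_eq_right[OF lt]) (rule degF)
    show "lead_coeff (P j) = 1" unfolding P by (subst lead_coeff_add_le[OF lt]) (rule degF)
  qed
  have indep: "e0 = 0 \<and> e1 = 0 \<and> e2 = 0"
    if "e0 \<in> \<rat>" "e1 \<in> \<rat>" "e2 \<in> \<rat>" "e0 + e1 * \<alpha> + e2 * \<alpha> ^ 2 = 0" for e0 e1 e2
  proof -
    have "U dvd [:e0, e1, e2:]"
      using that by (intro Q.irreducible_over_dvd_if_common_root[OF Uirr _ \<alpha>])
        (auto simp: power2_eq_square algebra_simps)
    moreover have "degree [:e0, e1, e2:] \<le> 2" by simp
    ultimately have "[:e0, e1, e2:] = 0" using dvd_imp_degree_le[of U] degU by fastforce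
    then show ?thesis by simp
  qed
  have not_cube: "of_int (iterate_num 3 c j) / of_int c ^ (3 ^ j) - \<alpha> \<noteq> w ^ 3" if "w \<in> K" for j w
  proof
    assume eq: "of_int (iterate_num 3 c j) / of_int c ^ (3 ^ j) - \<alpha> = w ^ 3"
    define v :: complex where "v = of_int (iterate_num 3 c j) / of_int c ^ (3 ^ j)"
    have vQ: "v \<in> \<rat>" by (auto simp: v_def)
    obtain x y z where xyz: "x \<in> \<rat>" "y \<in> \<rat>" "z \<in> \<rat>" "w = x + y * \<alpha> + z * \<alpha> ^ 2"
      using adjoin_cubic[OF Q.subfield_axioms _ \<open>w \<in> K\<close>[unfolded K_def]] \<alpha>3 tQ by metis
    define e0 e1 e2 where "e0 = x ^ 3 + t * y ^ 3 + t ^ 2 * z ^ 3 + 6 * t * x * y * z - v"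
      and "e1 = 3 * (x ^ 2 * y + t * y ^ 2 * z + t * x * z ^ 2) + 1"
      and "e2 = 3 * (x ^ 2 * z + x * y ^ 2 + t * y * z ^ 2)"
    have "e0 + e1 * \<alpha> + e2 * \<alpha> ^ 2 = w ^ 3 - (v - \<alpha>)"
      unfolding xyz(4) cubic_cube_identities[OF \<alpha>3] e0_def e1_def e2_def by (simp add: algebra_simps)
    then have "e0 + e1 * \<alpha> + e2 * \<alpha> ^ 2 = 0" using eq by (simp add: v_def)
    moreover have "e0 \<in> \<rat>" "e1 \<in> \<rat>" "e2 \<in> \<rat>" unfolding e0_def e1_def e2_def using xyz tQ vQ by auto
    ultimately have "e0 = 0 \<and> e1 = 0 \<and> e2 = 0" by (intro indep)
    then have zero: "e0 = 0" "e1 = 0" "e2 = 0" by auto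
    have es: "x ^ 3 + t * y ^ 3 + t ^ 2 * z ^ 3 + 6 * t * x * y * z = v"
      "3 * (x ^ 2 * y + t * y ^ 2 * z + t * x * z ^ 2) = - 1"
      "x ^ 2 * z + x * y ^ 2 + t * y * z ^ 2 = 0"
      using zero unfolding e0_def e1_def e2_def
      by (simp, simp only: eq_neg_iff_add_eq_0, simp only: mult_eq_0_iff, simp)
    show False
    proof (cases j)
      case 0
      then have "v = 1 / of_int c" by (simp add: v_def)
      then show False using cubic_norm_obstruction[OF xyz(1-3) c t_def _ es(2,3)] es(1) by simp
    next
      case (Suc i)
      have "coprime (iterate_num 3 c j) c" by (rule coprime_iterate_num) simp
      then show False
        by (rule cubic_coordinates_obstruction[OF abc xyz(1-3) c t_def v_def _ _ _ es]) (use Suc in auto)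
    qed
  qed
  have P_irr: "irreducible_over K (P j)" for j
  proof (induction j)
    case 0
    show ?case unfolding irreducible_over_def
    proof (intro conjI ballI impI)
      fix a b assume ab: "a \<in> polys_over K" "b \<in> polys_over K" "P 0 = a * b"
      have nz: "a \<noteq> 0" "b \<noteq> 0" using ab(3) degP[of 0] lcP[of 0] by auto
      have "degree a + degree b = 1" using degP[of 0] ab(3) nz by (simp add: degree_mult_eq)
      then show "degree a = 0 \<or> degree b = 0" by linarith
    qed (use PK degP[of 0] in auto)
  next
    case (Suc j)
    have step: "P (Suc j) = pcompose (P j) (unicritical 3 c)"
      by (simp add: P_def F_def poly_iterate_Suc' pcompose_diff)
    show ?case
    proof (rule ccontr)
      assume "\<not> ?case"
      then have red: "\<not> irreducible_over K (pcompose (P j) (unicritical 3 c))" by (subst (asm) step)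
      obtain p w where pw: "prime p" "p dvd 3" "w \<in> K" "poly (P j) (1 / of_int c) = w ^ p"
        by (rule K.iterate_step[OF Suc lcP _ _ _ red]) (use QK in auto)
      have "prime (3::nat)" by simp
      then have "p = 3" using pw(1,2) primes_dvd_imp_eq by blast
      have "poly (F j) (1 / of_int c) = of_int (iterate_num 3 c j) / of_int c ^ (3 ^ j)"
        unfolding F_def using c by (subst poly_iterate_inverse_c) (simp_all add: poly_iterate_0_eq)
      then have "of_int (iterate_num 3 c j) / of_int c ^ (3 ^ j) - \<alpha> = w ^ 3"
        using pw(4) \<open>p = 3\<close> by (simp add: P_def)
      then show False using not_cube pw(3) by blast
    qed
  qed
  have "degree (P k) > 0" using degP by simp
  then obtain z where "poly (P k) z = 0" using alg_closed_imp_poly_has_root by blast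
  then have z: "poly (F k) z = \<alpha>" by (simp add: P_def)
  have "irreducible_over \<rat> (pcompose U (F k))"
    by (rule Q.irreducible_over_pcompose_tower[OF Uirr \<alpha> _ _ _ z])
      (use FQ degF P_irr[of k] in \<open>auto simp: P_def K_def\<close>)
  also have "pcompose U (F k) = poly_iterate (Suc k) (unicritical 3 c)"
    by (simp add: U_def F_def poly_iterate_Suc)
  finally show ?thesis .
qed

theorem theorem2:
  fixes d :: nat and c :: int
  assumes "explicit_abc_conjecture"
    and "d \<ge> 3"
    and "c \<noteq> 0"
    and "irreducible (monom 1 d + [:1 / of_int c:] :: rat poly)"
  shows "stable_over_Q (monom 1 d + [:1 / of_int c:] :: rat poly)"
proof -
  let ?f = "monom 1 d + [:1 / of_int c:] :: rat poly"
  have "poly_of_rat ?f = unicritical d c" using poly_of_rat_iterate[of 1 d c] by (simp only: poly_iterate_1)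
  then have irr: "irreducible_over \<rat> (unicritical d c :: complex poly)"
    using assms(4) irreducible_over_Rats_iff[of ?f] by simp
  have c1: "c \<noteq> -1"
  proof
    assume "c = -1"
    \<comment> \<open>For c = -1 the polynomial z^d - 1 has the root 1.\<close>
    then have "[:-1, 1:] dvd ?f" by (simp add: poly_eq_0_iff_dvd[symmetric] poly_monom)
    then obtain q where q: "?f = [:-1, 1:] * q" by (elim dvdE)
    then have "is_unit [:-1, 1::rat:] \<or> is_unit q" using assms(4) by (rule irreducibleD[rotated])
    moreover have "q \<noteq> 0" using q assms(4) by auto
    ultimately have "degree q = 0" by (auto simp: is_unit_iff_degree)
    moreover have "degree ?f = 1 + degree q" unfolding q using \<open>q \<noteq> 0\<close> by (subst degree_mult_eq) auto
    moreover have "degree ?f = d" by (rule degree_unicritical) (use assms(2) in simp)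
    ultimately show False using assms(2) by simp
  qed
  consider "d = 3" | "d = 4" "c > 0" | "d \<ge> 5 \<or> d = 4 \<and> c < 0" using assms(2,3) by linarith
  then have main: "irreducible_over \<rat> (poly_iterate (Suc k) (unicritical d c) :: complex poly)" for k
  proof cases
    case 1
    then show ?thesis using irreducible_iterate_cubic[OF assms(1,3)] irr by blast
  next
    case 2
    then show ?thesis using irreducible_iterate_quartic[OF assms(1)] irr by blast
  next
    case 3
    then show ?thesis using irreducible_iterate_generic[OF assms(1) _ assms(3) c1 irr] by blast
  qed
  show ?thesis unfolding stable_over_Q_def
  proof (intro allI impI)
    fix n :: nat assume "n \<ge> 1"
    then obtain k where "n = Suc k" by (cases n) auto
    then have "irreducible_over \<rat> (poly_of_rat (poly_iterate n ?f))"
      using main[of k] by (simp only: poly_of_rat_iterate)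
    then show "irreducible (poly_iterate n ?f)" by (simp only: irreducible_over_Rats_iff)
  qed
qed

end
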